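(* Let $d\ge 1$ and $n\ge 1$ be integers, let $P:\mathbb R^d\to\mathbb R$ be a polynomial of degree at most $n$, and let $p\ge 2$ be real. Then $$\|DP\|_{L^p(\gamma_d;\mathbb R^d)}\le \frac{2\sqrt{2en}}{m_p}\,\|P\|_{L^p(\gamma_d)},$$ where $m_p:=\bigl(\mathbb E_{g\sim\gamma_1}|g|^p\bigr)^{1/p}\asymp\sqrt p$ is the $L^p$ norm of a standard Gaussian. Consequently, $$\|DP\|_{L^p(\gamma_d;\mathbb R^d)}\le 2e\sqrt2\,\sqrt{\frac np}\,\|P\|_{L^p(\gamma_d)}.$$ In both inequalities the factor $2$ may be omitted (i.e. the constants become $\sqrt{2en}/m_p$ and $e\sqrt2\,\sqrt{n/p}$) if $p$ is an even integer or if $P$ is even or odd.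
   Context: $\gamma_d$ is the standard Gaussian measure on $\mathbb R^d$. $DP$ is the gradient of $P$, and $\|DP\|_{L^p(\gamma_d;\mathbb R^d)}=\bigl(\int|DP|^p\,d\gamma_d\bigr)^{1/p}$ with $|\cdot|$ the Euclidean norm. $P$ even means $P(-x)=P(x)$ for all $x$, and odd means $P(-x)=-P(x)$ for all $x$. The notation $m_p\asymp\sqrt p$ means $c\sqrt p\le m_p\le C\sqrt p$ for all $p\ge2$ with universal constants $c,C>0$. *)

theory Defs
  imports "HOL-Probability.Probability"
begin

text \<open>
  The standard Gaussian measure on a Euclidean space; on \<^typ>\<open>real ^ 'd\<close> it is \<open>\<gamma>\<^sub>d\<close> with
  \<open>d = CARD('d)\<close>, on \<^typ>\<open>real\<close> it is \<open>\<gamma>\<^sub>1\<close>.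
\<close>

definition gaussian :: "'a::euclidean_space measure" where
  "gaussian = density lborel
     (\<lambda>x. ennreal ((2 * pi) powr (- real DIM('a) / 2) * exp (- (norm x)\<^sup>2 / 2)))"

lemma gaussian_real_eq:
  "(gaussian :: real measure) = density lborel (\<lambda>x. ennreal (std_normal_density x))"
proof -
  have "(2 * pi) powr (- real DIM(real) / 2) * exp (- (norm x)\<^sup>2 / 2) = std_normal_density x"
    for x :: real
  proof -
    have "(2 * pi) powr (- real DIM(real) / 2) = 1 / sqrt (2 * pi)"
      using powr_minus_divide[of "2 * pi" "1 / 2"] powr_half_sqrt[of "2 * pi"] by simp
    then show ?thesis
      by (simp only: std_normal_density_def real_norm_def power2_abs)
  qed
  then show ?thesis
    by (simp only: gaussian_def)
qed

text \<open>
  The Bochner integral is \<open>0\<close> for non-integrable integrands. This does not matter below: the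
  functions involved have polynomial growth, hence all moments with respect to a Gaussian measure.
\<close>

definition Lp_norm :: "'a measure \<Rightarrow> real \<Rightarrow> ('a \<Rightarrow> 'b::real_normed_vector) \<Rightarrow> real" where
  "Lp_norm M p f = (\<integral>x. norm (f x) powr p \<partial>M) powr (1 / p)"

definition gauss_moment :: "real \<Rightarrow> real" where
  "gauss_moment p = Lp_norm (gaussian :: real measure) p (\<lambda>g. g)"

definition polynomial_degree_le :: "nat \<Rightarrow> (real ^ 'd \<Rightarrow> real) \<Rightarrow> bool" where
  "polynomial_degree_le n P \<longleftrightarrow>
     (\<exists>c :: ('d \<Rightarrow> nat) \<Rightarrow> real. \<forall>x.
        P x = (\<Sum>\<alpha> \<in> {\<alpha>. (\<Sum>i\<in>UNIV. \<alpha> i) \<le> n}. c \<alpha> * (\<Prod>i\<in>UNIV. (x $ i) ^ \<alpha> i)))"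

text \<open>The index set is finite, so the sum above is a genuine one.\<close>

lemma finite_multi_indices: "finite {\<alpha> :: 'd::finite \<Rightarrow> nat. (\<Sum>i\<in>UNIV. \<alpha> i) \<le> n}"
proof (rule finite_subset)
  show "{\<alpha> :: 'd \<Rightarrow> nat. (\<Sum>i\<in>UNIV. \<alpha> i) \<le> n} \<subseteq> PiE UNIV (\<lambda>_. {..n})"
  proof
    fix \<alpha> :: "'d \<Rightarrow> nat" assume \<alpha>: "\<alpha> \<in> {\<alpha>. (\<Sum>i\<in>UNIV. \<alpha> i) \<le> n}"
    have "\<alpha> i \<le> n" for i
    proof -
      have "\<alpha> i \<le> (\<Sum>i\<in>UNIV. \<alpha> i)"
        by (rule member_le_sum) simp_all
      with \<alpha> show ?thesis by simp
    qed
    then show "\<alpha> \<in> PiE UNIV (\<lambda>_. {..n})"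
      by (simp add: PiE_UNIV_domain)
  qed
  show "finite (PiE (UNIV :: 'd set) (\<lambda>_. {..n}))"
    by (rule finite_PiE) simp_all
qed

definition gradient :: "('a::real_inner \<Rightarrow> real) \<Rightarrow> 'a \<Rightarrow> 'a" where
  "gradient f x = (THE D. GDERIV f x :> D)"

lemma gradient_eq:
  assumes "GDERIV f x :> D"
  shows "gradient f x = D"
  unfolding gradient_def
proof (rule the_equality)
  fix E assume "GDERIV f x :> E"
  then have "(\<lambda>h. inner h E) = (\<lambda>h. inner h D)"
    using assms unfolding gderiv_def by (rule has_derivative_unique)
  then have "inner (E - D) E = inner (E - D) D"
    by (rule fun_cong)
  then have "inner (E - D) (E - D) = 0"
    by (simp add: inner_diff_right)
  then show "E = D" by simp
qed (fact assms)

end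

theory Submission
  imports Defs "HOL-Complex_Analysis.Cauchy_Integral_Formula"
begin

text \<open>
  Let $x, y$ be independent standard Gaussian vectors. For fixed $x$ one has
  $E_y |DP(x) \cdot y|^p = m_p^p\,|DP(x)|^p$, and $DP(x) \cdot y = T'(0)$ for the entire function
  $T(\zeta) = P(x \cos\zeta + y \sin\zeta)$. By rotation invariance the law of
  $T(\theta + i\eta)$ is that of $P(x \cosh\eta + i y \sinh\eta)$. If
  $$E|P(x \cosh\eta + i y \sinh\eta)|^p \le \cosh(2\eta)^{np/2}\,E|P(x)|^p, \qquad (*)$$
  then, as $\cosh(2\eta) \le e^{2\eta^2}$, Cauchy's estimate on the circle of radius $1/\sqrt{2n}$ gives
  $E|DP(x) \cdot y|^p \le (2en)^{p/2}\,E|P(x)|^p$.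

  For $P$ even or odd, (*) is proved by homogenising: let $\tilde P(s, z)$ be weighted homogeneous, with $s$ of
  weight $2$, and $\tilde P(1, z) = P(z)$. Consider $k(s) = E|\tilde P(s, Z)|^p$ for a complex Gaussian
  vector $Z$ with $E|Z_i|^2 = u$ and $E Z_i^2 = s$, $|s| \le u$. By homogeneity $k$ depends only on
  $|s|$, and $\partial_s \partial_{\bar s} k = E|(\partial_s + \frac12 \sum_i \partial_i^2) \tilde P^{p/2}|^2 \ge 0$
  for $p \ge 2$, so that $k$ is subharmonic and therefore increasing in $|s|$; with $u = \cosh 2\eta$ the
  inequality $k(1) \le k(u)$ is (*). To make sense of this at the zeros of $\tilde P$, $|\tilde P|^p$ is replaced
  by $(|\tilde P|^2 + \varepsilon)^{p/2}$.

  If $p$ is an even integer, the even and odd parts of $P^{p/2}$ are orthogonal and (*) follows from its case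
  $p = 2$. In general, $P$ is split into its even and odd part, which costs the factor $2$.
\<close>

definition tame :: "('a::real_normed_vector \<Rightarrow> 'b::real_normed_vector) \<Rightarrow> bool" where
  "tame f \<longleftrightarrow> continuous_on UNIV f \<and> (\<exists>C m. \<forall>x. norm (f x) \<le> C * (1 + norm x) ^ m)"

lemma tameI: "continuous_on UNIV f \<Longrightarrow> (\<And>x. norm (f x) \<le> C * (1 + norm x) ^ m) \<Longrightarrow> tame f"
  unfolding tame_def by blast

lemma tame_continuous: "tame f \<Longrightarrow> continuous_on UNIV f"
  unfolding tame_def by blast

lemma tameE:
  assumes "tame f"
  obtains C m where "C \<ge> 1" "\<And>x. norm (f x) \<le> C * (1 + norm x) ^ m"
proof -
  obtain C m where *: "\<And>x. norm (f x) \<le> C * (1 + norm x) ^ m"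
    using assms unfolding tame_def by blast
  have "norm (f x) \<le> max C 1 * (1 + norm x) ^ m" for x
    by (rule order_trans[OF * mult_right_mono]) auto
  then show ?thesis using that[of "max C 1" m] by auto
qed

lemma tame_measurable [measurable_dest]: "tame f \<Longrightarrow> f \<in> borel_measurable borel"
  unfolding tame_def by (blast intro: borel_measurable_continuous_onI)

lemma tame_const [intro]: "tame (\<lambda>_. c)"
  by (rule tameI[of _ "norm c" 0]) auto

lemma tame_id [intro]: "tame (\<lambda>x. x)"
  by (rule tameI[of _ 1 1]) auto

lemma tame_add [intro]:
  assumes "tame f" "tame g" shows "tame (\<lambda>x. f x + g x)"
proof -
  obtain C m where 1: "C \<ge> 1" "\<And>x. norm (f x) \<le> C * (1 + norm x) ^ m" using tameE[OF assms(1)] by blast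
  obtain D k where 2: "D \<ge> 1" "\<And>x. norm (g x) \<le> D * (1 + norm x) ^ k" using tameE[OF assms(2)] by blast
  show ?thesis
  proof (rule tameI)
    show "continuous_on UNIV (\<lambda>x. f x + g x)"
      by (intro continuous_on_add tame_continuous assms)
    fix x
    have "norm (f x + g x) \<le> C * (1 + norm x) ^ m + D * (1 + norm x) ^ k"
      using 1(2)[of x] 2(2)[of x] norm_triangle_ineq[of "f x" "g x"] by linarith
    also have "\<dots> \<le> C * (1 + norm x) ^ (m + k) + D * (1 + norm x) ^ (m + k)"
      using 1 2 by (intro add_mono mult_left_mono power_increasing) auto
    finally show "norm (f x + g x) \<le> (C + D) * (1 + norm x) ^ (m + k)" by (simp add: algebra_simps)
  qed
qed

lemma tame_bilinear:
  assumes "bounded_bilinear b" "tame f" "tame g" shows "tame (\<lambda>x. b (f x) (g x))"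
proof -
  obtain C m where 1: "C \<ge> 1" "\<And>x. norm (f x) \<le> C * (1 + norm x) ^ m" using tameE[OF assms(2)] by blast
  obtain D k where 2: "D \<ge> 1" "\<And>x. norm (g x) \<le> D * (1 + norm x) ^ k" using tameE[OF assms(3)] by blast
  obtain K where K: "K > 0" "\<And>u v. norm (b u v) \<le> norm u * norm v * K"
    using bounded_bilinear.pos_bounded[OF assms(1)] by blast
  show ?thesis
  proof (rule tameI)
    show "continuous_on UNIV (\<lambda>x. b (f x) (g x))"
      by (rule bounded_bilinear.continuous_on[OF assms(1) tame_continuous[OF assms(2)] tame_continuous[OF assms(3)]])
    fix x
    have "norm (b (f x) (g x)) \<le> norm (f x) * norm (g x) * K" by (rule K)
    also have "\<dots> \<le> (C * (1 + norm x) ^ m) * (D * (1 + norm x) ^ k) * K"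
      using 1 2 K(1) by (intro mult_right_mono mult_mono) auto
    finally show "norm (b (f x) (g x)) \<le> (C * D * K) * (1 + norm x) ^ (m + k)"
      by (simp add: algebra_simps power_add)
  qed
qed

lemma tame_mult [intro]:
  fixes f g :: "_ \<Rightarrow> 'b::real_normed_algebra"
  shows "tame f \<Longrightarrow> tame g \<Longrightarrow> tame (\<lambda>x. f x * g x)"
  by (rule tame_bilinear[OF bounded_bilinear_mult])

lemma tame_scaleR [intro]: "tame f \<Longrightarrow> tame g \<Longrightarrow> tame (\<lambda>x. f x *\<^sub>R g x)"
  by (rule tame_bilinear[OF bounded_bilinear_scaleR])

lemma tame_compose:
  fixes f :: "'b::real_normed_vector \<Rightarrow> 'c::real_normed_vector" and g :: "'a::real_normed_vector \<Rightarrow> 'b"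
  assumes "tame f" "tame g" shows "tame (\<lambda>x. f (g x))"
proof -
  obtain C m where 1: "C \<ge> 1" "\<And>x. norm (f x) \<le> C * (1 + norm x) ^ m" using tameE[OF assms(1)] by blast
  obtain D k where 2: "D \<ge> 1" "\<And>x. norm (g x) \<le> D * (1 + norm x) ^ k" using tameE[OF assms(2)] by blast
  show ?thesis
  proof (rule tameI)
    show "continuous_on UNIV (\<lambda>x. f (g x))"
      by (rule continuous_on_compose2[OF tame_continuous[OF assms(1)] tame_continuous[OF assms(2)]]) auto
    fix x :: 'a
    have "1 \<le> (1 + norm x) ^ k" by (intro one_le_power) simp
    then have "1 + norm (g x) \<le> (1 + D) * (1 + norm x) ^ k"
      using 2(2)[of x] unfolding distrib_right by linarith
    then have "C * (1 + norm (g x)) ^ m \<le> C * ((1 + D) * (1 + norm x) ^ k) ^ m"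
      using 1(1) by (intro mult_left_mono power_mono) auto
    then show "norm (f (g x)) \<le> (C * (1 + D) ^ m) * (1 + norm x) ^ (k * m)"
      using 1(2)[of "g x"] by (simp add: power_mult_distrib power_mult)
  qed
qed

lemma tame_bounded_linear: "bounded_linear f \<Longrightarrow> tame f"
proof -
  assume f: "bounded_linear f"
  then obtain K where K: "K > 0" "\<And>x. norm (f x) \<le> norm x * K"
    using bounded_linear.pos_bounded by blast
  show "tame f"
  proof (rule tameI[of _ K 1])
    show "continuous_on UNIV f" using f by (rule bounded_linear.continuous_on) auto
    show "norm (f x) \<le> K * (1 + norm x) ^ 1" for x
      using K(1) K(2)[of x] by (simp add: algebra_simps)
  qed
qed

lemma tame_power [intro]:
  fixes f :: "_ \<Rightarrow> 'b::real_normed_algebra_1"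
  shows "tame f \<Longrightarrow> tame (\<lambda>x. f x ^ n)"
  by (induction n) auto

lemma tame_uminus [intro]: "tame f \<Longrightarrow> tame (\<lambda>x. - f x)"
  by (rule tame_compose[OF tame_bounded_linear[OF bounded_linear_minus[OF bounded_linear_ident]]])

lemma tame_diff [intro]: "tame f \<Longrightarrow> tame g \<Longrightarrow> tame (\<lambda>x. f x - g x)"
  using tame_add[OF _ tame_uminus] by fastforce

lemma tame_sum [intro]: "(\<And>i. i \<in> I \<Longrightarrow> tame (f i)) \<Longrightarrow> tame (\<lambda>x. \<Sum>i\<in>I. f i x)"
  by (induction I rule: infinite_finite_induct) auto

lemma tame_cnj [intro]: "tame f \<Longrightarrow> tame (\<lambda>x. cnj (f x))"
  by (rule tame_compose[OF tame_bounded_linear[OF bounded_linear_cnj]])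

lemma tame_of_real [intro]:
  "tame f \<Longrightarrow> tame (\<lambda>x. of_real (f x) :: 'b::{real_normed_algebra_1})"
  by (rule tame_compose[OF tame_bounded_linear[OF bounded_linear_of_real]])

lemma tame_Re [intro]: "tame f \<Longrightarrow> tame (\<lambda>x. Re (f x))"
  by (rule tame_compose[OF tame_bounded_linear[OF bounded_linear_Re]])

lemma tame_norm [intro]: "tame f \<Longrightarrow> tame (\<lambda>x. norm (f x))"
  unfolding tame_def by (auto intro: continuous_on_norm)

lemma tame_bound:
  assumes "continuous_on UNIV f" "tame g" "\<And>x. norm (f x) \<le> norm (g x)"
  shows "tame f"
proof -
  obtain C m where "\<And>x. norm (g x) \<le> C * (1 + norm x) ^ m" using tameE[OF assms(2)] by blast
  then show ?thesis using tameI[OF assms(1)] assms(3) order_trans by metis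
qed

lemma tame_powr:
  fixes f :: "_ \<Rightarrow> real"
  assumes f: "tame f" and nn: "\<And>x. f x \<ge> 0" and q: "q > 0"
  shows "tame (\<lambda>x. f x powr q)"
proof (rule tame_bound)
  show "continuous_on UNIV (\<lambda>x. f x powr q)"
    by (rule continuous_on_powr'[OF tame_continuous[OF f] continuous_on_const]) (use nn q in auto)
  show "tame (\<lambda>x. (1 + f x) ^ nat \<lceil>q\<rceil>)"
    by (intro tame_power tame_add tame_const f)
  fix x
  have "f x powr q \<le> (1 + f x) powr q" using nn q by (intro powr_mono2) auto
  also have "\<dots> \<le> (1 + f x) powr real (nat \<lceil>q\<rceil>)"
    using nn[of x] q by (intro powr_mono) linarith+
  also have "\<dots> = (1 + f x) ^ nat \<lceil>q\<rceil>" using nn[of x] by (intro powr_realpow) linarith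
  finally show "norm (f x powr q) \<le> norm ((1 + f x) ^ nat \<lceil>q\<rceil>)" using nn[of x] by simp
qed

section \<open>Gaussian measure\<close>

definition gauss_dens :: "'a::euclidean_space \<Rightarrow> real" where
  "gauss_dens x = (2 * pi) powr (- real DIM('a) / 2) * exp (- (norm x)\<^sup>2 / 2)"

lemma gaussian_density: "gaussian = density lborel (\<lambda>x. ennreal (gauss_dens x))"
  unfolding gaussian_def gauss_dens_def ..

lemma gauss_dens_pos: "gauss_dens x > 0"
  unfolding gauss_dens_def by simp

lemma gauss_dens_measurable [measurable]: "gauss_dens \<in> borel_measurable borel"
  unfolding gauss_dens_def by measurable

lemma sets_gaussian [measurable_cong, simp]: "sets gaussian = sets borel"
  and space_gaussian [simp]: "space gaussian = UNIV"
  unfolding gaussian_density by auto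

lemma gauss_dens_prod: "gauss_dens (x :: 'a::euclidean_space) = (\<Prod>b\<in>Basis. std_normal_density (x \<bullet> b))"
proof -
  have "(norm x)\<^sup>2 = (\<Sum>b\<in>Basis. (x \<bullet> b)\<^sup>2)"
    by (subst power2_norm_eq_inner, subst euclidean_inner) (simp add: power2_eq_square)
  then have "exp (- (norm x)\<^sup>2 / 2) = (\<Prod>b\<in>Basis. exp (- (x \<bullet> b)\<^sup>2 / 2))"
    by (simp add: exp_sum[symmetric] sum_negf sum_divide_distrib)
  moreover have "(1 / sqrt (2 * pi)) ^ DIM('a) = (2 * pi) powr (- real DIM('a) / 2)"
    by (simp add: powr_half_sqrt[symmetric] powr_minus_divide[symmetric] powr_realpow[symmetric] powr_powr)
  ultimately show ?thesis
    unfolding gauss_dens_def std_normal_density_def by (simp only: prod.distrib prod_constant)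
qed

lemma prob_space_gaussian: "prob_space (gaussian :: 'a::euclidean_space measure)"
proof
  have "emeasure (gaussian :: 'a measure) (space gaussian) = (\<integral>\<^sup>+x. ennreal (gauss_dens x) \<partial>(lborel :: 'a measure))"
    unfolding gaussian_density by (subst emeasure_density) auto
  also have "\<dots> = (\<integral>\<^sup>+x. (\<Prod>b\<in>Basis. ennreal (std_normal_density (x \<bullet> b))) \<partial>(lborel :: 'a measure))"
    by (simp add: gauss_dens_prod prod_ennreal)
  also have "\<dots> = (\<Prod>b\<in>(Basis::'a set). (\<integral>\<^sup>+x. ennreal (std_normal_density x) \<partial>lborel))"
    by (rule nn_integral_lborel_prod) auto
  also have "(\<integral>\<^sup>+x. ennreal (std_normal_density x) \<partial>lborel) = 1"
  proof -
    interpret prob_space "density lborel (\<lambda>x. ennreal (std_normal_density x))"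
      by (rule prob_space_normal_density) auto
    show ?thesis using emeasure_space_1 by (subst (asm) emeasure_density) auto
  qed
  finally show "emeasure (gaussian :: 'a measure) (space gaussian) = 1" by simp
qed

lemma gaussian_pair:
  "(gaussian :: ('a::euclidean_space \<times> 'b::euclidean_space) measure) = gaussian \<Otimes>\<^sub>M gaussian"
proof -
  interpret A: prob_space "gaussian :: 'a measure" by (rule prob_space_gaussian)
  interpret B: prob_space "gaussian :: 'b measure" by (rule prob_space_gaussian)
  have "gaussian \<Otimes>\<^sub>M gaussian = density (lborel \<Otimes>\<^sub>M lborel)
      (\<lambda>(x :: 'a, y :: 'b). ennreal (gauss_dens x) * ennreal (gauss_dens y))"
    unfolding gaussian_density
    by (rule pair_measure_density) (auto simp: gaussian_density[symmetric] intro: lborel.sigma_finite_measure_axioms B.sigma_finite_measure_axioms)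
  also have "\<dots> = density lborel (\<lambda>z :: 'a \<times> 'b. ennreal (gauss_dens z))"
    unfolding lborel_prod
  proof (rule density_cong)
    show "AE z in lborel. (case z of (x :: 'a, y :: 'b) \<Rightarrow> ennreal (gauss_dens x) * ennreal (gauss_dens y)) = ennreal (gauss_dens z)"
    proof (rule AE_I2)
      fix z :: "'a \<times> 'b"
      obtain x y where z: "z = (x, y)" by force
      have "gauss_dens x * gauss_dens y = gauss_dens (x, y)"
        unfolding gauss_dens_def norm_Pair
        by (simp add: exp_add[symmetric] powr_add[symmetric] add_divide_distrib field_simps)
      then show "(case z of (x :: 'a, y :: 'b) \<Rightarrow> ennreal (gauss_dens x) * ennreal (gauss_dens y)) = ennreal (gauss_dens z)"
        using gauss_dens_pos[of x] gauss_dens_pos[of y] by (simp add: z ennreal_mult[symmetric] less_imp_le)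
    qed
  next
    show "(\<lambda>(x :: 'a, y :: 'b). ennreal (gauss_dens x) * ennreal (gauss_dens y)) \<in> borel_measurable lborel"
      unfolding lborel_prod[symmetric] by measurable
  qed measurable
  finally show ?thesis by (simp add: gaussian_density)
qed

lemma power_le_exp_bound:
  "\<exists>C>0. \<forall>t\<ge>0. (1 + t) ^ m * exp (- t\<^sup>2 / 2) \<le> C * exp (- t\<^sup>2 / (4::real))"
proof -
  define k where "k = real (Suc m)"
  have k: "k > 0" unfolding k_def by simp
  have "(1 + t) ^ m * exp (- t\<^sup>2 / 2) \<le> (k ^ m * exp 2) * exp (- t\<^sup>2 / 4)" if t: "t \<ge> 0" for t :: real
  proof -
    have "(1 + t) / k \<le> exp ((1 + t) / k)" using exp_ge_add_one_self[of "(1 + t) / k"] by linarith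
    then have "1 + t \<le> k * exp ((1 + t) / k)" using k by (simp add: field_simps)
    then have "(1 + t) ^ m \<le> (k * exp ((1 + t) / k)) ^ m" using t by (intro power_mono) auto
    also have "\<dots> = k ^ m * exp (real m * ((1 + t) / k))"
      by (simp only: power_mult_distrib exp_of_nat_mult)
    also have "\<dots> \<le> k ^ m * exp (1 + t)"
      using k t by (intro mult_left_mono) (auto simp: k_def field_simps)
    finally have "(1 + t) ^ m * exp (- t\<^sup>2 / 2) \<le> k ^ m * (exp (1 + t) * exp (- t\<^sup>2 / 2))"
      by (simp add: mult_right_mono mult.assoc)
    also have "exp (1 + t) * exp (- t\<^sup>2 / 2) \<le> exp 2 * exp (- t\<^sup>2 / 4)"
    proof -
      have "0 \<le> (t - 2)\<^sup>2" by simp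
      then have "(1 + t) + (- t\<^sup>2 / 2) \<le> 2 + (- t\<^sup>2 / 4)" by (simp add: power2_eq_square algebra_simps)
      then show ?thesis unfolding exp_add[symmetric] by simp
    qed
    finally show ?thesis using k by (simp add: mult_left_mono algebra_simps)
  qed
  then show ?thesis using k by (intro exI[of _ "k ^ m * exp 2"]) auto
qed

lemma integrable_lborel_exp_norm:
  "integrable (lborel :: 'a::euclidean_space measure) (\<lambda>x. exp (- (norm x)\<^sup>2 / 4))"
proof (rule integrableI_bounded)
  have n2: "(norm x)\<^sup>2 = (\<Sum>b\<in>Basis. (x \<bullet> b)\<^sup>2)" for x :: 'a
    by (subst power2_norm_eq_inner, subst euclidean_inner) (simp add: power2_eq_square)
  have *: "exp (- (norm x)\<^sup>2 / 4) = (\<Prod>b\<in>Basis. exp (- (x \<bullet> b)\<^sup>2 / 4))" for x :: 'a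
    by (simp add: n2 exp_sum[symmetric] sum_negf sum_divide_distrib)
  have "integrable lborel (\<lambda>x::real. normal_density 0 (sqrt 2) x * sqrt (4 * pi))"
    by (intro integrable_mult_left integrable_normal_density) auto
  also have "(\<lambda>x::real. normal_density 0 (sqrt 2) x * sqrt (4 * pi)) = (\<lambda>x. exp (- x\<^sup>2 / 4))"
    by (auto simp: normal_density_def mult.commute)
  finally have "(\<integral>\<^sup>+x. ennreal (exp (- x\<^sup>2 / 4)) \<partial>lborel) < \<infinity>" for x :: real
    by (auto simp: integrable_iff_bounded)
  then have "(\<Prod>b\<in>(Basis::'a set). (\<integral>\<^sup>+x. ennreal (exp (- x\<^sup>2 / 4)) \<partial>lborel)) < \<infinity>"
    by (simp add: power_less_top_ennreal)
  moreover have "(\<integral>\<^sup>+x. ennreal (norm (exp (- (norm x)\<^sup>2 / 4))) \<partial>(lborel :: 'a measure)) =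
     (\<integral>\<^sup>+x. (\<Prod>b\<in>Basis. ennreal (exp (- (x \<bullet> b)\<^sup>2 / 4))) \<partial>(lborel :: 'a measure))"
    unfolding real_norm_def abs_exp_cancel unfolding * by (simp add: prod_ennreal)
  moreover have "\<dots> = (\<Prod>b\<in>(Basis::'a set). (\<integral>\<^sup>+x. ennreal (exp (- x\<^sup>2 / 4)) \<partial>lborel))"
    by (rule nn_integral_lborel_prod) auto
  ultimately show "(\<integral>\<^sup>+x. ennreal (norm (exp (- (norm x)\<^sup>2 / 4))) \<partial>(lborel :: 'a measure)) < \<infinity>"
    by simp
qed measurable

lemma integrable_tame_dens:
  assumes "tame (f :: 'a::euclidean_space \<Rightarrow> 'b::{banach, second_countable_topology})"
  shows "integrable lborel (\<lambda>x. gauss_dens x *\<^sub>R f x)"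
proof -
  obtain C m where 1: "C \<ge> 1" "\<And>x. norm (f x) \<le> C * (1 + norm x) ^ m" using tameE[OF assms(1)] by blast
  obtain D where D: "D > 0" "\<And>t::real. t \<ge> 0 \<Longrightarrow> (1 + t) ^ m * exp (- t\<^sup>2 / 2) \<le> D * exp (- t\<^sup>2 / 4)"
    using power_le_exp_bound by blast
  let ?c = "(2 * pi) powr (- real DIM('a) / 2)"
  show ?thesis
  proof (rule Bochner_Integration.integrable_bound)
    show "integrable (lborel :: 'a measure) (\<lambda>x. ?c * C * D * exp (- (norm x)\<^sup>2 / 4))"
      using integrable_lborel_exp_norm by (intro integrable_mult_right) auto
    show "(\<lambda>x. gauss_dens x *\<^sub>R f x) \<in> borel_measurable lborel"
      using assms by measurable
    have "norm (gauss_dens x *\<^sub>R f x) \<le> norm (?c * C * D * exp (- (norm x)\<^sup>2 / 4))" for x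
    proof -
      have "norm (gauss_dens x *\<^sub>R f x) \<le> ?c * exp (- (norm x)\<^sup>2 / 2) * (C * (1 + norm x) ^ m)"
        using 1(2)[of x] by (simp add: gauss_dens_def mult_left_mono)
      also have "\<dots> = ?c * C * ((1 + norm x) ^ m * exp (- (norm x)\<^sup>2 / 2))" by simp
      also have "\<dots> \<le> ?c * C * (D * exp (- (norm x)\<^sup>2 / 4))"
        using 1(1) by (intro mult_left_mono D) auto
      finally show ?thesis using 1(1) D(1) by (simp add: abs_mult)
    qed
    then show "AE x in lborel. norm (gauss_dens x *\<^sub>R f x) \<le> norm (?c * C * D * exp (- (norm x)\<^sup>2 / 4))" by simp
  qed
qed

lemma integral_gaussian:
  fixes f :: "'a::euclidean_space \<Rightarrow> 'b::{banach, second_countable_topology}"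
  assumes "f \<in> borel_measurable borel"
  shows "integral\<^sup>L gaussian f = (\<integral>x. gauss_dens x *\<^sub>R f x \<partial>lborel)"
  unfolding gaussian_density using assms
  by (intro integral_density) (auto simp: less_imp_le[OF gauss_dens_pos])

lemma integrable_tame [intro]:
  assumes "tame (f :: 'a::euclidean_space \<Rightarrow> 'b::{banach, second_countable_topology})"
  shows "integrable gaussian f"
  unfolding gaussian_density using integrable_tame_dens[OF assms] assms
  by (subst integrable_density) (auto simp: less_imp_le[OF gauss_dens_pos])

lemma tame_Pair [intro]:
  assumes "tame f" "tame g" shows "tame (\<lambda>x. (f x, g x))"
proof -
  have "(\<lambda>x. (f x, g x)) = (\<lambda>x. (f x, 0) + (0, g x))" by auto
  moreover have "tame (\<lambda>x. (f x, 0 :: 'c))"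
    by (rule tame_compose[OF tame_bounded_linear assms(1)]) (intro bounded_linear_intros)
  moreover have "tame (\<lambda>x. (0 :: 'b, g x))"
    by (rule tame_compose[OF tame_bounded_linear assms(2)]) (intro bounded_linear_intros)
  ultimately show ?thesis using tame_add by metis
qed

lemma tame_fst [intro]: "tame f \<Longrightarrow> tame (\<lambda>x. fst (f x))"
  by (rule tame_compose[OF tame_bounded_linear[OF bounded_linear_fst]])

lemma tame_snd [intro]: "tame f \<Longrightarrow> tame (\<lambda>x. snd (f x))"
  by (rule tame_compose[OF tame_bounded_linear[OF bounded_linear_snd]])

lemma tame_inner [intro]: "tame f \<Longrightarrow> tame g \<Longrightarrow> tame (\<lambda>x. f x \<bullet> g x)"
  by (rule tame_bilinear[OF bounded_bilinear_inner])

lemma tame_bounded: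
  assumes "continuous_on UNIV f" "\<And>x. norm (f x) \<le> C" shows "tame f"
  by (rule tameI[of f C 0]) (use assms in auto)

lemma tame_cos [intro]: "tame f \<Longrightarrow> tame (\<lambda>x. cos (f x) :: real)"
  by (rule tame_compose[OF tame_bounded[of cos 1]]) (auto intro: continuous_intros)

lemma tame_sin [intro]: "tame f \<Longrightarrow> tame (\<lambda>x. sin (f x) :: real)"
  by (rule tame_compose[OF tame_bounded[of sin 1]]) (auto intro: continuous_intros)

lemma tame_slice: "tame (\<lambda>z. f (fst z) (snd z)) \<Longrightarrow> tame (f t)"
proof -
  assume f: "tame (\<lambda>z. f (fst z) (snd z))"
  have "tame (\<lambda>x. (\<lambda>z. f (fst z) (snd z)) (t, x))"
    by (rule tame_compose[OF f]) (intro tame_Pair tame_const tame_id)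
  then show ?thesis by simp
qed

lemma integral_lborel_translate:
  fixes h :: "'a::euclidean_space \<Rightarrow> 'b::{banach, second_countable_topology}"
  assumes "h \<in> borel_measurable borel"
  shows "(\<integral>x. h (x + v) \<partial>lborel) = (\<integral>x. h x \<partial>lborel)"
    and "integrable lborel h \<Longrightarrow> integrable lborel (\<lambda>x. h (x + v))"
proof -
  have 1: "distr lborel borel ((+) v) = lborel" by (rule lborel_distr_plus)
  have "(\<integral>x. h x \<partial>(distr lborel borel ((+) v))) = (\<integral>x. h (v + x) \<partial>lborel)"
    using assms by (intro integral_distr) auto
  then show "(\<integral>x. h (x + v) \<partial>lborel) = (\<integral>x. h x \<partial>lborel)"
    unfolding 1 by (simp add: add.commute)
  assume "integrable lborel h"
  then have "integrable (distr lborel borel ((+) v)) h" unfolding 1 .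
  then have "integrable lborel (\<lambda>x. h (v + x))"
    by (subst (asm) integrable_distr_eq) (use assms in auto)
  then show "integrable lborel (\<lambda>x. h (x + v))" by (simp add: add.commute)
qed

lemma integral_directional_derivative:
  fixes h :: "'a::euclidean_space \<Rightarrow> 'b::euclidean_space"
  assumes h: "integrable lborel h" and h': "integrable lborel h'" and cont: "continuous_on UNIV h'"
    and hm: "h \<in> borel_measurable borel"
    and deriv: "\<And>x. ((\<lambda>t. h (x + t *\<^sub>R v)) has_vector_derivative h' x) (at 0)"
  shows "(\<integral>x. h' x \<partial>lborel) = 0"
proof -
  have h'm [measurable]: "h' \<in> borel_measurable borel"
    using cont by (rule borel_measurable_continuous_onI)
  let ?F = "\<lambda>(t::real, x). indicator {0..1} t *\<^sub>R h' (x + t *\<^sub>R v)"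
  have "integrable (lborel \<Otimes>\<^sub>M lborel) ?F"
  proof (rule lborel_pair.Fubini_integrable)
    have "(\<lambda>t. \<integral>y. norm (?F (t, y)) \<partial>lborel) = (\<lambda>t. indicator {0..1} t *\<^sub>R (\<integral>y. norm (h' y) \<partial>lborel))"
    proof
      fix t :: real
      show "(\<integral>y. norm (?F (t, y)) \<partial>lborel) = indicator {0..1} t *\<^sub>R (\<integral>y. norm (h' y) \<partial>lborel)"
        using integral_lborel_translate(1)[of "\<lambda>y. norm (h' y)" "t *\<^sub>R v"] by (simp add: indicator_def)
    qed
    then show "integrable lborel (\<lambda>t. \<integral>y. norm (?F (t, y)) \<partial>lborel)"
      by (auto intro!: integrable_scaleR_left)
    show "AE t in lborel. integrable lborel (\<lambda>y. ?F (t, y))"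
      using integral_lborel_translate(2)[OF h'm h'] by (intro AE_I2) simp
  qed measurable
  then have "(\<integral>x. (\<integral>t. indicator {0..1} t *\<^sub>R h' (x + t *\<^sub>R v) \<partial>lborel) \<partial>lborel)
      = (\<integral>t. (\<integral>x. indicator {0..1} t *\<^sub>R h' (x + t *\<^sub>R v) \<partial>lborel) \<partial>lborel)"
    by (intro lborel_pair.Fubini_integral) simp
  moreover have "(\<integral>t. indicator {0..1} t *\<^sub>R h' (x + t *\<^sub>R v) \<partial>lborel) = h (x + v) - h x" for x
  proof -
    have "has_bochner_integral lborel (\<lambda>t. indicator {0..1} t *\<^sub>R h' (x + t *\<^sub>R v)) (h (x + 1 *\<^sub>R v) - h (x + 0 *\<^sub>R v))"
    proof (rule has_bochner_integral_FTC_Icc)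
      fix t :: real
      have "((\<lambda>s. h ((x + t *\<^sub>R v) + s *\<^sub>R v)) has_vector_derivative h' (x + t *\<^sub>R v)) (at (t - t))"
        using deriv by simp
      then have "((\<lambda>s. h ((x + t *\<^sub>R v) + s *\<^sub>R v)) \<circ> (\<lambda>s. s - t) has_vector_derivative 1 *\<^sub>R h' (x + t *\<^sub>R v)) (at t)"
        by (intro vector_diff_chain_at) (auto intro!: derivative_eq_intros)
      then have "((\<lambda>s. h (x + s *\<^sub>R v)) has_vector_derivative h' (x + t *\<^sub>R v)) (at t)"
        by (simp add: o_def algebra_simps)
      then show "((\<lambda>s. h (x + s *\<^sub>R v)) has_vector_derivative h' (x + t *\<^sub>R v)) (at t within {0..1})"
        by (rule has_vector_derivative_at_within)
    next
      show "continuous_on {0..1} (\<lambda>t. h' (x + t *\<^sub>R v))"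
        by (rule continuous_on_compose2[OF cont]) (auto intro!: continuous_intros)
    qed auto
    then show ?thesis by (simp add: has_bochner_integral_integral_eq)
  qed
  moreover have "(\<integral>t. (\<integral>x. indicator {0..1} t *\<^sub>R h' (x + t *\<^sub>R v) \<partial>lborel) \<partial>lborel) = (\<integral>x. h' x \<partial>lborel)"
  proof -
    have *: "(\<integral>x. indicator {0..1} t *\<^sub>R h' (x + t *\<^sub>R v) \<partial>lborel) = indicator {0..1} t *\<^sub>R (\<integral>x. h' x \<partial>lborel)" for t :: real
      using integral_lborel_translate(1)[OF h'm, of "t *\<^sub>R v"] by simp
    show ?thesis unfolding * by simp
  qed
  moreover have "(\<integral>x. h (x + v) - h x \<partial>lborel) = 0"
    using integral_lborel_translate[OF hm, of v] h by simp
  ultimately show ?thesis by simp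
qed

lemma gaussian_integration_by_parts:
  fixes f :: "'a::euclidean_space \<Rightarrow> 'b::euclidean_space"
  assumes f: "tame f" and f': "tame f'"
    and deriv: "\<And>x. ((\<lambda>t. f (x + t *\<^sub>R v)) has_vector_derivative f' x) (at 0)"
  shows "(\<integral>x. (v \<bullet> x) *\<^sub>R f x \<partial>gaussian) = (\<integral>x. f' x \<partial>gaussian)"
proof -
  have vx: "tame (\<lambda>x. (v \<bullet> x) *\<^sub>R f x)"
    by (intro tame_scaleR tame_inner tame_const tame_id f)
  have d: "tame (\<lambda>x. f' x - (v \<bullet> x) *\<^sub>R f x)" by (intro tame_diff f' vx)
  have cd: "continuous_on UNIV (gauss_dens :: 'a \<Rightarrow> real)"
    unfolding gauss_dens_def by (intro continuous_intros) auto
  have "(\<integral>x. gauss_dens x *\<^sub>R (f' x - (v \<bullet> x) *\<^sub>R f x) \<partial>lborel) = 0"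
  proof (rule integral_directional_derivative[where h = "\<lambda>x. gauss_dens x *\<^sub>R f x"])
    show "integrable lborel (\<lambda>x. gauss_dens x *\<^sub>R f x)" by (rule integrable_tame_dens[OF f])
    show "integrable lborel (\<lambda>x. gauss_dens x *\<^sub>R (f' x - (v \<bullet> x) *\<^sub>R f x))" by (rule integrable_tame_dens[OF d])
    show "continuous_on UNIV (\<lambda>x. gauss_dens x *\<^sub>R (f' x - (v \<bullet> x) *\<^sub>R f x))"
      by (intro continuous_on_scaleR cd tame_continuous[OF d])
    show "(\<lambda>x. gauss_dens x *\<^sub>R f x) \<in> borel_measurable borel" using f by measurable
    fix x :: 'a
    have "(norm (x + t *\<^sub>R v))\<^sup>2 = (norm x)\<^sup>2 + 2 * t * (v \<bullet> x) + t\<^sup>2 * (norm v)\<^sup>2" for t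
      unfolding power2_norm_eq_inner by (simp add: inner_simps inner_commute power2_eq_square algebra_simps)
    then have e: "gauss_dens (x + t *\<^sub>R v) = (2 * pi) powr (- real DIM('a) / 2) * exp (- ((norm x)\<^sup>2 + 2 * t * (v \<bullet> x) + t\<^sup>2 * (norm v)\<^sup>2) / 2)" for t
      unfolding gauss_dens_def by simp
    have "((\<lambda>t. gauss_dens (x + t *\<^sub>R v)) has_vector_derivative - (v \<bullet> x) * gauss_dens x) (at 0)"
      unfolding e has_real_derivative_iff_has_vector_derivative[symmetric]
      by (auto intro!: derivative_eq_intros simp: gauss_dens_def)
    from has_vector_derivative_scaleR[OF this[folded has_real_derivative_iff_has_vector_derivative] deriv[of x]]
    show "((\<lambda>t. gauss_dens (x + t *\<^sub>R v) *\<^sub>R f (x + t *\<^sub>R v)) has_vector_derivative gauss_dens x *\<^sub>R (f' x - (v \<bullet> x) *\<^sub>R f x)) (at 0)"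
      by (simp add: scaleR_diff_right algebra_simps)
  qed
  then have "(\<integral>x. f' x - (v \<bullet> x) *\<^sub>R f x \<partial>gaussian) = 0"
    by (subst integral_gaussian) (use d in measurable)
  then show ?thesis
    by (simp add: Bochner_Integration.integral_diff[OF integrable_tame[OF f'] integrable_tame[OF vx]])
qed

lemma interval_gaussian_Fubini:
  fixes F :: "real \<Rightarrow> 'a::euclidean_space \<Rightarrow> 'b::euclidean_space"
  assumes F: "tame (\<lambda>z. F (fst z) (snd z))"
  shows "(\<integral>x. (\<integral>t. indicator {a..b} t *\<^sub>R F t x \<partial>lborel) \<partial>gaussian)
      = (\<integral>t. indicator {a..b} t *\<^sub>R (\<integral>x. F t x \<partial>gaussian) \<partial>lborel)"
    and "integrable gaussian (\<lambda>x. (\<integral>t. indicator {a..b} t *\<^sub>R F t x \<partial>lborel))"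
    and "integrable lborel (\<lambda>t. indicator {a..b} t *\<^sub>R (\<integral>x. F t x \<partial>gaussian))"
proof -
  interpret G: prob_space "gaussian :: 'a measure" by (rule prob_space_gaussian)
  interpret LG: pair_sigma_finite "lborel :: real measure" "gaussian :: 'a measure" ..
  have dm: "(\<lambda>z. F (fst z) (snd z)) \<in> borel_measurable (borel \<Otimes>\<^sub>M borel)"
    using tame_measurable[OF F] by (simp add: borel_prod)
  then have dm' [measurable]: "(\<lambda>z. F (fst z) (snd z)) \<in> borel_measurable (lborel \<Otimes>\<^sub>M gaussian)"
    by (simp cong: measurable_cong_sets sets_pair_measure_cong)
  obtain C m where C: "C \<ge> 1" "\<And>z. norm (F (fst z) (snd z)) \<le> C * (1 + norm z) ^ m" using tameE[OF F] by blast
  let ?K = "1 + \<bar>a\<bar> + \<bar>b\<bar>"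
  let ?g = "\<lambda>x::'a. C * (?K + norm x) ^ m"
  have g: "tame ?g" by (intro tame_mult tame_power tame_add tame_const tame_norm tame_id)
  have bound: "norm (F t x) \<le> ?g x" if "t \<in> {a..b}" for t x
  proof -
    have "norm (t, x) \<le> norm t + norm x" by (rule norm_Pair_le)
    then have "1 + norm (t, x) \<le> ?K + norm x" using that by auto
    then have "C * (1 + norm (t, x)) ^ m \<le> ?g x" using C(1) by (intro mult_left_mono power_mono) auto
    then show ?thesis using C(2)[of "(t, x)"] by simp
  qed
  have ii: "integrable lborel (\<lambda>t. indicator {a..b} t :: real)"
  proof (rule integrable_real_indicator)
    show "emeasure lborel {a..b} < \<infinity>" by (cases "a \<le> b") (auto simp: emeasure_lborel_Icc)
  qed auto
  have "integrable (lborel \<Otimes>\<^sub>M gaussian) (\<lambda>z. indicator {a..b} (fst z) *\<^sub>R F (fst z) (snd z))"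
  proof (rule Bochner_Integration.integrable_bound)
    show "integrable (lborel \<Otimes>\<^sub>M gaussian) (\<lambda>(t, x). indicator {a..b} t * ?g x)"
    proof (rule LG.Fubini_integrable)
      show "integrable lborel (\<lambda>t. \<integral>y. norm (case (t, y) of (t, x) \<Rightarrow> indicator {a..b} t * ?g x) \<partial>gaussian)"
        using ii by (simp add: abs_mult)
      show "AE t in lborel. integrable gaussian (\<lambda>y. case (t, y) of (t, x) \<Rightarrow> indicator {a..b} t * ?g x)"
        using integrable_tame[OF g] by (intro AE_I2) simp
    qed measurable
    show "AE z in lborel \<Otimes>\<^sub>M gaussian. norm (indicator {a..b} (fst z) *\<^sub>R F (fst z) (snd z)) \<le> norm (case z of (t, x) \<Rightarrow> indicator {a..b} t * ?g x)"
      using bound C(1) by (intro AE_I2) (auto simp: indicator_def abs_mult)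
  qed measurable
  then have int: "integrable (lborel \<Otimes>\<^sub>M gaussian) (\<lambda>(t, x). indicator {a..b} t *\<^sub>R F t x)" by (simp add: case_prod_unfold)
  have e: "(\<integral>x. indicator {a..b} t *\<^sub>R F t x \<partial>gaussian) = indicator {a..b} t *\<^sub>R (\<integral>x. F t x \<partial>gaussian)" for t
    by simp
  show "(\<integral>x. (\<integral>t. indicator {a..b} t *\<^sub>R F t x \<partial>lborel) \<partial>gaussian)
      = (\<integral>t. indicator {a..b} t *\<^sub>R (\<integral>x. F t x \<partial>gaussian) \<partial>lborel)"
    using LG.Fubini_integral[OF int] unfolding e .
  show "integrable gaussian (\<lambda>x. (\<integral>t. indicator {a..b} t *\<^sub>R F t x \<partial>lborel))"
    by (rule LG.integrable_snd[OF int])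
  show "integrable lborel (\<lambda>t. indicator {a..b} t *\<^sub>R (\<integral>x. F t x \<partial>gaussian))"
    using LG.integrable_fst[OF int] unfolding e .
qed

lemma gaussian_parameter_derivative:
  fixes \<phi> :: "real \<Rightarrow> 'a::euclidean_space \<Rightarrow> 'b::euclidean_space"
  assumes ab: "a \<le> b" and d: "tame (\<lambda>z. \<phi>' (fst z) (snd z))" and t: "\<And>t. tame (\<phi> t)"
    and deriv: "\<And>x t. ((\<lambda>t. \<phi> t x) has_vector_derivative \<phi>' t x) (at t)"
  shows "(\<integral>x. \<phi> b x \<partial>gaussian) - (\<integral>x. \<phi> a x \<partial>gaussian)
    = (\<integral>t. indicator {a..b} t *\<^sub>R (\<integral>x. \<phi>' t x \<partial>gaussian) \<partial>lborel)"
proof -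
  have "(\<integral>t. indicator {a..b} t *\<^sub>R \<phi>' t x \<partial>lborel) = \<phi> b x - \<phi> a x" for x
  proof -
    have "has_bochner_integral lborel (\<lambda>t. indicator {a..b} t *\<^sub>R \<phi>' t x) (\<phi> b x - \<phi> a x)"
    proof (rule has_bochner_integral_FTC_Icc)
      show "((\<lambda>t. \<phi> t x) has_vector_derivative \<phi>' t x) (at t within {a..b})" for t
        by (rule has_vector_derivative_at_within[OF deriv])
      have "continuous_on {a..b} (\<lambda>t. (\<lambda>z. \<phi>' (fst z) (snd z)) (t, x))"
        by (rule continuous_on_compose2[OF tame_continuous[OF d]]) (auto intro!: continuous_intros)
      then show "continuous_on {a..b} (\<lambda>t. \<phi>' t x)" by simp
    qed (rule ab)
    then show ?thesis by (simp add: has_bochner_integral_integral_eq)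
  qed
  moreover have "(\<integral>x. \<phi> b x - \<phi> a x \<partial>gaussian) = (\<integral>x. \<phi> b x \<partial>gaussian) - (\<integral>x. \<phi> a x \<partial>gaussian)"
    by (intro Bochner_Integration.integral_diff integrable_tame t)
  ultimately show ?thesis using interval_gaussian_Fubini(1)[OF d, of a b] by simp
qed

lemma gaussian_parameter_antimono:
  fixes \<phi> :: "real \<Rightarrow> 'a::euclidean_space \<Rightarrow> real"
  assumes ab: "a \<le> b" and d: "tame (\<lambda>z. \<phi>' (fst z) (snd z))" and t: "\<And>t. tame (\<phi> t)"
    and deriv: "\<And>x t. ((\<lambda>t. \<phi> t x) has_vector_derivative \<phi>' t x) (at t)"
    and neg: "\<And>t. a \<le> t \<Longrightarrow> t \<le> b \<Longrightarrow> (\<integral>x. \<phi>' t x \<partial>gaussian) \<le> 0"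
  shows "(\<integral>x. \<phi> b x \<partial>gaussian) \<le> (\<integral>x. \<phi> a x \<partial>gaussian)"
proof -
  have "0 \<le> (\<integral>t. - (indicator {a..b} t *\<^sub>R (\<integral>x. \<phi>' t x \<partial>gaussian)) \<partial>lborel)"
    using neg by (intro Bochner_Integration.integral_nonneg) (auto simp: indicator_def)
  then show ?thesis
    using gaussian_parameter_derivative[OF ab d t deriv] by simp
qed

section \<open>Invariances\<close>

lemma gaussian_invariant:
  fixes f :: "'a::euclidean_space \<Rightarrow> 'b::{banach, second_countable_topology}" and R :: "'a \<Rightarrow> 'a"
  assumes R: "distr lborel borel R = lborel" and Rm: "R \<in> borel_measurable borel"
    and iso: "\<And>x. norm (R x) = norm x" and f: "f \<in> borel_measurable borel"
  shows "(\<integral>x. f (R x) \<partial>gaussian) = (\<integral>x. f x \<partial>gaussian)"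
proof -
  have [measurable]: "R \<in> borel_measurable borel" "f \<in> borel_measurable borel" by fact+
  have "(\<integral>x. f (R x) \<partial>gaussian) = (\<integral>x. gauss_dens (R x) *\<^sub>R f (R x) \<partial>lborel)"
    by (subst integral_gaussian) (auto simp: gauss_dens_def iso)
  also have "\<dots> = (\<integral>x. gauss_dens x *\<^sub>R f x \<partial>(distr lborel borel R))"
    by (subst integral_distr) auto
  also have "\<dots> = (\<integral>x. f x \<partial>gaussian)"
    unfolding R by (subst integral_gaussian) auto
  finally show ?thesis .
qed

lemma gaussian_uminus:
  fixes f :: "'a::euclidean_space \<Rightarrow> 'b::{banach, second_countable_topology}"
  assumes "f \<in> borel_measurable borel"
  shows "(\<integral>x. f (- x) \<partial>gaussian) = (\<integral>x. f x \<partial>gaussian)"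
proof (rule gaussian_invariant[OF _ _ _ assms])
  show "distr lborel borel uminus = (lborel :: 'a measure)"
    by (subst (2) lborel_affine[of "-1" 0]) (auto simp: density_1)
qed auto

lemma lborel_shear:
  "distr lborel borel (\<lambda>z::'a \<times> 'a. (fst z + t *\<^sub>R snd z, snd z)) = (lborel :: ('a::euclidean_space \<times> 'a) measure)"
  "distr lborel borel (\<lambda>z::'a \<times> 'a. (fst z, snd z + t *\<^sub>R fst z)) = (lborel :: ('a::euclidean_space \<times> 'a) measure)"
proof -
  have m1 [measurable]: "(\<lambda>z::'a \<times> 'a. (fst z + t *\<^sub>R snd z, snd z)) \<in> borel_measurable borel"
    and m2 [measurable]: "(\<lambda>z::'a \<times> 'a. (fst z, snd z + t *\<^sub>R fst z)) \<in> borel_measurable borel"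
    by (intro borel_measurable_continuous_onI continuous_intros)+
  have tr: "(\<integral>\<^sup>+x. indicator A (x + v) \<partial>lborel) = emeasure lborel A" if "A \<in> sets borel" for A and v :: 'a
  proof -
    have "emeasure (distr lborel borel ((+) v)) A = (\<integral>\<^sup>+x. indicator A (v + x) \<partial>lborel)"
      using that by (subst nn_integral_indicator[symmetric], simp, subst nn_integral_distr) auto
    then show ?thesis by (simp add: lborel_distr_plus add.commute)
  qed
  show "distr lborel borel (\<lambda>z::'a \<times> 'a. (fst z + t *\<^sub>R snd z, snd z)) = (lborel :: ('a \<times> 'a) measure)"
  proof (rule measure_eqI)
    fix A :: "('a \<times> 'a) set" assume "A \<in> sets (distr lborel borel (\<lambda>z::'a \<times> 'a. (fst z + t *\<^sub>R snd z, snd z)))"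
    then have A [measurable]: "A \<in> sets borel" by simp
    then have A2 [measurable]: "A \<in> sets (borel \<Otimes>\<^sub>M borel)" unfolding borel_prod .
    have "emeasure (distr lborel borel (\<lambda>z::'a \<times> 'a. (fst z + t *\<^sub>R snd z, snd z))) A
        = (\<integral>\<^sup>+z. indicator A (fst z + t *\<^sub>R snd z, snd z) \<partial>(lborel :: ('a \<times> 'a) measure))"
      by (subst nn_integral_indicator[symmetric], simp, subst nn_integral_distr) auto
    also have "\<dots> = (\<integral>\<^sup>+y. (\<integral>\<^sup>+x. indicator A (x + t *\<^sub>R y, y) \<partial>lborel) \<partial>lborel)"
      unfolding lborel_prod[symmetric] by (subst lborel_pair.nn_integral_snd[symmetric]) auto
    also have "\<dots> = (\<integral>\<^sup>+y. (\<integral>\<^sup>+x. indicator ((\<lambda>x. (x, y)) -` A) (x + t *\<^sub>R y) \<partial>lborel) \<partial>lborel)"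
      by (simp add: indicator_def)
    also have "\<dots> = (\<integral>\<^sup>+y. emeasure lborel ((\<lambda>x. (x, y)) -` A) \<partial>lborel)"
      using sets_Pair2[OF A2] by (simp add: tr)
    also have "\<dots> = emeasure lborel A"
      unfolding lborel_prod[symmetric] by (subst lborel_pair.emeasure_pair_measure_alt2) auto
    finally show "emeasure (distr lborel borel (\<lambda>z::'a \<times> 'a. (fst z + t *\<^sub>R snd z, snd z))) A = emeasure lborel A" .
  qed simp
  show "distr lborel borel (\<lambda>z::'a \<times> 'a. (fst z, snd z + t *\<^sub>R fst z)) = (lborel :: ('a \<times> 'a) measure)"
  proof (rule measure_eqI)
    fix A :: "('a \<times> 'a) set" assume "A \<in> sets (distr lborel borel (\<lambda>z::'a \<times> 'a. (fst z, snd z + t *\<^sub>R fst z)))"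
    then have A [measurable]: "A \<in> sets borel" by simp
    then have A2 [measurable]: "A \<in> sets (borel \<Otimes>\<^sub>M borel)" unfolding borel_prod .
    have "emeasure (distr lborel borel (\<lambda>z::'a \<times> 'a. (fst z, snd z + t *\<^sub>R fst z))) A
        = (\<integral>\<^sup>+z. indicator A (fst z, snd z + t *\<^sub>R fst z) \<partial>(lborel :: ('a \<times> 'a) measure))"
      by (subst nn_integral_indicator[symmetric], simp, subst nn_integral_distr) auto
    also have "\<dots> = (\<integral>\<^sup>+x. (\<integral>\<^sup>+y. indicator A (x, y + t *\<^sub>R x) \<partial>lborel) \<partial>lborel)"
      unfolding lborel_prod[symmetric] by (subst lborel.nn_integral_fst[symmetric]) auto
    also have "\<dots> = (\<integral>\<^sup>+x. (\<integral>\<^sup>+y. indicator (Pair x -` A) (y + t *\<^sub>R x) \<partial>lborel) \<partial>lborel)"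
      by (simp add: indicator_def)
    also have "\<dots> = (\<integral>\<^sup>+x. emeasure lborel (Pair x -` A) \<partial>lborel)"
      using sets_Pair1[OF A2] by (simp add: tr)
    also have "\<dots> = emeasure lborel A"
      unfolding lborel_prod[symmetric] by (subst lborel.emeasure_pair_measure_alt) auto
    finally show "emeasure (distr lborel borel (\<lambda>z::'a \<times> 'a. (fst z, snd z + t *\<^sub>R fst z))) A = emeasure lborel A" .
  qed simp
qed

lemma gaussian_rotate:
  fixes f :: "'a::euclidean_space \<times> 'a \<Rightarrow> 'b::{banach, second_countable_topology}"
  assumes \<theta>: "cos (\<theta> / 2) \<noteq> 0" and f: "f \<in> borel_measurable borel"
  shows "(\<integral>z. f (cos \<theta> *\<^sub>R fst z + sin \<theta> *\<^sub>R snd z, cos \<theta> *\<^sub>R snd z - sin \<theta> *\<^sub>R fst z) \<partial>gaussian) = (\<integral>z. f z \<partial>gaussian)"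
proof (rule gaussian_invariant[OF _ _ _ f])
  define a where "a = tan (\<theta> / 2)"
  let ?S = "\<lambda>z::'a \<times> 'a. (fst z + a *\<^sub>R snd z, snd z)"
  let ?T = "\<lambda>z::'a \<times> 'a. (fst z, snd z + (- sin \<theta>) *\<^sub>R fst z)"
  let ?R = "\<lambda>z::'a \<times> 'a. (cos \<theta> *\<^sub>R fst z + sin \<theta> *\<^sub>R snd z, cos \<theta> *\<^sub>R snd z - sin \<theta> *\<^sub>R fst z)"
  have s: "sin \<theta> = 2 * sin (\<theta> / 2) * cos (\<theta> / 2)" using sin_double[of "\<theta> / 2"] by simp
  have c: "cos \<theta> = 1 - 2 * (sin (\<theta> / 2))\<^sup>2" "cos \<theta> = 2 * (cos (\<theta> / 2))\<^sup>2 - 1"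
    using cos_double_sin[of "\<theta> / 2"] cos_double_cos[of "\<theta> / 2"] by simp_all
  have 1: "1 - a * sin \<theta> = cos \<theta>"
    using \<theta> unfolding a_def tan_def s c(1) by (simp add: field_simps power2_eq_square)
  have 2: "a * cos \<theta> + a = sin \<theta>"
    using \<theta> unfolding a_def tan_def s c(2) by (simp add: field_simps power2_eq_square)
  have R: "?R = ?S \<circ> ?T \<circ> ?S"
  proof
    fix z :: "'a \<times> 'a"
    have "fst z + a *\<^sub>R snd z + a *\<^sub>R (snd z - sin \<theta> *\<^sub>R (fst z + a *\<^sub>R snd z))
      = (1 - a * sin \<theta>) *\<^sub>R fst z + (a * (1 - a * sin \<theta>) + a) *\<^sub>R snd z"
      by (simp add: algebra_simps) (metis mult_2_right scaleR_left_distrib)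
    moreover have "snd z - sin \<theta> *\<^sub>R (fst z + a *\<^sub>R snd z) = (1 - a * sin \<theta>) *\<^sub>R snd z - sin \<theta> *\<^sub>R fst z"
      by (simp add: algebra_simps)
    ultimately show "?R z = (?S \<circ> ?T \<circ> ?S) z" unfolding 1 2 by simp
  qed
  have [measurable]: "?S \<in> borel_measurable borel" "?T \<in> borel_measurable borel"
    by (intro borel_measurable_continuous_onI continuous_intros)+
  have "distr lborel borel (?S \<circ> ?T \<circ> ?S) = distr (distr (distr lborel borel ?S) borel ?T) borel ?S"
  proof -
    have *: "distr lborel borel (S \<circ> T \<circ> S) = distr (distr (distr lborel borel S) borel T) borel S"
      if [measurable]: "S \<in> borel_measurable borel" "T \<in> borel_measurable borel" for S T :: "'a \<times> 'a \<Rightarrow> 'a \<times> 'a"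
      by (simp add: distr_distr o_assoc measurable_comp[OF that(1) that(2)])
    show ?thesis by (rule *) fact+
  qed
  then show "distr lborel borel ?R = lborel" unfolding R lborel_shear .
  show "?R \<in> borel_measurable borel"
    by (intro borel_measurable_continuous_onI continuous_intros)
  show "norm (?R z) = norm z" for z
  proof -
    have "(norm (c *\<^sub>R fst z + s *\<^sub>R snd z))\<^sup>2 + (norm (c *\<^sub>R snd z - s *\<^sub>R fst z))\<^sup>2
      = (c\<^sup>2 + s\<^sup>2) * ((norm (fst z))\<^sup>2 + (norm (snd z))\<^sup>2)" for c s :: real
      unfolding power2_norm_eq_inner
      by (simp add: inner_simps inner_commute power2_eq_square algebra_simps)
    then show ?thesis unfolding norm_Pair norm_prod_def by (simp add: sin_squared_eq)
  qed
qed

lemma gaussian_iexp_inner: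
  fixes v :: "'a::euclidean_space"
  shows "(\<integral>x. cis (s * (v \<bullet> x)) \<partial>gaussian) = (\<integral>g. cis (s * (norm v * g)) \<partial>(gaussian :: real measure))"
proof -
  interpret G: prob_space "gaussian :: 'a measure" by (rule prob_space_gaussian)
  interpret H: prob_space "gaussian :: real measure" by (rule prob_space_gaussian)
  interpret GH: pair_prob_space "gaussian :: 'a measure" "gaussian :: real measure" ..
  have tc: "tame (\<lambda>x. cis (f x))" if "tame f" for f :: "'c::real_normed_vector \<Rightarrow> real"
  proof -
    have "continuous_on UNIV (\<lambda>x. cis (f x))"
      by (intro continuous_on_cis tame_continuous[OF that])
    then show ?thesis by (rule tame_bounded[where C = 1]) simp
  qed
  define u :: "real \<Rightarrow> 'a \<times> real" where "u = (\<lambda>\<theta>. (cos \<theta> *\<^sub>R v, sin \<theta> * norm v))"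
  define w :: "real \<Rightarrow> 'a \<times> real" where "w = (\<lambda>\<theta>. (- sin \<theta> *\<^sub>R v, cos \<theta> * norm v))"
  define \<phi> where "\<phi> = (\<lambda>\<theta> z. cis (s * (u \<theta> \<bullet> z)))"
  define \<phi>' where "\<phi>' = (\<lambda>\<theta> z. (w \<theta> \<bullet> z) *\<^sub>R (\<i> * of_real s * \<phi> \<theta> z))"
  have tu: "tame u" and tw: "tame w"
    unfolding u_def w_def by (intro tame_Pair tame_scaleR tame_mult tame_cos tame_sin tame_uminus tame_id tame_const)+
  have t\<phi>: "tame (\<lambda>z. \<phi> (fst z) (snd z))"
    unfolding \<phi>_def by (intro tc tame_mult tame_inner tame_const tame_snd tame_id tame_compose[OF tu] tame_fst)
  have t\<phi>': "tame (\<lambda>z. \<phi>' (fst z) (snd z))"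
    unfolding \<phi>'_def by (intro tame_scaleR tame_mult tame_inner tame_const tame_snd tame_id tame_compose[OF tw] tame_fst t\<phi>)
  have 0: "(\<integral>z. \<phi>' \<theta> z \<partial>gaussian) = 0" for \<theta>
  proof -
    have "u \<theta> \<bullet> w \<theta> = 0"
      unfolding u_def w_def by (simp add: power2_norm_eq_inner[symmetric] power2_eq_square)
    then have const: "\<phi> \<theta> (z + t *\<^sub>R w \<theta>) = \<phi> \<theta> z" for z t
      unfolding \<phi>_def by (simp add: inner_add_right)
    have "(\<integral>z. (w \<theta> \<bullet> z) *\<^sub>R (\<i> * of_real s * \<phi> \<theta> z) \<partial>gaussian) = (\<integral>z. 0 \<partial>(gaussian :: ('a \<times> real) measure))"
    proof (rule gaussian_integration_by_parts)
      show "tame (\<lambda>z. \<i> * of_real s * \<phi> \<theta> z)"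
        by (intro tame_mult tame_const tame_slice[OF t\<phi>])
    qed (auto simp: const)
    then show ?thesis unfolding \<phi>'_def by simp
  qed
  have "(\<integral>z. \<phi> (pi / 2) z \<partial>gaussian) - (\<integral>z. \<phi> 0 z \<partial>gaussian)
      = (\<integral>t. indicator {0..pi/2} t *\<^sub>R (\<integral>x. \<phi>' t x \<partial>gaussian) \<partial>lborel)"
  proof (rule gaussian_parameter_derivative)
    show "tame (\<lambda>z. \<phi>' (fst z) (snd z))" "tame (\<phi> t)" for t
      by (rule t\<phi>') (rule tame_slice[OF t\<phi>])
    fix z :: "'a \<times> real" and t :: real
    obtain x y where z: "z = (x, y)" by force
    have "((\<lambda>\<theta>. s * (cos \<theta> * (v \<bullet> x) + sin \<theta> * norm v * y)) has_real_derivative s * (w t \<bullet> z)) (at t)"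
      unfolding w_def z by (auto intro!: derivative_eq_intros)
    then have "((\<lambda>\<theta>. s * (u \<theta> \<bullet> z)) has_vector_derivative s * (w t \<bullet> z)) (at t)"
      unfolding u_def z by (simp add: has_real_derivative_iff_has_vector_derivative)
    moreover have "(cis has_vector_derivative \<i> * cis \<theta>) (at \<theta>)" for \<theta>
    proof -
      have "((\<lambda>x. exp (\<i> * of_real x)) has_vector_derivative \<i> * exp (\<i> * of_real \<theta>)) (at \<theta>)"
        by (auto intro!: derivative_eq_intros has_vector_derivative_real_field)
      then show ?thesis by (simp add: cis_conv_exp[abs_def])
    qed
    ultimately have "(cis \<circ> (\<lambda>\<theta>. s * (u \<theta> \<bullet> z)) has_vector_derivative (s * (w t \<bullet> z)) *\<^sub>R (\<i> * cis (s * (u t \<bullet> z)))) (at t)"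
      by (intro vector_diff_chain_at) auto
    then show "((\<lambda>t. \<phi> t z) has_vector_derivative \<phi>' t z) (at t)"
      unfolding \<phi>_def \<phi>'_def o_def by (simp add: scaleR_conv_of_real algebra_simps)
  qed auto
  then have "(\<integral>z. \<phi> (pi / 2) z \<partial>gaussian) = (\<integral>z. \<phi> 0 z \<partial>gaussian)" unfolding 0 by simp
  moreover have "(\<integral>z. \<phi> 0 z \<partial>gaussian) = (\<integral>x. cis (s * (v \<bullet> x)) \<partial>gaussian)"
  proof -
    have "integrable gaussian (\<phi> 0)" by (rule integrable_tame[OF tame_slice[OF t\<phi>]])
    then show ?thesis
      using GH.integral_fst'[of "\<phi> 0"] H.prob_space by (simp add: gaussian_pair \<phi>_def u_def)
  qed
  moreover have "(\<integral>z. \<phi> (pi / 2) z \<partial>gaussian) = (\<integral>g. cis (s * (norm v * g)) \<partial>(gaussian :: real measure))"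
  proof -
    have "integrable gaussian (\<phi> (pi/2))" by (rule integrable_tame[OF tame_slice[OF t\<phi>]])
    then show ?thesis
      using GH.integral_fst'[of "\<phi> (pi/2)"] G.prob_space by (simp add: gaussian_pair \<phi>_def u_def)
  qed
  ultimately show ?thesis by simp
qed

lemma gaussian_inner_distr:
  fixes v :: "'a::euclidean_space"
  shows "distr gaussian borel (\<lambda>x. v \<bullet> x) = distr gaussian borel (\<lambda>g::real. norm v * g)"
proof (rule Levy_uniqueness)
  interpret G: prob_space "gaussian :: 'a measure" by (rule prob_space_gaussian)
  interpret H: prob_space "gaussian :: real measure" by (rule prob_space_gaussian)
  show "real_distribution (distr (gaussian :: 'a measure) borel (\<lambda>x. v \<bullet> x))"
    unfolding real_distribution_def real_distribution_axioms_def by (auto intro!: G.prob_space_distr)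
  show "real_distribution (distr (gaussian :: real measure) borel (\<lambda>x. norm v * x))"
    unfolding real_distribution_def real_distribution_axioms_def by (auto intro!: H.prob_space_distr)
  show "char (distr (gaussian :: 'a measure) borel (\<lambda>x. v \<bullet> x)) = char (distr (gaussian :: real measure) borel (\<lambda>x. norm v * x))"
  proof
    fix t
    have "char (distr (gaussian :: 'a measure) borel (\<lambda>x. v \<bullet> x)) t = (\<integral>x. cis (t * (v \<bullet> x)) \<partial>gaussian)"
      unfolding char_def by (subst integral_distr) (auto simp: cis_conv_exp)
    moreover have "char (distr (gaussian :: real measure) borel (\<lambda>x. norm v * x)) t = (\<integral>g. cis (t * (norm v * g)) \<partial>(gaussian :: real measure))"
      unfolding char_def by (subst integral_distr) (auto simp: cis_conv_exp)
    ultimately show "char (distr (gaussian :: 'a measure) borel (\<lambda>x. v \<bullet> x)) t = char (distr (gaussian :: real measure) borel (\<lambda>x. norm v * x)) t"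
      by (simp add: gaussian_iexp_inner)
  qed
qed

lemma gaussian_abs_inner_powr:
  fixes v :: "'a::euclidean_space"
  shows "(\<integral>x. \<bar>v \<bullet> x\<bar> powr p \<partial>gaussian) = norm v powr p * (\<integral>g. \<bar>g\<bar> powr p \<partial>(gaussian :: real measure))"
proof -
  have "(\<integral>x. \<bar>v \<bullet> x\<bar> powr p \<partial>gaussian) = (\<integral>x. \<bar>x\<bar> powr p \<partial>(distr gaussian borel (\<lambda>x. v \<bullet> x)))"
    by (subst integral_distr) auto
  also have "\<dots> = (\<integral>g. \<bar>norm v * g\<bar> powr p \<partial>(gaussian :: real measure))"
    unfolding gaussian_inner_distr by (subst integral_distr) auto
  also have "\<dots> = (\<integral>g. norm v powr p * \<bar>g\<bar> powr p \<partial>(gaussian :: real measure))"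
    by (simp add: abs_mult powr_mult)
  finally show ?thesis by simp
qed

lemma tame_vec:
  fixes f :: "'a::real_normed_vector \<Rightarrow> 'b::real_normed_vector ^ 'n::finite"
  assumes "\<And>i. tame (\<lambda>x. f x $ i)" shows "tame f"
proof (rule tame_bound)
  show "continuous_on UNIV f"
    using continuous_on_vec_lambda[of UNIV "\<lambda>i x. f x $ i"] tame_continuous[OF assms] by simp
  show "tame (\<lambda>x. \<Sum>i\<in>UNIV. norm (f x $ i))" by (intro tame_sum tame_norm assms)
  fix x
  have "norm (f x) \<le> (\<Sum>i\<in>UNIV. norm (f x $ i))"
    unfolding norm_vec_def by (rule L2_set_le_sum) simp
  then show "norm (f x) \<le> norm (\<Sum>i\<in>UNIV. norm (f x $ i))" by simp
qed

lemma tame_nth [intro]: "tame f \<Longrightarrow> tame (\<lambda>x. f x $ i)"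
  by (rule tame_compose[OF tame_bounded_linear[OF bounded_linear_vec_nth]])

lemma UNIV_option_sum: "(\<Sum>j\<in>(UNIV :: 'd::finite option set). F j) = F None + (\<Sum>i\<in>UNIV. F (Some i))"
proof -
  have "(\<Sum>j\<in>(UNIV :: 'd option set). F j) = F None + (\<Sum>j\<in>range Some. F j)"
    unfolding UNIV_option_conv by (subst sum.insert) auto
  also have "(\<Sum>j\<in>range Some. F j) = (\<Sum>i\<in>(UNIV :: 'd set). F (Some i))"
    by (subst sum.reindex) auto
  finally show ?thesis .
qed

section \<open>Wirtinger derivatives\<close>

definition wirtinger ::
  "(complex ^ 'i::finite \<Rightarrow> complex) \<Rightarrow> ('i \<Rightarrow> complex ^ 'i \<Rightarrow> complex) \<Rightarrow> ('i \<Rightarrow> complex ^ 'i \<Rightarrow> complex) \<Rightarrow> bool" where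
  "wirtinger g a b \<longleftrightarrow>
    (\<forall>p. (g has_derivative (\<lambda>h. \<Sum>j\<in>UNIV. a j p * h $ j + b j p * cnj (h $ j))) (at p))"

abbreviation holo :: "(complex ^ 'i::finite \<Rightarrow> complex) \<Rightarrow> ('i \<Rightarrow> complex ^ 'i \<Rightarrow> complex) \<Rightarrow> bool" where
  "holo f f' \<equiv> wirtinger f f' (\<lambda>_ _. 0)"

definition wirtinger1 :: "(complex \<Rightarrow> complex) \<Rightarrow> (complex \<Rightarrow> complex) \<Rightarrow> (complex \<Rightarrow> complex) \<Rightarrow> bool" where
  "wirtinger1 \<Psi> \<Psi>w \<Psi>v \<longleftrightarrow> (\<forall>w. (\<Psi> has_derivative (\<lambda>h. \<Psi>w w * h + \<Psi>v w * cnj h)) (at w))"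

lemma wirtinger_const: "wirtinger (\<lambda>_. c) (\<lambda>_ _. 0) (\<lambda>_ _. 0)"
  unfolding wirtinger_def by auto

lemma wirtinger_add:
  assumes "wirtinger g a b" "wirtinger g' a' b'"
  shows "wirtinger (\<lambda>p. g p + g' p) (\<lambda>j p. a j p + a' j p) (\<lambda>j p. b j p + b' j p)"
  unfolding wirtinger_def
proof
  fix p
  have "((\<lambda>p. g p + g' p) has_derivative (\<lambda>h. (\<Sum>j\<in>UNIV. a j p * h $ j + b j p * cnj (h $ j)) + (\<Sum>j\<in>UNIV. a' j p * h $ j + b' j p * cnj (h $ j)))) (at p)"
    using assms unfolding wirtinger_def by (intro has_derivative_add) auto
  then show "((\<lambda>p. g p + g' p) has_derivative (\<lambda>h. \<Sum>j\<in>UNIV. (a j p + a' j p) * h $ j + (b j p + b' j p) * cnj (h $ j))) (at p)"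
    by (simp add: algebra_simps sum.distrib)
qed

lemma wirtinger_mult:
  assumes "wirtinger g a b" "wirtinger g' a' b'"
  shows "wirtinger (\<lambda>p. g p * g' p) (\<lambda>j p. a j p * g' p + g p * a' j p) (\<lambda>j p. b j p * g' p + g p * b' j p)"
  unfolding wirtinger_def
proof
  fix p
  have "((\<lambda>p. g p * g' p) has_derivative (\<lambda>h. g p * (\<Sum>j\<in>UNIV. a' j p * h $ j + b' j p * cnj (h $ j)) + (\<Sum>j\<in>UNIV. a j p * h $ j + b j p * cnj (h $ j)) * g' p)) (at p)"
    using assms unfolding wirtinger_def by (intro has_derivative_mult) auto
  then show "((\<lambda>p. g p * g' p) has_derivative (\<lambda>h. \<Sum>j\<in>UNIV. (a j p * g' p + g p * a' j p) * h $ j + (b j p * g' p + g p * b' j p) * cnj (h $ j))) (at p)"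
    by (simp add: algebra_simps sum.distrib sum_distrib_left sum_distrib_right)
qed

lemma wirtinger_cnj:
  assumes "wirtinger g a b"
  shows "wirtinger (\<lambda>p. cnj (g p)) (\<lambda>j p. cnj (b j p)) (\<lambda>j p. cnj (a j p))"
  unfolding wirtinger_def
proof
  fix p
  have "((\<lambda>p. cnj (g p)) has_derivative (\<lambda>h. cnj (\<Sum>j\<in>UNIV. a j p * h $ j + b j p * cnj (h $ j)))) (at p)"
    using assms unfolding wirtinger_def by (intro has_derivative_cnj) auto
  then show "((\<lambda>p. cnj (g p)) has_derivative (\<lambda>h. \<Sum>j\<in>UNIV. cnj (b j p) * h $ j + cnj (a j p) * cnj (h $ j))) (at p)"
    by (simp add: add.commute)
qed

lemma wirtinger_compose:
  assumes "wirtinger1 \<Psi> \<Psi>w \<Psi>v" "holo f f'"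
  shows "wirtinger (\<lambda>p. \<Psi> (f p)) (\<lambda>j p. \<Psi>w (f p) * f' j p) (\<lambda>j p. \<Psi>v (f p) * cnj (f' j p))"
  unfolding wirtinger_def
proof
  fix p
  have "((\<lambda>p. \<Psi> (f p)) has_derivative (\<lambda>h. \<Psi>w (f p) * (\<Sum>j\<in>UNIV. f' j p * h $ j) + \<Psi>v (f p) * cnj (\<Sum>j\<in>UNIV. f' j p * h $ j))) (at p)"
    using assms unfolding wirtinger_def wirtinger1_def
    by (intro has_derivative_compose[of f "\<lambda>h. \<Sum>j\<in>UNIV. f' j p * h $ j" p UNIV \<Psi>]) auto
  then show "((\<lambda>p. \<Psi> (f p)) has_derivative (\<lambda>h. \<Sum>j\<in>UNIV. \<Psi>w (f p) * f' j p * h $ j + \<Psi>v (f p) * cnj (f' j p) * cnj (h $ j))) (at p)"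
    by (simp add: sum.distrib sum_distrib_left mult.assoc)
qed

lemma wirtinger_curve:
  fixes z :: "real \<Rightarrow> complex ^ 'i::finite" and z' :: "complex ^ 'i"
  assumes g: "wirtinger g a b" and z: "\<And>j. ((\<lambda>t. z t $ j) has_vector_derivative z' $ j) (at t)"
  shows "((\<lambda>t. g (z t)) has_vector_derivative (\<Sum>j\<in>UNIV. a j (z t) * z' $ j + b j (z t) * cnj (z' $ j))) (at t)"
proof -
  have ax: "bounded_linear (axis j :: complex \<Rightarrow> complex ^ 'i)" for j
    unfolding linear_conv_bounded_linear[symmetric]
    by (rule linearI) (auto simp: vec_eq_iff axis_def)
  have rep: "v = (\<Sum>j\<in>UNIV. axis j (v $ j))" for v :: "complex ^ 'i"
    by (simp add: vec_eq_iff axis_def)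
  have "((\<lambda>t. \<Sum>j\<in>UNIV. axis j (z t $ j)) has_vector_derivative (\<Sum>j\<in>UNIV. axis j (z' $ j))) (at t)"
    by (intro has_vector_derivative_sum bounded_linear.has_vector_derivative[OF ax] z)
  then have "(z has_vector_derivative z') (at t)" unfolding rep[symmetric] .
  then have "(g \<circ> z has_derivative (\<lambda>h. \<Sum>j\<in>UNIV. a j p * h $ j + b j p * cnj (h $ j)) \<circ> (\<lambda>s. s *\<^sub>R z')) (at t)" if "p = z t" for p
    using g that unfolding wirtinger_def has_vector_derivative_def by (intro diff_chain_at) auto
  then show ?thesis unfolding has_vector_derivative_def o_def
    by (simp add: scaleR_sum_right algebra_simps)
qed

section \<open>Weighted homogeneous polynomials\<close>

primrec wt :: "'d option \<Rightarrow> int" where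
  "wt None = 2"
| "wt (Some _) = 1"

text \<open>Weights are integers because differentiation lowers them, possibly below $0$, where only the zero
  function is left.\<close>

inductive wpoly :: "int \<Rightarrow> (complex ^ 'd::finite option \<Rightarrow> complex) \<Rightarrow> bool" where
  wpoly_zero: "wpoly w (\<lambda>_. 0)"
| wpoly_const: "wpoly 0 (\<lambda>_. c)"
| wpoly_var: "wpoly (wt j) (\<lambda>p. p $ j)"
| wpoly_add: "wpoly w f \<Longrightarrow> wpoly w g \<Longrightarrow> wpoly w (\<lambda>p. f p + g p)"
| wpoly_mult: "wpoly w f \<Longrightarrow> wpoly w' g \<Longrightarrow> wpoly (w + w') (\<lambda>p. f p * g p)"

lemma wpoly_tame: "wpoly w f \<Longrightarrow> tame f"
  by (induction rule: wpoly.induct) (intro tame_const tame_nth tame_id tame_add tame_mult; assumption)+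

lemma wpoly_cmult: "wpoly w f \<Longrightarrow> wpoly w (\<lambda>p. c * f p)"
  using wpoly_mult[OF wpoly_const] by fastforce

lemma wpoly_sum: "(\<And>i. i \<in> I \<Longrightarrow> wpoly w (f i)) \<Longrightarrow> wpoly w (\<lambda>p. \<Sum>i\<in>I. f i p)"
  by (induction I rule: infinite_finite_induct) (auto intro: wpoly.intros)

lemma wpoly_scale:
  assumes "wpoly w f" "c \<noteq> 0"
  shows "f (\<chi> j. c powi wt j * p $ j) = c powi w * f p"
  using assms(1)
  by (induction rule: wpoly.induct) (simp_all add: power_int_add assms(2) algebra_simps)

lemma wpoly_derivative:
  fixes f :: "complex ^ 'd::finite option \<Rightarrow> complex"
  assumes "wpoly w f"
  shows "\<exists>f'. holo f f' \<and> (\<forall>j. wpoly (w - wt j) (f' j)) \<and> (\<forall>p. (\<Sum>j\<in>UNIV. of_int (wt j) * p $ j * f' j p) = of_int w * f p)"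
  using assms
proof (induction rule: wpoly.induct)
  case (wpoly_zero w)
  show ?case by (rule exI[of _ "\<lambda>_ _. 0"]) (auto intro: wirtinger_const wpoly.intros)
next
  case (wpoly_const c)
  show ?case by (rule exI[of _ "\<lambda>_ _. 0"]) (auto intro: wirtinger_const wpoly.intros)
next
  case (wpoly_var k)
  show ?case
  proof (rule exI[of _ "\<lambda>j _. if j = k then 1 else 0"], intro conjI allI)
    have "((\<lambda>p. p $ k) has_derivative (\<lambda>h. h $ k)) (at p)" for p :: "complex ^ 'd option"
      by (rule bounded_linear_imp_has_derivative[OF bounded_linear_vec_nth])
    then show "holo (\<lambda>p. p $ k) (\<lambda>j _. if j = k then 1 else 0)"
      unfolding wirtinger_def by (simp add: if_distrib[of "\<lambda>x. x * _"] cong: if_cong)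
    show "wpoly (wt k - wt j) (\<lambda>_. if j = k then 1 else 0)" for j
      using wpoly.wpoly_zero wpoly.wpoly_const by (cases "j = k") auto
    show "(\<Sum>j\<in>UNIV. of_int (wt j) * p $ j * (if j = k then 1 else 0)) = of_int (wt k) * p $ k" for p :: "complex ^ 'd option"
      by (simp add: if_distrib cong: if_cong)
  qed
next
  case (wpoly_add w f g)
  then obtain f' g' where *: "holo f f'" "\<And>j. wpoly (w - wt j) (f' j)" "\<And>p. (\<Sum>j\<in>UNIV. of_int (wt j) * p $ j * f' j p) = of_int w * f p"
    "holo g g'" "\<And>j. wpoly (w - wt j) (g' j)" "\<And>p. (\<Sum>j\<in>UNIV. of_int (wt j) * p $ j * g' j p) = of_int w * g p"
    by blast
  show ?case
  proof (rule exI[of _ "\<lambda>j p. f' j p + g' j p"], intro conjI allI)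
    show "holo (\<lambda>p. f p + g p) (\<lambda>j p. f' j p + g' j p)" using wirtinger_add[OF *(1) *(4)] by simp
    show "wpoly (w - wt j) (\<lambda>p. f' j p + g' j p)" for j by (intro wpoly.wpoly_add *)
    show "(\<Sum>j\<in>UNIV. of_int (wt j) * p $ j * (f' j p + g' j p)) = of_int w * (f p + g p)" for p
      using *(3)[of p] *(6)[of p] by (simp add: algebra_simps sum.distrib)
  qed
next
  case (wpoly_mult w f v g)
  then obtain f' g' where *: "holo f f'" "\<And>j. wpoly (w - wt j) (f' j)" "\<And>p. (\<Sum>j\<in>UNIV. of_int (wt j) * p $ j * f' j p) = of_int w * f p"
    "holo g g'" "\<And>j. wpoly (v - wt j) (g' j)" "\<And>p. (\<Sum>j\<in>UNIV. of_int (wt j) * p $ j * g' j p) = of_int v * g p"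
    by blast
  show ?case
  proof (rule exI[of _ "\<lambda>j p. f' j p * g p + f p * g' j p"], intro conjI allI)
    show "holo (\<lambda>p. f p * g p) (\<lambda>j p. f' j p * g p + f p * g' j p)" using wirtinger_mult[OF *(1) *(4)] by simp
    show "wpoly (w + v - wt j) (\<lambda>p. f' j p * g p + f p * g' j p)" for j
    proof (rule wpoly.wpoly_add)
      show "wpoly (w + v - wt j) (\<lambda>p. f' j p * g p)"
        using wpoly.wpoly_mult[OF *(2)[of j] wpoly_mult.hyps(2)] by (simp add: algebra_simps)
      show "wpoly (w + v - wt j) (\<lambda>p. f p * g' j p)"
        using wpoly.wpoly_mult[OF wpoly_mult.hyps(1) *(5)[of j]] by (simp add: algebra_simps)
    qed
    have "(\<Sum>j\<in>UNIV. of_int (wt j) * p $ j * (f' j p * g p + f p * g' j p)) =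
        (\<Sum>j\<in>UNIV. of_int (wt j) * p $ j * f' j p) * g p + f p * (\<Sum>j\<in>UNIV. of_int (wt j) * p $ j * g' j p)" for p
      by (simp add: algebra_simps sum.distrib sum_distrib_left sum_distrib_right)
    then show "(\<Sum>j\<in>UNIV. of_int (wt j) * p $ j * (f' j p * g p + f p * g' j p)) = of_int (w + v) * (f p * g p)" for p
      using *(3)[of p] *(6)[of p] by (simp add: algebra_simps)
  qed
qed

section \<open>Gaussian points with prescribed covariances\<close>

text \<open>With \<open>r = u cos 2\<omega>\<close>, the components \<open>Z\<^sub>i\<close> have \<open>E |Z\<^sub>i|\<^sup>2 = u\<close> and
  \<open>E Z\<^sub>i\<^sup>2 = r\<close>; the component of index \<^const>\<open>None\<close> is the homogenising variable, set to \<open>r\<close>.\<close>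

definition zpt :: "real \<Rightarrow> real \<Rightarrow> (real ^ 'd::finite) \<times> (real ^ 'd) \<Rightarrow> complex ^ 'd option" where
  "zpt u \<omega> z = (\<chi> j. case j of None \<Rightarrow> of_real (u * cos (2 * \<omega>))
     | Some i \<Rightarrow> of_real (sqrt u * cos \<omega> * fst z $ i) + \<i> * of_real (sqrt u * sin \<omega> * snd z $ i))"

definition zpt' :: "real \<Rightarrow> real \<Rightarrow> (real ^ 'd::finite) \<times> (real ^ 'd) \<Rightarrow> complex ^ 'd option" where
  "zpt' u \<omega> z = (\<chi> j. case j of None \<Rightarrow> of_real (- 2 * u * sin (2 * \<omega>))
     | Some i \<Rightarrow> of_real (- sqrt u * sin \<omega> * fst z $ i) + \<i> * of_real (sqrt u * cos \<omega> * snd z $ i))"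

lemma zpt_nth [simp]:
  "zpt u \<omega> z $ None = of_real (u * cos (2 * \<omega>))"
  "zpt u \<omega> z $ Some i = of_real (sqrt u * cos \<omega> * fst z $ i) + \<i> * of_real (sqrt u * sin \<omega> * snd z $ i)"
  "zpt' u \<omega> z $ None = of_real (- 2 * u * sin (2 * \<omega>))"
  "zpt' u \<omega> z $ Some i = of_real (- sqrt u * sin \<omega> * fst z $ i) + \<i> * of_real (sqrt u * cos \<omega> * snd z $ i)"
  unfolding zpt_def zpt'_def by simp_all

lemma tame_zpt: "tame (\<lambda>z. zpt u (fst z) (snd z))"
proof (rule tame_vec)
  fix j :: "'a option"
  show "tame (\<lambda>z. zpt u (fst z) (snd z) $ j)"
    by (cases j; simp only: zpt_nth)
      (intro tame_of_real tame_mult tame_const tame_cos tame_sin tame_add tame_nth tame_fst tame_snd tame_id)+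
qed

lemma tame_zpt': "tame (\<lambda>z. zpt' u (fst z) (snd z))"
proof (rule tame_vec)
  fix j :: "'a option"
  show "tame (\<lambda>z. zpt' u (fst z) (snd z) $ j)"
    by (cases j; simp only: zpt_nth)
      (intro tame_of_real tame_mult tame_const tame_cos tame_sin tame_add tame_nth tame_fst tame_snd tame_id)+
qed

lemma zpt_derivative: "((\<lambda>\<omega>. zpt u \<omega> z $ j) has_vector_derivative zpt' u \<omega> z $ j) (at \<omega>)"
proof (cases j)
  case None
  have "((\<lambda>\<omega>. complex_of_real (u * cos (2 * \<omega>))) has_vector_derivative complex_of_real (- 2 * u * sin (2 * \<omega>))) (at \<omega>)"
    by (rule has_vector_derivative_of_real) (auto intro!: derivative_eq_intros)
  then show ?thesis unfolding None zpt_nth .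
next
  case (Some i)
  have "((\<lambda>\<omega>. complex_of_real (sqrt u * cos \<omega> * fst z $ i) + \<i> * complex_of_real (sqrt u * sin \<omega> * snd z $ i)) has_vector_derivative
     complex_of_real (- sqrt u * sin \<omega> * fst z $ i) + \<i> * complex_of_real (sqrt u * cos \<omega> * snd z $ i)) (at \<omega>)"
    by (intro has_vector_derivative_add has_vector_derivative_mult_right has_vector_derivative_of_real) (auto intro!: derivative_eq_intros)
  then show ?thesis unfolding Some zpt_nth .
qed

lemma zpt_ibp:
  fixes a b :: "'d::finite option \<Rightarrow> complex ^ 'd option \<Rightarrow> complex" and \<kappa> \<mu> :: complex
  assumes g: "wirtinger g a b" and tg: "tame g" and ta: "\<And>j. tame (a j)" and tb: "\<And>j. tame (b j)"
  shows "(\<integral>z. (\<kappa> * of_real (fst z $ i) + \<mu> * of_real (snd z $ i)) * g (zpt u \<omega> z) \<partial>gaussian)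
    = (\<kappa> * of_real (sqrt u * cos \<omega>) + \<i> * \<mu> * of_real (sqrt u * sin \<omega>)) * (\<integral>z. a (Some i) (zpt u \<omega> z) \<partial>gaussian)
    + (\<kappa> * of_real (sqrt u * cos \<omega>) - \<i> * \<mu> * of_real (sqrt u * sin \<omega>)) * (\<integral>z. b (Some i) (zpt u \<omega> z) \<partial>gaussian)"
proof -
  let ?\<alpha> = "complex_of_real (sqrt u * cos \<omega>)" and ?\<beta> = "complex_of_real (sqrt u * sin \<omega>)"
  let ?Z = "zpt u \<omega> :: (real ^ 'd) \<times> (real ^ 'd) \<Rightarrow> _"
  have tZ: "tame ?Z" by (rule tame_slice[OF tame_zpt])
  note tc = tame_compose[OF _ tZ]
  have X: "(\<integral>z. of_real (fst z $ i) * g (?Z z) \<partial>gaussian) = (\<integral>z. ?\<alpha> * (a (Some i) (?Z z) + b (Some i) (?Z z)) \<partial>gaussian)"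
  proof -
    have "(\<integral>z. ((axis i 1, 0) \<bullet> z) *\<^sub>R g (?Z z) \<partial>gaussian) = (\<integral>z. ?\<alpha> * (a (Some i) (?Z z) + b (Some i) (?Z z)) \<partial>gaussian)"
    proof (rule gaussian_integration_by_parts)
      show "tame (\<lambda>z. g (?Z z))" by (rule tc[OF tg])
      show "tame (\<lambda>z. ?\<alpha> * (a (Some i) (?Z z) + b (Some i) (?Z z)))"
        by (intro tame_mult tame_const tame_add tc[OF ta] tc[OF tb])
      fix z :: "(real ^ 'd) \<times> (real ^ 'd)"
      let ?z' = "(\<chi> j. if j = Some i then ?\<alpha> else 0) :: complex ^ 'd option"
      have "((\<lambda>t. g (?Z (z + t *\<^sub>R (axis i 1, 0)))) has_vector_derivative
          (\<Sum>j\<in>UNIV. a j (?Z (z + 0 *\<^sub>R (axis i 1, 0))) * ?z' $ j + b j (?Z (z + 0 *\<^sub>R (axis i 1, 0))) * cnj (?z' $ j))) (at 0)"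
      proof (rule wirtinger_curve[OF g])
        fix j
        show "((\<lambda>t. ?Z (z + t *\<^sub>R (axis i 1, 0)) $ j) has_vector_derivative ?z' $ j) (at 0)"
        proof (cases j)
          case (Some k)
          have "((\<lambda>t. complex_of_real (sqrt u * cos \<omega> * (fst z $ k + t * axis i 1 $ k)) + \<i> * of_real (sqrt u * sin \<omega> * snd z $ k))
              has_vector_derivative of_real (sqrt u * cos \<omega> * axis i 1 $ k) + 0) (at 0)"
            by (intro has_vector_derivative_add has_vector_derivative_of_real has_vector_derivative_const) (auto intro!: derivative_eq_intros)
          then show ?thesis by (cases "k = i") (simp_all add: Some axis_def)
        qed simp
      qed
      also have "(\<Sum>j\<in>UNIV. a j (?Z (z + 0 *\<^sub>R (axis i 1, 0))) * ?z' $ j + b j (?Z (z + 0 *\<^sub>R (axis i 1, 0))) * cnj (?z' $ j))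
          = ?\<alpha> * (a (Some i) (?Z z) + b (Some i) (?Z z))"
        unfolding UNIV_option_sum by (simp add: if_distrib[of "\<lambda>x. _ * x"] if_distrib[of cnj] sum.distrib algebra_simps zero_prod_def[symmetric] cong: if_cong)
      finally show "((\<lambda>t. g (?Z (z + t *\<^sub>R (axis i 1, 0)))) has_vector_derivative ?\<alpha> * (a (Some i) (?Z z) + b (Some i) (?Z z))) (at 0)" .
    qed
    then show ?thesis by (simp add: inner_prod_def inner_axis' scaleR_conv_of_real)
  qed
  have Y: "(\<integral>z. of_real (snd z $ i) * g (?Z z) \<partial>gaussian) = (\<integral>z. \<i> * ?\<beta> * (a (Some i) (?Z z) - b (Some i) (?Z z)) \<partial>gaussian)"
  proof -
    have "(\<integral>z. ((0, axis i 1) \<bullet> z) *\<^sub>R g (?Z z) \<partial>gaussian) = (\<integral>z. \<i> * ?\<beta> * (a (Some i) (?Z z) - b (Some i) (?Z z)) \<partial>gaussian)"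
    proof (rule gaussian_integration_by_parts)
      show "tame (\<lambda>z. g (?Z z))" by (rule tc[OF tg])
      show "tame (\<lambda>z. \<i> * ?\<beta> * (a (Some i) (?Z z) - b (Some i) (?Z z)))"
        by (intro tame_mult tame_const tame_diff tc[OF ta] tc[OF tb])
      fix z :: "(real ^ 'd) \<times> (real ^ 'd)"
      let ?z' = "(\<chi> j. if j = Some i then \<i> * ?\<beta> else 0) :: complex ^ 'd option"
      have "((\<lambda>t. g (?Z (z + t *\<^sub>R (0, axis i 1)))) has_vector_derivative
          (\<Sum>j\<in>UNIV. a j (?Z (z + 0 *\<^sub>R (0, axis i 1))) * ?z' $ j + b j (?Z (z + 0 *\<^sub>R (0, axis i 1))) * cnj (?z' $ j))) (at 0)"
      proof (rule wirtinger_curve[OF g])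
        fix j
        show "((\<lambda>t. ?Z (z + t *\<^sub>R (0, axis i 1)) $ j) has_vector_derivative ?z' $ j) (at 0)"
        proof (cases j)
          case (Some k)
          have "((\<lambda>t. complex_of_real (sqrt u * cos \<omega> * fst z $ k) + \<i> * of_real (sqrt u * sin \<omega> * (snd z $ k + t * axis i 1 $ k)))
              has_vector_derivative 0 + \<i> * of_real (sqrt u * sin \<omega> * axis i 1 $ k)) (at 0)"
            by (intro has_vector_derivative_add has_vector_derivative_of_real has_vector_derivative_const has_vector_derivative_mult_right) (auto intro!: derivative_eq_intros)
          then show ?thesis by (cases "k = i") (simp_all add: Some axis_def)
        qed simp
      qed
      also have "(\<Sum>j\<in>UNIV. a j (?Z (z + 0 *\<^sub>R (0, axis i 1))) * ?z' $ j + b j (?Z (z + 0 *\<^sub>R (0, axis i 1))) * cnj (?z' $ j))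
          = \<i> * ?\<beta> * (a (Some i) (?Z z) - b (Some i) (?Z z))"
        unfolding UNIV_option_sum by (simp add: if_distrib[of "\<lambda>x. _ * x"] if_distrib[of cnj] sum.distrib algebra_simps zero_prod_def[symmetric] cong: if_cong)
      finally show "((\<lambda>t. g (?Z (z + t *\<^sub>R (0, axis i 1)))) has_vector_derivative \<i> * ?\<beta> * (a (Some i) (?Z z) - b (Some i) (?Z z))) (at 0)" .
    qed
    then show ?thesis by (simp add: inner_prod_def inner_axis' scaleR_conv_of_real)
  qed
  have tx: "tame (\<lambda>z :: (real ^ 'd) \<times> (real ^ 'd). complex_of_real (fst z $ i) * g (?Z z))"
    and ty: "tame (\<lambda>z :: (real ^ 'd) \<times> (real ^ 'd). complex_of_real (snd z $ i) * g (?Z z))"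
    by (intro tame_mult tame_of_real tame_nth tame_fst tame_snd tame_id tc[OF tg])+
  have "(\<integral>z. (\<kappa> * of_real (fst z $ i) + \<mu> * of_real (snd z $ i)) * g (?Z z) \<partial>gaussian)
    = (\<integral>z. \<kappa> * (of_real (fst z $ i) * g (?Z z)) + \<mu> * (of_real (snd z $ i) * g (?Z z)) \<partial>gaussian)"
    by (simp add: algebra_simps)
  also have "\<dots> = \<kappa> * (\<integral>z. of_real (fst z $ i) * g (?Z z) \<partial>gaussian) + \<mu> * (\<integral>z. of_real (snd z $ i) * g (?Z z) \<partial>gaussian)"
    using integrable_tame[OF tx] integrable_tame[OF ty]
    by (subst Bochner_Integration.integral_add) auto
  also have "\<dots> = (\<kappa> * ?\<alpha> + \<i> * \<mu> * ?\<beta>) * (\<integral>z. a (Some i) (?Z z) \<partial>gaussian)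
    + (\<kappa> * ?\<alpha> - \<i> * \<mu> * ?\<beta>) * (\<integral>z. b (Some i) (?Z z) \<partial>gaussian)"
    unfolding X Y using integrable_tame[OF tc[OF ta]] integrable_tame[OF tc[OF tb]]
    by (simp add: algebra_simps)
  finally show ?thesis .
qed

section \<open>The functions $\bar w^a (|w|^2+\varepsilon)^t$\<close>

definition psi :: "real \<Rightarrow> nat \<Rightarrow> real \<Rightarrow> complex \<Rightarrow> complex" where
  "psi \<epsilon> a t w = cnj w ^ a * of_real (((cmod w)\<^sup>2 + \<epsilon>) powr t)"

definition psiw :: "real \<Rightarrow> nat \<Rightarrow> real \<Rightarrow> complex \<Rightarrow> complex" where
  "psiw \<epsilon> a t w = of_real t * psi \<epsilon> (a + 1) (t - 1) w"

definition psiv :: "real \<Rightarrow> nat \<Rightarrow> real \<Rightarrow> complex \<Rightarrow> complex" where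
  "psiv \<epsilon> a t w = of_nat a * psi \<epsilon> (a - 1) t w + of_real t * w * psi \<epsilon> a (t - 1) w"

definition psivv :: "real \<Rightarrow> nat \<Rightarrow> real \<Rightarrow> complex \<Rightarrow> complex" where
  "psivv \<epsilon> a t w = of_nat a * psiv \<epsilon> (a - 1) t w + of_real t * w * psiv \<epsilon> a (t - 1) w"

lemma wirtinger1_mult:
  assumes "wirtinger1 f a b" "wirtinger1 g c d"
  shows "wirtinger1 (\<lambda>w. f w * g w) (\<lambda>w. f w * c w + a w * g w) (\<lambda>w. f w * d w + b w * g w)"
  unfolding wirtinger1_def
proof
  fix w
  have "((\<lambda>w. f w * g w) has_derivative (\<lambda>h. f w * (c w * h + d w * cnj h) + (a w * h + b w * cnj h) * g w)) (at w)"
    using assms unfolding wirtinger1_def by (intro has_derivative_mult) auto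
  then show "((\<lambda>w. f w * g w) has_derivative (\<lambda>h. (f w * c w + a w * g w) * h + (f w * d w + b w * g w) * cnj h)) (at w)"
    by (simp add: algebra_simps)
qed

lemma wirtinger1_add:
  assumes "wirtinger1 f a b" "wirtinger1 g c d"
  shows "wirtinger1 (\<lambda>w. f w + g w) (\<lambda>w. a w + c w) (\<lambda>w. b w + d w)"
  unfolding wirtinger1_def
proof
  fix w
  have "((\<lambda>w. f w + g w) has_derivative (\<lambda>h. (a w * h + b w * cnj h) + (c w * h + d w * cnj h))) (at w)"
    using assms unfolding wirtinger1_def by (intro has_derivative_add) auto
  then show "((\<lambda>w. f w + g w) has_derivative (\<lambda>h. (a w + c w) * h + (b w + d w) * cnj h)) (at w)"
    by (simp add: algebra_simps)
qed

lemma wirtinger1_const: "wirtinger1 (\<lambda>_. c) (\<lambda>_. 0) (\<lambda>_. 0)"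
  and wirtinger1_id: "wirtinger1 (\<lambda>w. w) (\<lambda>_. 1) (\<lambda>_. 0)"
  unfolding wirtinger1_def by auto

lemma wirtinger1_cmult:
  assumes "wirtinger1 f a b" shows "wirtinger1 (\<lambda>w. c * f w) (\<lambda>w. c * a w) (\<lambda>w. c * b w)"
  using wirtinger1_mult[OF wirtinger1_const assms] by simp

lemma wirtinger1_cnj_power: "wirtinger1 (\<lambda>w. cnj w ^ a) (\<lambda>_. 0) (\<lambda>w. of_nat a * cnj w ^ (a - 1))"
  unfolding wirtinger1_def
  by (auto intro!: derivative_eq_intros has_derivative_cnj simp: mult_ac)

lemma wirtinger1_powr:
  assumes "\<epsilon> > 0"
  shows "wirtinger1 (\<lambda>w. of_real (((cmod w)\<^sup>2 + \<epsilon>) powr t))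
    (\<lambda>w. of_real t * (cnj w * of_real (((cmod w)\<^sup>2 + \<epsilon>) powr (t - 1))))
    (\<lambda>w. of_real t * (w * of_real (((cmod w)\<^sup>2 + \<epsilon>) powr (t - 1))))"
  unfolding wirtinger1_def
proof
  fix w
  let ?R = "(cmod w)\<^sup>2 + \<epsilon>"
  have R: "?R > 0" using assms by (simp add: add_nonneg_pos)
  have d1: "((\<lambda>w. (cmod w)\<^sup>2 + \<epsilon>) has_derivative (\<lambda>h. 2 * (w \<bullet> h))) (at w)"
    unfolding power2_norm_eq_inner by (auto intro!: derivative_eq_intros simp: inner_commute)
  have "((\<lambda>x. x powr t) has_derivative (*) (t * ?R powr (t - 1))) (at ?R)"
    using has_real_derivative_powr[OF R, of t] by (simp add: has_field_derivative_def)
  from has_derivative_compose[OF d1 this]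
  have "((\<lambda>w. of_real (((cmod w)\<^sup>2 + \<epsilon>) powr t)) has_derivative (\<lambda>h. complex_of_real (t * ?R powr (t - 1) * (2 * (w \<bullet> h))))) (at w)"
    by (intro has_derivative_of_real)
  moreover have "complex_of_real (2 * (w \<bullet> h)) = cnj w * h + w * cnj h" for h
    by (simp add: complex_eq_iff inner_complex_def)
  then have "complex_of_real (t * ?R powr (t - 1) * (2 * (w \<bullet> h))) = of_real t * (cnj w * of_real (?R powr (t - 1))) * h + of_real t * (w * of_real (?R powr (t - 1))) * cnj h" for h
    unfolding of_real_mult[of _ "2 * (w \<bullet> h)"] by (simp add: algebra_simps)
  ultimately show "((\<lambda>w. of_real (((cmod w)\<^sup>2 + \<epsilon>) powr t)) has_derivative
      (\<lambda>h. of_real t * (cnj w * of_real (?R powr (t - 1))) * h + of_real t * (w * of_real (?R powr (t - 1))) * cnj h)) (at w)"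
    by simp
qed

context
  fixes \<epsilon> :: real
  assumes \<epsilon>: "\<epsilon> > 0"
begin

lemma wirtinger1_psi: "wirtinger1 (psi \<epsilon> a t) (psiw \<epsilon> a t) (psiv \<epsilon> a t)"
  using wirtinger1_mult[OF wirtinger1_cnj_power[of a] wirtinger1_powr[OF \<epsilon>, of t]]
  unfolding psi_def psiw_def psiv_def by (simp add: algebra_simps)

lemma wirtinger1_psiw:
  "wirtinger1 (psiw \<epsilon> a t) (\<lambda>w. of_real t * psiw \<epsilon> (a + 1) (t - 1) w) (\<lambda>w. of_real t * psiv \<epsilon> (a + 1) (t - 1) w)"
  unfolding psiw_def[of \<epsilon> a t, abs_def] by (rule wirtinger1_cmult[OF wirtinger1_psi])

lemma wirtinger1_psiv: "wirtinger1 (psiv \<epsilon> a t) (\<lambda>w. of_real t * psiv \<epsilon> (a + 1) (t - 1) w) (psivv \<epsilon> a t)"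
proof -
  have "wirtinger1 (psiv \<epsilon> a t)
    (\<lambda>w. of_nat a * psiw \<epsilon> (a - 1) t w + (of_real t * w * psiw \<epsilon> a (t - 1) w + of_real t * 1 * psi \<epsilon> a (t - 1) w))
    (\<lambda>w. of_nat a * psiv \<epsilon> (a - 1) t w + (of_real t * w * psiv \<epsilon> a (t - 1) w + of_real t * 0 * psi \<epsilon> a (t - 1) w))"
    unfolding psiv_def[of \<epsilon> a t, abs_def]
    by (intro wirtinger1_add wirtinger1_cmult wirtinger1_mult wirtinger1_id wirtinger1_psi)
  moreover have "of_nat a * psiw \<epsilon> (a - 1) t w + (of_real t * w * psiw \<epsilon> a (t - 1) w + of_real t * 1 * psi \<epsilon> a (t - 1) w)
     = of_real t * psiv \<epsilon> (a + 1) (t - 1) w" for w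
    by (cases a) (simp_all add: psiw_def psiv_def algebra_simps)
  ultimately show ?thesis unfolding psivv_def[abs_def] by simp
qed

lemma tame_psi: "tame (psi \<epsilon> a t)"
proof -
  have R: "(cmod w)\<^sup>2 + \<epsilon> > 0" for w using \<epsilon> by (simp add: add_nonneg_pos)
  have c: "continuous_on UNIV (\<lambda>w. ((cmod w)\<^sup>2 + \<epsilon>) powr t)"
    using R by (intro continuous_on_powr continuous_intros) (auto simp: less_imp_neq[symmetric])
  have "tame (\<lambda>w. ((cmod w)\<^sup>2 + \<epsilon>) powr t)"
  proof (cases "t > 0")
    case True
    show ?thesis
      by (rule tame_powr) (use R True in \<open>auto intro!: tame_add tame_power tame_norm tame_id tame_const simp: less_imp_le\<close>)
  next
    case False
    have "norm (((cmod w)\<^sup>2 + \<epsilon>) powr t) \<le> \<epsilon> powr t" for w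
      using False \<epsilon> by (auto intro!: powr_mono2')
    with c show ?thesis by (rule tame_bounded)
  qed
  then show ?thesis unfolding psi_def[abs_def] by (intro tame_mult tame_power tame_cnj tame_of_real tame_id)
qed

lemma tame_psiw: "tame (psiw \<epsilon> a t)"
  unfolding psiw_def[abs_def] by (intro tame_mult tame_const tame_psi)

lemma tame_psiv: "tame (psiv \<epsilon> a t)"
  unfolding psiv_def[abs_def] by (intro tame_add tame_mult tame_const tame_id tame_psi)

lemma tame_psivv: "tame (psivv \<epsilon> a t)"
  unfolding psivv_def[abs_def] by (intro tame_add tame_mult tame_const tame_id tame_psiv)

lemma psi_euler: "w * psiw \<epsilon> a t w - cnj w * psiv \<epsilon> a t w = - of_nat a * psi \<epsilon> a t w"
  by (cases a) (simp_all add: psi_def psiw_def psiv_def algebra_simps)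

end

section \<open>Differentiation along the covariance path\<close>

definition flow_derivative where
  "flow_derivative u a b \<omega> z = (\<Sum>j\<in>UNIV. a j (zpt u \<omega> z) * zpt' u \<omega> z $ j + b j (zpt u \<omega> z) * cnj (zpt' u \<omega> z $ j))"

lemma flow_has_derivative:
  assumes "wirtinger g a b"
  shows "((\<lambda>\<omega>. g (zpt u \<omega> z)) has_vector_derivative flow_derivative u a b \<omega> z) (at \<omega>)"
  unfolding flow_derivative_def by (rule wirtinger_curve[OF assms zpt_derivative])

lemma tame_flow_derivative:
  assumes "\<And>j. tame (a j)" "\<And>j. tame (b j)"
  shows "tame (\<lambda>z. flow_derivative u a b (fst z) (snd z))"
  unfolding flow_derivative_def
  by (intro tame_sum tame_add tame_mult tame_cnj tame_nth tame_zpt' tame_compose[OF assms(1) tame_zpt] tame_compose[OF assms(2) tame_zpt])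

text \<open>Write $D = \partial_{None} + \frac12 \sum_i \partial_i^2$ and $V(\omega) = E\,g(Z_\omega)$. Integration by
  parts gives $V' = r' E(D + \bar D)g$, and the infinitesimal phase rotation \<open>euler\<close> of weight $w$ gives
  $w V = 2r E(D - \bar D)g$. Eliminating $D$ leaves the identity below, where only $2\bar D g$ occurs.\<close>

lemma flow_identity:
  fixes g :: "complex ^ 'd::finite option \<Rightarrow> complex" and \<omega> :: real
  assumes u: "u \<ge> 0" and W: "wirtinger g a b" and tg: "tame g" and ta: "\<And>j. tame (a j)" and tb: "\<And>j. tame (b j)"
    and Wa: "\<And>i. wirtinger (a (Some i)) (c i) (d i)" and tc: "\<And>i j. tame (c i j)" and td: "\<And>i j. tame (d i j)"
    and Wb: "\<And>i. wirtinger (b (Some i)) (d' i) (e i)" and td': "\<And>i j. tame (d' i j)" and te: "\<And>i j. tame (e i j)"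
    and mixed: "\<And>i. d i (Some i) = d' i (Some i)"
    and euler: "\<And>p. (\<Sum>j\<in>UNIV. of_int (wt j) * (p $ j * a j p - cnj (p $ j) * b j p)) = of_int w * g p"
  defines "r \<equiv> complex_of_real (u * cos (2 * \<omega>))" and "r' \<equiv> complex_of_real (- 2 * u * sin (2 * \<omega>))"
  shows "2 * r * (\<integral>z. flow_derivative u a b \<omega> z \<partial>gaussian) =
    r' * of_int w * (\<integral>z. g (zpt u \<omega> z) \<partial>gaussian)
    + 2 * r * r' * (\<integral>z. 2 * b None (zpt u \<omega> z) + (\<Sum>i\<in>UNIV. e i (Some i) (zpt u \<omega> z)) \<partial>gaussian)"
proof -
  define A where "A = complex_of_real (sqrt u * cos \<omega>)"
  define B where "B = complex_of_real (sqrt u * sin \<omega>)"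
  define U where "U = complex_of_real u"
  have U: "U = A\<^sup>2 + B\<^sup>2"
    unfolding U_def A_def B_def of_real_power[symmetric] of_real_add[symmetric] of_real_eq_iff
    using u by (simp add: power_mult_distrib distrib_left[symmetric])
  have r: "r = A\<^sup>2 - B\<^sup>2"
    unfolding r_def A_def B_def of_real_power[symmetric] of_real_diff[symmetric] of_real_eq_iff
    using u by (simp add: power_mult_distrib cos_double right_diff_distrib)
  have r': "r' = - 4 * A * B"
  proof -
    have "- 2 * u * sin (2 * \<omega>) = - 4 * (sqrt u * cos \<omega>) * (sqrt u * sin \<omega>)"
      using u by (simp add: sin_double)
    then show ?thesis unfolding r'_def A_def B_def by (simp only: of_real_mult of_real_minus of_real_numeral)
  qed
  let ?Z = "zpt u \<omega> :: (real ^ 'd) \<times> (real ^ 'd) \<Rightarrow> _"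
  have tZ: "tame ?Z" by (rule tame_slice[OF tame_zpt])
  note tz = tame_compose[OF _ tZ]
  define \<kappa>1 where "\<kappa>1 = 2 * U * B"
  define \<mu>1 where "\<mu>1 = 2 * \<i> * U * A"
  define \<kappa>2 where "\<kappa>2 = 2 * U * B - 8 * A\<^sup>2 * B"
  define \<mu>2 where "\<mu>2 = - 2 * \<i> * U * A + 8 * \<i> * A * B\<^sup>2"
  let ?x = "\<lambda>i z. complex_of_real (fst (z :: (real ^ 'd) \<times> (real ^ 'd)) $ i)"
  let ?y = "\<lambda>i z. complex_of_real (snd (z :: (real ^ 'd) \<times> (real ^ 'd)) $ i)"
  have point: "2 * r * flow_derivative u a b \<omega> z = r' * of_int w * g (?Z z) + 4 * r * r' * b None (?Z z)
     + (\<Sum>i\<in>UNIV. (\<kappa>1 * ?x i z + \<mu>1 * ?y i z) * a (Some i) (?Z z) + (\<kappa>2 * ?x i z + \<mu>2 * ?y i z) * b (Some i) (?Z z))" for z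
  proof -
    have Zi: "?Z z $ Some i = A * ?x i z + \<i> * (B * ?y i z)" "cnj (?Z z $ Some i) = A * ?x i z - \<i> * (B * ?y i z)"
      "zpt' u \<omega> z $ Some i = - B * ?x i z + \<i> * (A * ?y i z)" "cnj (zpt' u \<omega> z $ Some i) = - B * ?x i z - \<i> * (A * ?y i z)" for i
      unfolding zpt_nth A_def B_def by simp_all
    have cn: "cnj A = A" "cnj B = B" unfolding A_def B_def by simp_all
    have cr: "cnj r = r" "cnj r' = r'" unfolding r_def r'_def by simp_all
    have ZN: "?Z z $ None = r" "cnj (?Z z $ None) = r" "zpt' u \<omega> z $ None = r'" "cnj (zpt' u \<omega> z $ None) = r'"
      unfolding zpt_nth r_def r'_def by simp_all
    define S1 where "S1 = (\<lambda>i. a (Some i) (?Z z) * zpt' u \<omega> z $ Some i + b (Some i) (?Z z) * cnj (zpt' u \<omega> z $ Some i))"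
    define S2 where "S2 = (\<lambda>i. ?Z z $ Some i * a (Some i) (?Z z) - cnj (?Z z $ Some i) * b (Some i) (?Z z))"
    define T where "T = (\<lambda>i. (\<kappa>1 * ?x i z + \<mu>1 * ?y i z) * a (Some i) (?Z z) + (\<kappa>2 * ?x i z + \<mu>2 * ?y i z) * b (Some i) (?Z z))"
    have "2 * r * S1 i = r' * S2 i + T i" for i
      unfolding S1_def S2_def T_def Zi r r' \<kappa>1_def \<mu>1_def \<kappa>2_def \<mu>2_def U by (simp add: cn algebra_simps power2_eq_square)
    then have S: "2 * r * (\<Sum>i\<in>UNIV. S1 i) = r' * (\<Sum>i\<in>UNIV. S2 i) + (\<Sum>i\<in>UNIV. T i)"
      by (simp add: sum_distrib_left sum.distrib)
    have fd: "flow_derivative u a b \<omega> z = a None (?Z z) * r' + b None (?Z z) * r' + (\<Sum>i\<in>UNIV. S1 i)"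
      unfolding flow_derivative_def UNIV_option_sum ZN S1_def cr ..
    have "of_int w * g (?Z z) = 2 * (r * a None (?Z z) - r * b None (?Z z)) + (\<Sum>i\<in>UNIV. S2 i)"
      unfolding euler[symmetric] UNIV_option_sum ZN S2_def cr by simp
    then have "r' * of_int w * g (?Z z) = r' * (2 * (r * a None (?Z z) - r * b None (?Z z)) + (\<Sum>i\<in>UNIV. S2 i))"
      by (simp add: mult.assoc)
    then show ?thesis unfolding T_def[symmetric] fd using S by (simp add: algebra_simps)
  qed
  have Ia: "(\<integral>z. (\<kappa>1 * ?x i z + \<mu>1 * ?y i z) * a (Some i) (?Z z) \<partial>gaussian) = 4 * U * A * B * (\<integral>z. d i (Some i) (?Z z) \<partial>gaussian)" for i
    unfolding zpt_ibp[OF Wa ta tc td] A_def[symmetric] B_def[symmetric] \<kappa>1_def \<mu>1_def by (simp add: algebra_simps)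
  have Ib: "(\<integral>z. (\<kappa>2 * ?x i z + \<mu>2 * ?y i z) * b (Some i) (?Z z) \<partial>gaussian) = - 4 * U * A * B * (\<integral>z. d i (Some i) (?Z z) \<partial>gaussian)
     + 2 * r * r' * (\<integral>z. e i (Some i) (?Z z) \<partial>gaussian)" for i
    unfolding zpt_ibp[OF Wb tb td' te] A_def[symmetric] B_def[symmetric] \<kappa>2_def \<mu>2_def mixed r r' U
    by (simp add: algebra_simps power2_eq_square power3_eq_cube)
  have t1: "tame (\<lambda>z. (\<kappa>1 * ?x i z + \<mu>1 * ?y i z) * a (Some i) (?Z z))"
    and t2: "tame (\<lambda>z. (\<kappa>2 * ?x i z + \<mu>2 * ?y i z) * b (Some i) (?Z z))" for i
    by (intro tame_mult tame_add tame_const tame_of_real tame_nth tame_fst tame_snd tame_id tz[OF ta] tz[OF tb])+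
  have int: "integrable gaussian (\<lambda>z. g (?Z z))" "integrable gaussian (\<lambda>z. b j (?Z z))" "integrable gaussian (\<lambda>z. e i j (?Z z))" for i j
    by (intro integrable_tame tz tg tb te)+
  have "2 * r * (\<integral>z. flow_derivative u a b \<omega> z \<partial>gaussian) = (\<integral>z. 2 * r * flow_derivative u a b \<omega> z \<partial>gaussian)"
    by simp
  also have "\<dots> = r' * of_int w * (\<integral>z. g (?Z z) \<partial>gaussian) + 4 * r * r' * (\<integral>z. b None (?Z z) \<partial>gaussian)
    + (\<Sum>i\<in>UNIV. (\<integral>z. (\<kappa>1 * ?x i z + \<mu>1 * ?y i z) * a (Some i) (?Z z) \<partial>gaussian) + (\<integral>z. (\<kappa>2 * ?x i z + \<mu>2 * ?y i z) * b (Some i) (?Z z) \<partial>gaussian))"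
    unfolding point using int integrable_tame[OF t1] integrable_tame[OF t2]
    by (simp add: Bochner_Integration.integral_sum)
  also have "\<dots> = r' * of_int w * (\<integral>z. g (?Z z) \<partial>gaussian) + 4 * r * r' * (\<integral>z. b None (?Z z) \<partial>gaussian)
    + (\<Sum>i\<in>UNIV. 2 * r * r' * (\<integral>z. e i (Some i) (?Z z) \<partial>gaussian))"
    unfolding Ia Ib by simp
  also have "\<dots> = r' * of_int w * (\<integral>z. g (?Z z) \<partial>gaussian)
    + 2 * r * r' * (\<integral>z. 2 * b None (?Z z) + (\<Sum>i\<in>UNIV. e i (Some i) (?Z z)) \<partial>gaussian)"
    using int by (simp add: sum_distrib_left algebra_simps)
  finally show ?thesis .
qed


definition psi_da where
  "psi_da \<epsilon> a t f f1 h h1 j p = psiw \<epsilon> a t (f p) * f1 j p * h p + psi \<epsilon> a t (f p) * h1 j p"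

definition psi_db where
  "psi_db \<epsilon> a t f f1 h j p = psiv \<epsilon> a t (f p) * cnj (f1 j p) * h p"

lemma wirtinger_psi:
  assumes \<epsilon>: "\<epsilon> > 0" and f: "holo f f1" and h: "holo h h1"
  shows "wirtinger (\<lambda>p. psi \<epsilon> a t (f p) * h p) (psi_da \<epsilon> a t f f1 h h1) (psi_db \<epsilon> a t f f1 h)"
  using wirtinger_mult[OF wirtinger_compose[OF wirtinger1_psi[OF \<epsilon>, of a t] f] h]
  unfolding psi_da_def[abs_def] psi_db_def[abs_def] by simp

lemma flow_identity_psi:
  fixes f h :: "complex ^ 'd::finite option \<Rightarrow> complex" and \<omega> :: real
  assumes u: "u \<ge> 0" and \<epsilon>: "\<epsilon> > 0"
    and f: "holo f f1" "\<And>i. holo (f1 (Some i)) (f2 i)" and h: "holo h h1" "\<And>i. holo (h1 (Some i)) (h2 i)"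
    and tf: "tame f" "\<And>j. tame (f1 j)" "\<And>i j. tame (f2 i j)"
    and th: "tame h" "\<And>j. tame (h1 j)" "\<And>i j. tame (h2 i j)"
    and ef: "\<And>p. (\<Sum>j\<in>UNIV. of_int (wt j) * p $ j * f1 j p) = of_int mf * f p"
    and eh: "\<And>p. (\<Sum>j\<in>UNIV. of_int (wt j) * p $ j * h1 j p) = of_int mh * h p"
  defines "r \<equiv> complex_of_real (u * cos (2 * \<omega>))" and "r' \<equiv> complex_of_real (- 2 * u * sin (2 * \<omega>))"
    and "A \<equiv> \<lambda>p. f1 None p + (\<Sum>i\<in>UNIV. f2 i (Some i) p) / 2" and "B \<equiv> \<lambda>p. (\<Sum>i\<in>UNIV. (f1 (Some i) p)\<^sup>2) / 2"
  shows "2 * r * (\<integral>z. flow_derivative u (psi_da \<epsilon> a t f f1 h h1) (psi_db \<epsilon> a t f f1 h) \<omega> z \<partial>gaussian) =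
    r' * of_int (mh - int a * mf) * (\<integral>z. psi \<epsilon> a t (f (zpt u \<omega> z)) * h (zpt u \<omega> z) \<partial>gaussian)
    + 4 * r * r' * (\<integral>z. (psiv \<epsilon> a t (f (zpt u \<omega> z)) * cnj (A (zpt u \<omega> z)) + psivv \<epsilon> a t (f (zpt u \<omega> z)) * cnj (B (zpt u \<omega> z))) * h (zpt u \<omega> z) \<partial>gaussian)"
proof -
  note W0 = wirtinger_compose[OF wirtinger1_psi[OF \<epsilon>, of a t] f(1)]
  note Ww = wirtinger_compose[OF wirtinger1_psiw[OF \<epsilon>, of a t] f(1)]
  note Wv = wirtinger_compose[OF wirtinger1_psiv[OF \<epsilon>, of a t] f(1)]
  note tp = tame_compose[OF tame_psi[OF \<epsilon>] tf(1)] tame_compose[OF tame_psiw[OF \<epsilon>] tf(1)]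
    tame_compose[OF tame_psiv[OF \<epsilon>] tf(1)] tame_compose[OF tame_psivv[OF \<epsilon>] tf(1)]
  define c where "c = (\<lambda>i j p. (of_real t * psiw \<epsilon> (a + 1) (t - 1) (f p) * f1 j p * f1 (Some i) p + psiw \<epsilon> a t (f p) * f2 i j p) * h p +
      psiw \<epsilon> a t (f p) * f1 (Some i) p * h1 j p + (psiw \<epsilon> a t (f p) * f1 j p * h1 (Some i) p + psi \<epsilon> a t (f p) * h2 i j p))"
  define d where "d = (\<lambda>i j p. of_real t * psiv \<epsilon> (a + 1) (t - 1) (f p) * cnj (f1 j p) * f1 (Some i) p * h p
      + psiv \<epsilon> a t (f p) * cnj (f1 j p) * h1 (Some i) p)"
  define d' where "d' = (\<lambda>i j p. of_real t * psiv \<epsilon> (a + 1) (t - 1) (f p) * f1 j p * cnj (f1 (Some i) p) * h p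
      + psiv \<epsilon> a t (f p) * cnj (f1 (Some i) p) * h1 j p)"
  define e where "e = (\<lambda>i j p. (psivv \<epsilon> a t (f p) * cnj (f1 j p) * cnj (f1 (Some i) p) + psiv \<epsilon> a t (f p) * cnj (f2 i j p)) * h p)"
  have Wa: "wirtinger (psi_da \<epsilon> a t f f1 h h1 (Some i)) (c i) (d i)" for i
    using wirtinger_add[OF wirtinger_mult[OF wirtinger_mult[OF Ww f(2)[of i]] h(1)] wirtinger_mult[OF W0 h(2)[of i]]]
    unfolding psi_da_def[abs_def] c_def d_def by simp
  have Wb: "wirtinger (psi_db \<epsilon> a t f f1 h (Some i)) (d' i) (e i)" for i
    using wirtinger_mult[OF wirtinger_mult[OF Wv wirtinger_cnj[OF f(2)[of i]]] h(1)]
    unfolding psi_db_def[abs_def] d'_def e_def by simp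
  have tame_all: "tame (\<lambda>p. psi \<epsilon> a t (f p) * h p)" "tame (psi_da \<epsilon> a t f f1 h h1 j)" "tame (psi_db \<epsilon> a t f f1 h j)"
    "tame (c i j)" "tame (d i j)" "tame (d' i j)" "tame (e i j)" for i j
    unfolding psi_da_def[abs_def] psi_db_def[abs_def] c_def d_def d'_def e_def
    by (intro tame_add tame_mult tame_cnj tame_const tp tf th)+
  have mixed: "d i (Some i) = d' i (Some i)" for i
    unfolding d_def d'_def by (simp add: mult_ac)
  have euler: "(\<Sum>j\<in>UNIV. of_int (wt j) * (p $ j * psi_da \<epsilon> a t f f1 h h1 j p - cnj (p $ j) * psi_db \<epsilon> a t f f1 h j p))
     = of_int (mh - int a * mf) * (psi \<epsilon> a t (f p) * h p)" for p
  proof -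
    have "(\<Sum>j\<in>UNIV. of_int (wt j) * (p $ j * psi_da \<epsilon> a t f f1 h h1 j p - cnj (p $ j) * psi_db \<epsilon> a t f f1 h j p))
      = psiw \<epsilon> a t (f p) * h p * (\<Sum>j\<in>UNIV. of_int (wt j) * p $ j * f1 j p)
        + psi \<epsilon> a t (f p) * (\<Sum>j\<in>UNIV. of_int (wt j) * p $ j * h1 j p)
        - psiv \<epsilon> a t (f p) * h p * cnj (\<Sum>j\<in>UNIV. of_int (wt j) * p $ j * f1 j p)"
      unfolding psi_da_def psi_db_def
      by (simp add: sum_distrib_left sum.distrib sum_subtractf algebra_simps)
    also have "\<dots> = of_int mf * (f p * psiw \<epsilon> a t (f p) - cnj (f p) * psiv \<epsilon> a t (f p)) * h p + of_int mh * psi \<epsilon> a t (f p) * h p"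
      unfolding ef eh by (simp add: algebra_simps)
    also have "\<dots> = of_int (mh - int a * mf) * (psi \<epsilon> a t (f p) * h p)"
      unfolding psi_euler[OF \<epsilon>] by (simp add: algebra_simps)
    finally show ?thesis .
  qed
  have *: "2 * psi_db \<epsilon> a t f f1 h None p + (\<Sum>i\<in>UNIV. e i (Some i) p)
     = 2 * ((psiv \<epsilon> a t (f p) * cnj (A p) + psivv \<epsilon> a t (f p) * cnj (B p)) * h p)" for p
  proof -
    have "(\<Sum>i\<in>UNIV. e i (Some i) p) = (psivv \<epsilon> a t (f p) * cnj (\<Sum>i\<in>UNIV. (f1 (Some i) p)\<^sup>2)
        + psiv \<epsilon> a t (f p) * cnj (\<Sum>i\<in>UNIV. f2 i (Some i) p)) * h p"
      unfolding e_def by (simp add: sum.distrib sum_distrib_left sum_distrib_right algebra_simps power2_eq_square)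
    then show ?thesis unfolding A_def B_def psi_db_def by (simp add: algebra_simps)
  qed
  show ?thesis
    using flow_identity[OF u wirtinger_psi[OF \<epsilon> f(1) h(1)] tame_all(1-3) Wa tame_all(4,5) Wb tame_all(6,7) mixed euler, of \<omega>]
    unfolding r_def r'_def * by simp
qed

section \<open>Comparison of complex Gaussian moments\<close>

text \<open>The Hermitian form with coefficients $\Phi_{w\bar w}, \Phi_{w\bar w\bar w}, \Phi_{ww\bar w},
  \Phi_{ww\bar w\bar w}$ for $\Phi = (|w|^2+\varepsilon)^q$. This is where $q \ge 1$, i.e. $p \ge 2$, enters.\<close>

lemma psi_form_nonneg:
  fixes A B w :: complex
  assumes \<epsilon>: "\<epsilon> > 0" and q: "q \<ge> 1"
  shows "Re (of_real q * ((psiv \<epsilon> 1 (q - 1) w * cnj A + psivv \<epsilon> 1 (q - 1) w * cnj B) * A)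
    + of_real (q * (q - 1)) * ((psiv \<epsilon> 2 (q - 2) w * cnj A + psivv \<epsilon> 2 (q - 2) w * cnj B) * B)) \<ge> 0"
proof -
  define s where "s = (cmod w)\<^sup>2"
  define R where "R = s + \<epsilon>"
  define K where "K = R powr (q - 4)"
  have s: "s \<ge> 0" unfolding s_def by simp
  have R: "R > 0" using s \<epsilon> unfolding R_def by simp
  have K: "K > 0" unfolding K_def using R by simp
  have P: "R powr (q - 1) = K * R ^ 3" "R powr (q - 2) = K * R\<^sup>2" "R powr (q - 3) = K * R"
    unfolding K_def using powr_add[of R "q - 4" 3] powr_add[of R "q - 4" 2] powr_add[of R "q - 4" 1] R by simp_all
  have ww: "w * cnj w = of_real s" "cnj w * w = of_real s"
    unfolding s_def using complex_norm_square[of w] by (simp_all add: mult.commute)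
  define \<alpha> where "\<alpha> = R\<^sup>2 * (R + (q - 1) * s)"
  define \<beta> where "\<beta> = R * (2 * R + (q - 2) * s)"
  define \<gamma> where "\<gamma> = 2 * R\<^sup>2 + 4 * (q - 2) * s * R + (q - 2) * (q - 3) * s\<^sup>2"
  have psi: "psi \<epsilon> a t w = cnj w ^ a * of_real (R powr t)" for a t
    unfolding psi_def R_def s_def ..
  have 11: "psiv \<epsilon> 1 (q - 1) w = of_real (K * \<alpha>)"
  proof -
    have "psiv \<epsilon> 1 (q - 1) w = of_real (R powr (q - 1)) + of_real (q - 1) * (w * cnj w) * of_real (R powr (q - 2))"
      unfolding psiv_def psi by simp
    also have "\<dots> = of_real (K * \<alpha>)"
      unfolding ww P \<alpha>_def of_real_mult[symmetric] of_real_add[symmetric] of_real_eq_iff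
      by (simp add: algebra_simps power2_eq_square power3_eq_cube)
    finally show ?thesis .
  qed
  have 12: "psivv \<epsilon> 1 (q - 1) w = of_real (K * (q - 1) * \<beta>) * w"
  proof -
    have "psivv \<epsilon> 1 (q - 1) w = (of_real (2 * (q - 1) * R powr (q - 2)) + of_real ((q - 1) * (q - 2)) * (w * cnj w) * of_real (R powr (q - 3))) * w"
      unfolding psivv_def psiv_def psi by (simp add: algebra_simps)
    also have "\<dots> = of_real (K * (q - 1) * \<beta>) * w"
      unfolding ww P \<beta>_def of_real_mult[symmetric] of_real_add[symmetric]
      by (simp only: algebra_simps power2_eq_square)
    finally show ?thesis .
  qed
  have 21: "psiv \<epsilon> 2 (q - 2) w = of_real (K * \<beta>) * cnj w"
  proof -
    have "psiv \<epsilon> 2 (q - 2) w = (of_real (2 * R powr (q - 2)) + of_real (q - 2) * (w * cnj w) * of_real (R powr (q - 3))) * cnj w"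
      unfolding psiv_def psi by (simp add: algebra_simps power2_eq_square)
    also have "\<dots> = of_real (K * \<beta>) * cnj w"
      unfolding ww P \<beta>_def of_real_mult[symmetric] of_real_add[symmetric]
      by (simp only: algebra_simps power2_eq_square)
    finally show ?thesis .
  qed
  have 22: "psivv \<epsilon> 2 (q - 2) w = of_real (K * \<gamma>)"
  proof -
    have "psivv \<epsilon> 2 (q - 2) w = of_real (2 * R powr (q - 2)) + of_real (4 * (q - 2)) * (w * cnj w) * of_real (R powr (q - 3))
       + of_real ((q - 2) * (q - 3)) * (w * cnj w)\<^sup>2 * of_real (R powr (q - 4))"
      unfolding psivv_def psiv_def psi by (simp add: algebra_simps power2_eq_square)
    also have "\<dots> = of_real (K * \<gamma>)"
      unfolding ww P \<gamma>_def of_real_mult[symmetric] of_real_add[symmetric] of_real_power[symmetric] of_real_eq_iff K_def[symmetric]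
      by (simp add: algebra_simps power2_eq_square)
    finally show ?thesis .
  qed
  let ?X = "Re (A * w * cnj B)"
  have expand: "of_real q * ((of_real (K * \<alpha>) * cnj A + of_real (K * (q - 1) * \<beta>) * w * cnj B) * A)
     + of_real (q * (q - 1)) * ((of_real (K * \<beta>) * cnj w * cnj A + of_real (K * \<gamma>) * cnj B) * B)
     = of_real (q * K * \<alpha>) * (A * cnj A) + of_real (q * K * (q - 1) * \<beta>) * (A * w * cnj B + cnj (A * w * cnj B))
      + of_real (q * (q - 1) * K * \<gamma>) * (B * cnj B)"
    by (simp add: algebra_simps)
  have eq: "Re (of_real q * ((psiv \<epsilon> 1 (q - 1) w * cnj A + psivv \<epsilon> 1 (q - 1) w * cnj B) * A)
    + of_real (q * (q - 1)) * ((psiv \<epsilon> 2 (q - 2) w * cnj A + psivv \<epsilon> 2 (q - 2) w * cnj B) * B))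
    = q * K * (\<alpha> * (cmod A)\<^sup>2 + 2 * ((q - 1) * \<beta>) * ?X + (q - 1) * \<gamma> * (cmod B)\<^sup>2)"
    unfolding 11 12 21 22 expand complex_norm_square[symmetric] complex_add_cnj
    by (simp add: algebra_simps)
  have \<alpha>: "\<alpha> > 0" unfolding \<alpha>_def using R q s by (simp add: add_pos_nonneg)
  have \<beta>: "\<beta> \<ge> 0"
  proof -
    have "2 * R + (q - 2) * s = q * s + 2 * \<epsilon>" unfolding R_def by (simp add: algebra_simps)
    then show ?thesis unfolding \<beta>_def using R q s \<epsilon> by simp
  qed
  have det: "\<alpha> * ((q - 1) * \<gamma>) - ((q - 1) * \<beta>)\<^sup>2 * s \<ge> 0"
  proof -
    have "\<alpha> * ((q - 1) * \<gamma>) - ((q - 1) * \<beta>)\<^sup>2 * s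
      = (q - 1) * R\<^sup>2 * (R - s) * (2 * R\<^sup>2 + 2 * (q - 2) * R * s + (q - 1) * (q - 2) * s\<^sup>2)"
      unfolding \<alpha>_def \<beta>_def \<gamma>_def by (simp add: algebra_simps power2_eq_square)
    also have "2 * R\<^sup>2 + 2 * (q - 2) * R * s + (q - 1) * (q - 2) * s\<^sup>2 = q * (q - 1) * s\<^sup>2 + 2 * q * s * \<epsilon> + 2 * \<epsilon>\<^sup>2"
      unfolding R_def by (simp add: algebra_simps power2_eq_square)
    finally show ?thesis using q s \<epsilon> R by (simp add: R_def)
  qed
  let ?x = "cmod A" and ?y = "cmod B" and ?m = "cmod w" and ?b = "(q - 1) * \<beta>" and ?c = "(q - 1) * \<gamma>"
  have "\<bar>?X\<bar> \<le> ?x * ?m * ?y" using abs_Re_le_cmod[of "A * w * cnj B"] by (simp add: norm_mult)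
  then have X: "?X \<ge> - (?x * ?m * ?y)" by linarith
  have "\<alpha> * (\<alpha> * ?x\<^sup>2 - 2 * ?b * (?x * ?m * ?y) + ?c * ?y\<^sup>2) = (\<alpha> * ?x - ?b * ?m * ?y)\<^sup>2 + (\<alpha> * ?c - ?b\<^sup>2 * s) * ?y\<^sup>2"
    unfolding s_def by (simp add: algebra_simps power2_eq_square)
  also have "\<dots> \<ge> 0" using det by (intro add_nonneg_nonneg mult_nonneg_nonneg) auto
  finally have "\<alpha> * ?x\<^sup>2 - 2 * ?b * (?x * ?m * ?y) + ?c * ?y\<^sup>2 \<ge> 0"
    using \<alpha> by (simp add: zero_le_mult_iff)
  moreover have "2 * ?b * ?X \<ge> 2 * ?b * (- (?x * ?m * ?y))"
    using X \<beta> q by (intro mult_left_mono) auto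
  ultimately have "\<alpha> * ?x\<^sup>2 + 2 * ?b * ?X + ?c * ?y\<^sup>2 \<ge> 0" by linarith
  then show ?thesis unfolding eq using K q by simp
qed

text \<open>For $G = (|f|^2+\varepsilon)^q$ and $Q = DG$ the identity gives $(EG)' = 2 r'\,\mathrm{Re}\,E Q$ and
  $(r\,E Q)' = 2 r r' E \bar D D G$. Since $\bar D D G \ge 0$, $r' \le 0$ and $r = 0$ at $\omega = \pi/4$,
  first $r\,\mathrm{Re}\,E Q \ge 0$ and then $(EG)' \le 0$.\<close>

lemma smoothed_moment_mono:
  fixes f :: "complex ^ 'd::finite option \<Rightarrow> complex"
  assumes f: "wpoly w f" and u0: "u > 0" and \<epsilon>: "\<epsilon> > 0" and q: "q \<ge> 1" and \<omega>0: "0 \<le> \<omega>0" "\<omega>0 < pi / 4"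
  shows "(\<integral>z. ((cmod (f (zpt u \<omega>0 z)))\<^sup>2 + \<epsilon>) powr q \<partial>gaussian) \<le> (\<integral>z. ((cmod (f (zpt u 0 z)))\<^sup>2 + \<epsilon>) powr q \<partial>gaussian)"
proof -
  have u: "u \<ge> 0" using u0 by simp
  obtain f1 where f1: "holo f f1" "\<And>j. wpoly (w - wt j) (f1 j)" "\<And>p. (\<Sum>j\<in>UNIV. of_int (wt j) * p $ j * f1 j p) = of_int w * f p"
    using wpoly_derivative[OF f] by blast
  have "\<forall>i. \<exists>f2. holo (f1 (Some i)) f2 \<and> (\<forall>j. wpoly (w - 1 - wt j) (f2 j))"
    using wpoly_derivative[OF f1(2)] by (metis wt.simps(2))
  then obtain f2 where f2: "\<And>i. holo (f1 (Some i)) (f2 i)" "\<And>i j. wpoly (w - 1 - wt j) (f2 i j)" by metis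
  define A where "A = (\<lambda>p. f1 None p + (\<Sum>i\<in>UNIV. f2 i (Some i) p) / 2)"
  define B where "B = (\<lambda>p. (\<Sum>i\<in>UNIV. (f1 (Some i) p)\<^sup>2) / 2)"
  have A: "wpoly (w - 2) A"
  proof -
    have "wpoly (w - 2) (\<lambda>p. f1 None p + (1 / 2) * (\<Sum>i\<in>UNIV. f2 i (Some i) p))"
      using f1(2)[of None] f2(2)[of "Some _"] by (intro wpoly_add wpoly_cmult wpoly_sum) simp_all
    then show ?thesis unfolding A_def by simp
  qed
  have B: "wpoly (2 * w - 2) B"
  proof -
    have "wpoly ((w - 1) + (w - 1)) (\<lambda>p. f1 (Some i) p * f1 (Some i) p)" for i
      using f1(2)[of "Some i"] by (intro wpoly_mult) simp_all
    then have "wpoly (2 * w - 2) (\<lambda>p. (1 / 2) * (\<Sum>i\<in>UNIV. f1 (Some i) p * f1 (Some i) p))"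
      by (intro wpoly_cmult wpoly_sum) (simp add: algebra_simps)
    then show ?thesis unfolding B_def by (simp add: power2_eq_square)
  qed
  have ex: "\<exists>h1 h2. holo h h1 \<and> (\<forall>i. holo (h1 (Some i)) (h2 i)) \<and> (\<forall>j. tame (h1 j)) \<and> (\<forall>i j. tame (h2 i j))
      \<and> (\<forall>p. (\<Sum>j\<in>UNIV. of_int (wt j) * p $ j * h1 j p) = of_int k * h p)" if hk: "wpoly k h" for k and h :: "complex ^ 'd option \<Rightarrow> complex"
  proof -
    obtain h1 where h1: "holo h h1" "\<And>j. wpoly (k - wt j) (h1 j)" "\<And>p. (\<Sum>j\<in>UNIV. of_int (wt j) * p $ j * h1 j p) = of_int k * h p"
      using wpoly_derivative[OF hk] by blast
    have "\<forall>i. \<exists>h2. holo (h1 (Some i)) h2 \<and> (\<forall>j. tame (h2 j))"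
      using wpoly_derivative[OF h1(2)] wpoly_tame by blast
    then obtain h2 where "\<And>i. holo (h1 (Some i)) (h2 i)" "\<And>i j. tame (h2 i j)" by metis
    then show ?thesis using h1 wpoly_tame by blast
  qed
  obtain A1 A2 where A12: "holo A A1" "\<And>i. holo (A1 (Some i)) (A2 i)" "\<And>j. tame (A1 j)" "\<And>i j. tame (A2 i j)"
      "\<And>p. (\<Sum>j\<in>UNIV. of_int (wt j) * p $ j * A1 j p) = of_int (w - 2) * A p" using ex[OF A] by blast
  obtain B1 B2 where B12: "holo B B1" "\<And>i. holo (B1 (Some i)) (B2 i)" "\<And>j. tame (B1 j)" "\<And>i j. tame (B2 i j)"
      "\<And>p. (\<Sum>j\<in>UNIV. of_int (wt j) * p $ j * B1 j p) = of_int (2 * w - 2) * B p" using ex[OF B] by blast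
  have tf: "tame f" "\<And>j. tame (f1 j)" "\<And>i j. tame (f2 i j)" "tame A" "tame B"
    using f f1(2) f2(2) A B wpoly_tame by blast+
  note tpsi = tame_compose[OF tame_psi[OF \<epsilon>] tf(1)] tame_compose[OF tame_psiw[OF \<epsilon>] tf(1)]
    tame_compose[OF tame_psiv[OF \<epsilon>] tf(1)] tame_compose[OF tame_psivv[OF \<epsilon>] tf(1)]
  note fid = flow_identity_psi[OF u \<epsilon> f1(1) f2(1) _ _ tf(1-3) _ _ _ f1(3)]
  have Ap: "f1 None p + (\<Sum>i\<in>UNIV. f2 i (Some i) p) / 2 = A p" "(\<Sum>i\<in>UNIV. (f1 (Some i) p)\<^sup>2) / 2 = B p" for p
    unfolding A_def B_def by simp_all
  let ?Z = "\<lambda>\<omega>. zpt u \<omega> :: (real ^ 'd) \<times> (real ^ 'd) \<Rightarrow> _"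
  have tZ: "tame (?Z \<omega>)" for \<omega> by (rule tame_slice[OF tame_zpt])
  have intZ: "integrable gaussian (\<lambda>z. g (?Z \<omega> z))" if "tame g" for g :: "complex ^ 'd option \<Rightarrow> complex" and \<omega>
    by (intro integrable_tame tame_compose[OF that tZ])
  define r where "r = (\<lambda>\<omega>. u * cos (2 * \<omega>))"
  define r' where "r' = (\<lambda>\<omega>. - 2 * u * sin (2 * \<omega>))"
  define Q where "Q = (\<lambda>p. of_real q * (psi \<epsilon> 1 (q - 1) (f p) * A p) + of_real (q * (q - 1)) * (psi \<epsilon> 2 (q - 2) (f p) * B p))"
  have tQ: "tame Q" unfolding Q_def by (intro tame_add tame_mult tame_const tpsi tf)
  define FA where "FA = flow_derivative u (psi_da \<epsilon> 1 (q - 1) f f1 A A1) (psi_db \<epsilon> 1 (q - 1) f f1 A)"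
  define FB where "FB = flow_derivative u (psi_da \<epsilon> 2 (q - 2) f f1 B B1) (psi_db \<epsilon> 2 (q - 2) f f1 B)"
  define FG where "FG = flow_derivative u (psi_da \<epsilon> 0 q f f1 (\<lambda>_. 1) (\<lambda>_ _. 0)) (psi_db \<epsilon> 0 q f f1 (\<lambda>_. 1))"
  have tFA: "tame (\<lambda>z. FA (fst z) (snd z))" and tFB: "tame (\<lambda>z. FB (fst z) (snd z))" and tFG: "tame (\<lambda>z. FG (fst z) (snd z))"
    unfolding FA_def FB_def FG_def psi_da_def[abs_def] psi_db_def[abs_def]
    by (intro tame_flow_derivative tame_add tame_mult tame_cnj tame_const tpsi tf A12 B12)+
  have intF: "integrable gaussian (FA \<omega>)" "integrable gaussian (FB \<omega>)" "integrable gaussian (FG \<omega>)" for \<omega>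
    by (intro integrable_tame tame_slice[OF tFA] tame_slice[OF tFB] tame_slice[OF tFG])+
  define DQ where "DQ = (\<lambda>p. of_real q * ((psiv \<epsilon> 1 (q - 1) (f p) * cnj (A p) + psivv \<epsilon> 1 (q - 1) (f p) * cnj (B p)) * A p)
    + of_real (q * (q - 1)) * ((psiv \<epsilon> 2 (q - 2) (f p) * cnj (A p) + psivv \<epsilon> 2 (q - 2) (f p) * cnj (B p)) * B p))"
  have idA: "2 * of_real (r \<omega>) * (\<integral>z. FA \<omega> z \<partial>gaussian) = - 2 * of_real (r' \<omega>) * (\<integral>z. psi \<epsilon> 1 (q - 1) (f (?Z \<omega> z)) * A (?Z \<omega> z) \<partial>gaussian)
    + 4 * of_real (r \<omega>) * of_real (r' \<omega>) * (\<integral>z. (psiv \<epsilon> 1 (q - 1) (f (?Z \<omega> z)) * cnj (A (?Z \<omega> z)) + psivv \<epsilon> 1 (q - 1) (f (?Z \<omega> z)) * cnj (B (?Z \<omega> z))) * A (?Z \<omega> z) \<partial>gaussian)" for \<omega>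
    using fid[OF A12(1,2) tf(4) A12(3,4,5), of \<omega> 1 "q - 1"] unfolding FA_def r_def r'_def Ap by simp
  have idB: "2 * of_real (r \<omega>) * (\<integral>z. FB \<omega> z \<partial>gaussian) = - 2 * of_real (r' \<omega>) * (\<integral>z. psi \<epsilon> 2 (q - 2) (f (?Z \<omega> z)) * B (?Z \<omega> z) \<partial>gaussian)
    + 4 * of_real (r \<omega>) * of_real (r' \<omega>) * (\<integral>z. (psiv \<epsilon> 2 (q - 2) (f (?Z \<omega> z)) * cnj (A (?Z \<omega> z)) + psivv \<epsilon> 2 (q - 2) (f (?Z \<omega> z)) * cnj (B (?Z \<omega> z))) * B (?Z \<omega> z) \<partial>gaussian)" for \<omega>
    using fid[OF B12(1,2) tf(5) B12(3,4,5), of \<omega> 2 "q - 2"] unfolding FB_def r_def r'_def Ap by simp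
  have idQ: "of_real (r' \<omega>) * (\<integral>z. Q (?Z \<omega> z) \<partial>gaussian) + of_real (r \<omega>) * (\<integral>z. of_real q * FA \<omega> z + of_real (q * (q - 1)) * FB \<omega> z \<partial>gaussian)
     = of_real (2 * r \<omega> * r' \<omega>) * (\<integral>z. DQ (?Z \<omega> z) \<partial>gaussian)" for \<omega>
  proof -
    have t1: "tame (\<lambda>p. psi \<epsilon> 1 (q - 1) (f p) * A p)" "tame (\<lambda>p. psi \<epsilon> 2 (q - 2) (f p) * B p)"
      "tame (\<lambda>p. (psiv \<epsilon> 1 (q - 1) (f p) * cnj (A p) + psivv \<epsilon> 1 (q - 1) (f p) * cnj (B p)) * A p)"
      "tame (\<lambda>p. (psiv \<epsilon> 2 (q - 2) (f p) * cnj (A p) + psivv \<epsilon> 2 (q - 2) (f p) * cnj (B p)) * B p)"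
      by (intro tame_add tame_mult tame_cnj tame_const tpsi tf)+
    note i1 = intZ[OF t1(1)] intZ[OF t1(2)] intZ[OF t1(3)] intZ[OF t1(4)]
    have lin: "(\<integral>z. c * g z + d * h z \<partial>gaussian) = c * (\<integral>z. g z \<partial>gaussian) + d * (\<integral>z. h z \<partial>gaussian)"
      if "integrable gaussian g" "integrable gaussian h" for c d and g h :: "(real ^ 'd) \<times> (real ^ 'd) \<Rightarrow> complex"
      using that by simp
    have e1: "(\<integral>z. Q (?Z \<omega> z) \<partial>gaussian) = of_real q * (\<integral>z. psi \<epsilon> 1 (q - 1) (f (?Z \<omega> z)) * A (?Z \<omega> z) \<partial>gaussian)
        + of_real (q * (q - 1)) * (\<integral>z. psi \<epsilon> 2 (q - 2) (f (?Z \<omega> z)) * B (?Z \<omega> z) \<partial>gaussian)"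
      unfolding Q_def by (rule lin[OF i1(1,2)])
    have e2: "(\<integral>z. DQ (?Z \<omega> z) \<partial>gaussian) = of_real q * (\<integral>z. (psiv \<epsilon> 1 (q - 1) (f (?Z \<omega> z)) * cnj (A (?Z \<omega> z)) + psivv \<epsilon> 1 (q - 1) (f (?Z \<omega> z)) * cnj (B (?Z \<omega> z))) * A (?Z \<omega> z) \<partial>gaussian)
      + of_real (q * (q - 1)) * (\<integral>z. (psiv \<epsilon> 2 (q - 2) (f (?Z \<omega> z)) * cnj (A (?Z \<omega> z)) + psivv \<epsilon> 2 (q - 2) (f (?Z \<omega> z)) * cnj (B (?Z \<omega> z))) * B (?Z \<omega> z) \<partial>gaussian)"
      unfolding DQ_def by (rule lin[OF i1(3,4)])
    have "2 * (of_real (r' \<omega>) * (\<integral>z. Q (?Z \<omega> z) \<partial>gaussian) + of_real (r \<omega>) * (\<integral>z. of_real q * FA \<omega> z + of_real (q * (q - 1)) * FB \<omega> z \<partial>gaussian))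
      = 2 * of_real (r' \<omega>) * (\<integral>z. Q (?Z \<omega> z) \<partial>gaussian) + of_real q * (2 * of_real (r \<omega>) * (\<integral>z. FA \<omega> z \<partial>gaussian))
        + of_real (q * (q - 1)) * (2 * of_real (r \<omega>) * (\<integral>z. FB \<omega> z \<partial>gaussian))"
      unfolding lin[OF intF(1,2)] by (simp add: algebra_simps)
    also have "\<dots> = 2 * (of_real (2 * r \<omega> * r' \<omega>) * (\<integral>z. DQ (?Z \<omega> z) \<partial>gaussian))"
      unfolding idA idB e1 e2 by (simp add: algebra_simps)
    finally show ?thesis by (rule mult_left_cancel[THEN iffD1, rotated]) simp
  qed
  have idG: "of_real (r \<omega>) * (\<integral>z. FG \<omega> z \<partial>gaussian) = of_real (2 * r \<omega> * r' \<omega>) * cnj (\<integral>z. Q (?Z \<omega> z) \<partial>gaussian)" for \<omega>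
  proof -
    have "(psiv \<epsilon> 0 q (f p) * cnj (A p) + psivv \<epsilon> 0 q (f p) * cnj (B p)) * 1 = cnj (Q p)" for p
      unfolding Q_def psiv_def psivv_def psi_def by (simp add: power2_eq_square algebra_simps)
    then have "2 * (of_real (r \<omega>) * (\<integral>z. FG \<omega> z \<partial>gaussian)) = 4 * of_real (r \<omega>) * of_real (r' \<omega>) * (\<integral>z. cnj (Q (?Z \<omega> z)) \<partial>gaussian)"
      using fid[where h = "\<lambda>_. 1" and ?h1.0 = "\<lambda>_ _. 0" and ?h2.0 = "\<lambda>_ _ _. 0" and mh = 0 and \<omega> = \<omega> and a = 0 and t = q,
        OF wirtinger_const wirtinger_const tame_const tame_const tame_const]
      unfolding FG_def r_def r'_def Ap by simp
    then show ?thesis by simp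
  qed
  have rr: "r \<omega> \<ge> 0" "r' \<omega> \<le> 0" if "0 \<le> \<omega>" "\<omega> \<le> pi / 4" for \<omega>
    unfolding r_def r'_def using that u by (auto intro!: mult_nonneg_nonneg cos_ge_zero sin_ge_zero)
  have DQ: "Re (\<integral>z. DQ (?Z \<omega> z) \<partial>gaussian) \<ge> 0" for \<omega>
  proof -
    have "tame DQ" unfolding DQ_def by (intro tame_add tame_mult tame_cnj tame_const tpsi tf)
    then have "Re (\<integral>z. DQ (?Z \<omega> z) \<partial>gaussian) = (\<integral>z. Re (DQ (?Z \<omega> z)) \<partial>gaussian)"
      using intZ by simp
    also have "\<dots> \<ge> 0"
      unfolding DQ_def by (intro Bochner_Integration.integral_nonneg psi_form_nonneg \<epsilon> q)
    finally show ?thesis .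
  qed
  have Q: "r \<omega> * Re (\<integral>z. Q (?Z \<omega> z) \<partial>gaussian) \<ge> 0" if \<omega>: "0 \<le> \<omega>" "\<omega> \<le> pi / 4" for \<omega>
  proof -
    let ?\<phi> = "\<lambda>t z. r t * Re (Q (?Z t z))"
    let ?\<phi>' = "\<lambda>t z. r' t * Re (Q (?Z t z)) + r t * Re (of_real q * FA t z + of_real (q * (q - 1)) * FB t z)"
    have tr: "tame r" "tame r'" unfolding r_def r'_def by (intro tame_mult tame_const tame_cos tame_sin tame_id)+
    have "(\<integral>z. ?\<phi> (pi / 4) z \<partial>gaussian) \<le> (\<integral>z. ?\<phi> \<omega> z \<partial>gaussian)"
    proof (rule gaussian_parameter_antimono[where \<phi>' = ?\<phi>', OF \<omega>(2)])
      show "tame (\<lambda>z. ?\<phi>' (fst z) (snd z))"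
        by (intro tame_add tame_mult tame_const tame_Re tame_compose[OF tr(1)] tame_compose[OF tr(2)] tame_compose[OF tQ tame_zpt] tFA tFB tame_fst tame_id)
      show "tame (?\<phi> t)" for t
        by (intro tame_mult tame_const tame_Re tame_compose[OF tQ tZ])
      fix z :: "(real ^ 'd) \<times> (real ^ 'd)" and t
      have "((\<lambda>t. Q (?Z t z)) has_vector_derivative (of_real q * FA t z + of_real (q * (q - 1)) * FB t z)) (at t)"
        unfolding Q_def FA_def FB_def
        by (intro has_vector_derivative_add has_vector_derivative_mult_right flow_has_derivative[OF wirtinger_psi[OF \<epsilon> f1(1) A12(1)]] flow_has_derivative[OF wirtinger_psi[OF \<epsilon> f1(1) B12(1)]])
      then have "((\<lambda>t. Re (Q (?Z t z))) has_real_derivative Re (of_real q * FA t z + of_real (q * (q - 1)) * FB t z)) (at t)"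
        unfolding has_vector_derivative_complex_iff by simp
      moreover have "(r has_real_derivative r' t) (at t)"
        unfolding r_def r'_def by (auto intro!: derivative_eq_intros)
      ultimately have "((\<lambda>t. ?\<phi> t z) has_real_derivative r' t * Re (Q (?Z t z)) + Re (of_real q * FA t z + of_real (q * (q - 1)) * FB t z) * r t) (at t)"
        by (intro DERIV_mult)
      then show "((\<lambda>t. ?\<phi> t z) has_vector_derivative ?\<phi>' t z) (at t)"
        unfolding has_real_derivative_iff_has_vector_derivative by (simp only: mult.commute[of "r t"])
    next
      fix t assume t: "\<omega> \<le> t" "t \<le> pi / 4"
      have i: "integrable gaussian (\<lambda>z. Q (?Z t z))" by (rule intZ[OF tQ])
      have "(\<integral>z. ?\<phi>' t z \<partial>gaussian) = Re (of_real (r' t) * (\<integral>z. Q (?Z t z) \<partial>gaussian) + of_real (r t) * (\<integral>z. of_real q * FA t z + of_real (q * (q - 1)) * FB t z \<partial>gaussian))"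
      proof -
        have "(\<integral>z. ?\<phi>' t z \<partial>gaussian) = (\<integral>z. Re (of_real (r' t) * Q (?Z t z) + of_real (r t) * (of_real q * FA t z + of_real (q * (q - 1)) * FB t z)) \<partial>gaussian)"
          by simp
        also have "\<dots> = Re (\<integral>z. of_real (r' t) * Q (?Z t z) + of_real (r t) * (of_real q * FA t z + of_real (q * (q - 1)) * FB t z) \<partial>gaussian)"
          using i intF by (intro integral_Re) auto
        also have "(\<integral>z. of_real (r' t) * Q (?Z t z) + of_real (r t) * (of_real q * FA t z + of_real (q * (q - 1)) * FB t z) \<partial>gaussian)
           = of_real (r' t) * (\<integral>z. Q (?Z t z) \<partial>gaussian) + of_real (r t) * (\<integral>z. of_real q * FA t z + of_real (q * (q - 1)) * FB t z \<partial>gaussian)"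
          using i intF by (subst Bochner_Integration.integral_add) auto
        finally show ?thesis .
      qed
      also have "\<dots> = 2 * (r t * r' t) * Re (\<integral>z. DQ (?Z t z) \<partial>gaussian)" unfolding idQ by simp
      also have "\<dots> \<le> 0"
      proof -
        have "r t * r' t \<le> 0" using rr[of t] t \<omega> by (intro mult_nonneg_nonpos) auto
        then have "(r t * r' t) * Re (\<integral>z. DQ (?Z t z) \<partial>gaussian) \<le> 0" using DQ[of t] by (rule mult_nonpos_nonneg)
        then show ?thesis by linarith
      qed
      finally show "(\<integral>z. ?\<phi>' t z \<partial>gaussian) \<le> 0" .
    qed
    moreover have "r (pi / 4) = 0" unfolding r_def by simp
    ultimately show ?thesis using intZ[OF tQ] by simp
  qed
  have G: "psi \<epsilon> 0 q v * 1 = of_real (((cmod v)\<^sup>2 + \<epsilon>) powr q)" for v unfolding psi_def by simp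
  show ?thesis
  proof (rule gaussian_parameter_antimono[where \<phi>' = "\<lambda>t z. Re (FG t z)", OF \<omega>0(1)])
    show "tame (\<lambda>z. Re (FG (fst z) (snd z)))" by (intro tame_Re tFG)
    have "tame (\<lambda>z. Re (psi \<epsilon> 0 q (f (?Z t z)) * 1))" for t
      by (intro tame_Re tame_mult tame_const tame_compose[OF tpsi(1) tZ])
    then show "tame (\<lambda>z. ((cmod (f (?Z t z)))\<^sup>2 + \<epsilon>) powr q)" for t unfolding G by simp
    fix z :: "(real ^ 'd) \<times> (real ^ 'd)" and t
    have "((\<lambda>t. psi \<epsilon> 0 q (f (?Z t z)) * 1) has_vector_derivative FG t z) (at t)"
      unfolding FG_def by (rule flow_has_derivative[OF wirtinger_psi[OF \<epsilon> f1(1) wirtinger_const]])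
    then show "((\<lambda>t. ((cmod (f (?Z t z)))\<^sup>2 + \<epsilon>) powr q) has_vector_derivative Re (FG t z)) (at t)"
      unfolding G has_vector_derivative_complex_iff by (simp add: has_real_derivative_iff_has_vector_derivative)
  next
    fix t assume t: "0 \<le> t" "t \<le> \<omega>0"
    have r: "r t > 0"
      unfolding r_def using t \<omega>0(2) u0 by (auto intro!: mult_pos_pos cos_gt_zero_pi)
    have "r t * Re (\<integral>z. FG t z \<partial>gaussian) = Re (of_real (r t) * (\<integral>z. FG t z \<partial>gaussian))" by simp
    also have "\<dots> = 2 * r' t * (r t * Re (\<integral>z. Q (?Z t z) \<partial>gaussian))" unfolding idG by simp
    also have "\<dots> \<le> 0"
    proof (rule mult_nonpos_nonneg)
      show "2 * r' t \<le> 0" using rr(2)[of t] t \<omega>0 by simp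
      show "r t * Re (\<integral>z. Q (?Z t z) \<partial>gaussian) \<ge> 0" using t \<omega>0 by (intro Q) auto
    qed
    finally have "Re (\<integral>z. FG t z \<partial>gaussian) \<le> 0" using r by (simp add: mult_le_0_iff)
    moreover have "Re (\<integral>z. FG t z \<partial>gaussian) = (\<integral>z. Re (FG t z) \<partial>gaussian)" using intF by simp
    ultimately show "(\<integral>z. Re (FG t z) \<partial>gaussian) \<le> 0" by simp
  qed
qed


definition cpt :: "complex \<Rightarrow> complex \<Rightarrow> (real ^ 'd::finite) \<times> (real ^ 'd) \<Rightarrow> complex ^ 'd option" where
  "cpt a b z = (\<chi> j. case j of None \<Rightarrow> 1 | Some i \<Rightarrow> a * of_real (fst z $ i) + b * of_real (snd z $ i))"

lemma cpt_nth [simp]: "cpt a b z $ None = 1" "cpt a b z $ Some i = a * of_real (fst z $ i) + b * of_real (snd z $ i)"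
  unfolding cpt_def by simp_all

lemma tame_cpt [intro]: "tame (cpt a b)"
proof (rule tame_vec)
  fix j :: "'a option"
  show "tame (\<lambda>z. cpt a b z $ j)"
    by (cases j; simp only: cpt_nth) (intro tame_of_real tame_mult tame_const tame_add tame_nth tame_fst tame_snd tame_id)+
qed

lemma wpoly_conjugate:
  assumes "wpoly w f"
  shows "wpoly w (\<lambda>p. cnj (f (\<chi> j. cnj (p $ j))))"
  using assms
proof (induction rule: wpoly.induct)
  case (wpoly_var j)
  show ?case using wpoly.wpoly_var[of j] by simp
qed (auto intro: wpoly.intros)

lemma complex_moment_bound_nonneg:
  fixes f :: "complex ^ 'd::finite option \<Rightarrow> complex"
  assumes f: "wpoly w f" and wn: "w \<le> int n" and p: "p \<ge> 2" and \<eta>: "\<eta> \<ge> 0"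
  shows "(\<integral>z. cmod (f (cpt (of_real (cosh \<eta>)) (\<i> * of_real (sinh \<eta>)) z)) powr p \<partial>gaussian)
    \<le> cosh (2 * \<eta>) powr (real n * p / 2) * (\<integral>z. cmod (f (cpt 1 0 z)) powr p \<partial>gaussian)"
proof -
  define u where "u = cosh (2 * \<eta>)"
  define \<omega> where "\<omega> = arccos (1 / u) / 2"
  have u: "u \<ge> 1" unfolding u_def by (rule cosh_real_ge_1)
  have bnd: "- 1 < 1 / u" "0 < 1 / u" "1 / u \<le> 1" using u by (auto simp: field_simps)
  have \<omega>: "0 \<le> \<omega>" "\<omega> < pi / 4"
    unfolding \<omega>_def using bnd arccos_lbound[OF less_imp_le[OF bnd(1)] bnd(3)] arccos_less_arccos[of 0 "1 / u"] by (auto simp: arccos_0)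
  have cos2: "u * cos (2 * \<omega>) = 1" unfolding \<omega>_def using cos_arccos[OF less_imp_le[OF bnd(1)] bnd(3)] u by simp
  have c: "sqrt u * cos \<omega> = cosh \<eta>"
  proof -
    have "cos \<omega> \<ge> 0" using \<omega> by (intro cos_ge_zero) auto
    then have "sqrt u * cos \<omega> = sqrt (u * (cos \<omega>)\<^sup>2)" by (simp add: real_sqrt_mult)
    also have "u * (cos \<omega>)\<^sup>2 = (u + 1) / 2"
    proof -
      have "u * cos (2 * \<omega>) = 2 * (u * (cos \<omega>)\<^sup>2) - u" unfolding cos_double_cos by (simp add: algebra_simps)
      then show ?thesis using cos2 by simp
    qed
    also have "\<dots> = (cosh \<eta>)\<^sup>2" unfolding u_def cosh_double_cosh by simp
    finally show ?thesis by simp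
  qed
  have s: "sqrt u * sin \<omega> = sinh \<eta>"
  proof -
    have "sin \<omega> \<ge> 0" using \<omega> by (intro sin_ge_zero) auto
    then have "sqrt u * sin \<omega> = sqrt (u * (sin \<omega>)\<^sup>2)" by (simp add: real_sqrt_mult)
    also have "u * (sin \<omega>)\<^sup>2 = (u - 1) / 2"
    proof -
      have "u * cos (2 * \<omega>) = u - 2 * (u * (sin \<omega>)\<^sup>2)" unfolding cos_double_sin by (simp add: algebra_simps)
      then show ?thesis using cos2 by simp
    qed
    also have "\<dots> = (sinh \<eta>)\<^sup>2" unfolding u_def cosh_double by (simp add: cosh_square_eq)
    finally show ?thesis using \<eta> by simp
  qed
  have Z: "zpt u \<omega> z = cpt (of_real (cosh \<eta>)) (\<i> * of_real (sinh \<eta>)) z" for z :: "(real ^ 'd) \<times> (real ^ 'd)"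
    unfolding vec_eq_iff
  proof
    show "zpt u \<omega> z $ j = cpt (of_real (cosh \<eta>)) (\<i> * of_real (sinh \<eta>)) z $ j" for j
      by (cases j) (simp_all only: zpt_nth cpt_nth cos2 c s of_real_mult of_real_1 mult.assoc)
  qed
  have "complex_of_real (sqrt u) \<noteq> 0" using u by simp
  have "zpt u 0 z = (\<chi> j. complex_of_real (sqrt u) powi wt j * cpt 1 0 z $ j)" for z :: "(real ^ 'd) \<times> (real ^ 'd)"
    unfolding vec_eq_iff
  proof
    have su: "complex_of_real u = (complex_of_real (sqrt u))\<^sup>2"
      using u unfolding of_real_power[symmetric] by simp
    fix j
    have "zpt u 0 z $ j = complex_of_real (sqrt u) powi wt j * cpt 1 0 z $ j"
      by (cases j) (simp_all add: su power_int_def)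
    then show "zpt u 0 z $ j = (\<chi> j. complex_of_real (sqrt u) powi wt j * cpt 1 0 z $ j) $ j" by simp
  qed
  then have Z0: "f (zpt u 0 z) = complex_of_real (sqrt u) powi w * f (cpt 1 0 z)" for z
    using wpoly_scale[OF f \<open>complex_of_real (sqrt u) \<noteq> 0\<close>] by simp
  have pw: "(cmod (f (zpt u 0 z))) powr p \<le> u powr (real n * p / 2) * cmod (f (cpt 1 0 z)) powr p" for z
  proof -
    have "cmod (complex_of_real (sqrt u) powi w) = sqrt u powi w"
      using u by (simp add: norm_power_int)
    also have "\<dots> \<le> sqrt u powi int n" using u wn by (intro power_int_increasing) auto
    also have "\<dots> = u powr (real n / 2)"
      using u by (simp add: powr_half_sqrt[symmetric] powr_realpow[symmetric] powr_powr)
    finally have "cmod (f (zpt u 0 z)) \<le> u powr (real n / 2) * cmod (f (cpt 1 0 z))"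
      unfolding Z0 norm_mult by (rule mult_right_mono) simp
    then have "cmod (f (zpt u 0 z)) powr p \<le> (u powr (real n / 2) * cmod (f (cpt 1 0 z))) powr p"
      using p by (intro powr_mono2) auto
    then show ?thesis by (simp add: powr_mult powr_powr)
  qed
  have tf: "tame f" using f by (rule wpoly_tame)
  have tZ: "tame (\<lambda>z. f (zpt u \<theta> z))" for \<theta> by (rule tame_compose[OF tf tame_slice[OF tame_zpt]])
  have half: "(x\<^sup>2) powr (p / 2) = x powr p" if "x \<ge> 0" for x :: real
  proof (cases "x = 0")
    case False
    then have "x\<^sup>2 = x powr 2" using that by (simp add: powr_numeral)
    then show ?thesis by (simp add: powr_powr)
  qed simp
  define V where "V = (\<lambda>\<theta> \<epsilon> (z :: (real ^ 'd) \<times> (real ^ 'd)). ((cmod (f (zpt u \<theta> z)))\<^sup>2 + \<epsilon>) powr (p / 2))"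
  have tV: "tame (V \<theta> \<epsilon>)" if "\<epsilon> \<ge> 0" for \<theta> \<epsilon>
    unfolding V_def
  proof (rule tame_powr)
    show "tame (\<lambda>z. (cmod (f (zpt u \<theta> z)))\<^sup>2 + \<epsilon>)" by (intro tame_add tame_const tame_power tame_norm tZ)
  qed (use that p in auto)
  have V0: "V \<theta> 0 z = cmod (f (zpt u \<theta> z)) powr p" for \<theta> z unfolding V_def by (simp add: half)
  have le: "(\<integral>z. V \<omega> 0 z \<partial>gaussian) \<le> (\<integral>z. V 0 (1 / Suc k) z \<partial>gaussian)" for k
  proof -
    have "(\<integral>z. V \<omega> 0 z \<partial>gaussian) \<le> (\<integral>z. V \<omega> (1 / Suc k) z \<partial>gaussian)"
      using p by (intro integral_mono integrable_tame tV) (auto simp: V_def intro!: powr_mono2)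
    also have "\<dots> \<le> (\<integral>z. V 0 (1 / Suc k) z \<partial>gaussian)"
      unfolding V_def using u p \<omega> by (intro smoothed_moment_mono[OF f]) auto
    finally show ?thesis .
  qed
  have "(\<lambda>k. \<integral>z. V 0 (1 / Suc k) z \<partial>gaussian) \<longlonglongrightarrow> (\<integral>z. V 0 0 z \<partial>gaussian)"
  proof (rule integral_dominated_convergence[where w = "V 0 1"])
    show "integrable gaussian (V 0 1)" by (intro integrable_tame tV) simp
    show "V 0 0 \<in> borel_measurable gaussian" "V 0 (1 / Suc k) \<in> borel_measurable gaussian" for k
      using tame_measurable[OF tV[of 0]] tame_measurable[OF tV[of "1 / Suc k"]] by (simp_all cong: measurable_cong_sets)
    show "AE z in gaussian. (\<lambda>k. V 0 (1 / Suc k) z) \<longlonglongrightarrow> V 0 0 z"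
    proof (rule AE_I2)
      fix z :: "(real ^ 'd) \<times> (real ^ 'd)"
      have "(\<lambda>k. (cmod (f (zpt u 0 z)))\<^sup>2 + 1 / real (Suc k)) \<longlonglongrightarrow> (cmod (f (zpt u 0 z)))\<^sup>2 + 0"
        by (intro tendsto_add tendsto_const lim_1_over_n[THEN LIMSEQ_Suc])
      then show "(\<lambda>k. V 0 (1 / Suc k) z) \<longlonglongrightarrow> V 0 0 z"
        unfolding V_def using p by (intro tendsto_powr2 tendsto_const) auto
    qed
    show "AE z in gaussian. norm (V 0 (1 / Suc k) z) \<le> V 0 1 z" for k
      unfolding V_def using p by (intro AE_I2) (auto intro!: powr_mono2)
  qed
  then have "(\<integral>z. V \<omega> 0 z \<partial>gaussian) \<le> (\<integral>z. V 0 0 z \<partial>gaussian)"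
    using le by (intro LIMSEQ_le_const) auto
  also have "\<dots> \<le> (\<integral>z. u powr (real n * p / 2) * cmod (f (cpt 1 0 z)) powr p \<partial>gaussian)"
  proof (rule integral_mono)
    show "integrable gaussian (\<lambda>z. V 0 0 z)" by (intro integrable_tame tV) simp
    have "tame (\<lambda>z. cmod (f (cpt 1 0 z)) powr p)"
      using p by (intro tame_powr tame_norm tame_compose[OF tf tame_cpt]) auto
    then show "integrable gaussian (\<lambda>z. u powr (real n * p / 2) * cmod (f (cpt 1 0 z)) powr p)"
      by (intro integrable_tame tame_mult tame_const)
  qed (simp add: V0 pw)
  finally show ?thesis unfolding V0 Z by (simp add: u_def)
qed

lemma complex_moment_bound:
  fixes f :: "complex ^ 'd::finite option \<Rightarrow> complex"
  assumes f: "wpoly w f" and wn: "w \<le> int n" and p: "p \<ge> 2"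
  shows "(\<integral>z. cmod (f (cpt (of_real (cosh \<eta>)) (\<i> * of_real (sinh \<eta>)) z)) powr p \<partial>gaussian)
    \<le> cosh (2 * \<eta>) powr (real n * p / 2) * (\<integral>z. cmod (f (cpt 1 0 z)) powr p \<partial>gaussian)"
proof (cases "\<eta> \<ge> 0")
  case True
  then show ?thesis by (rule complex_moment_bound_nonneg[OF f wn p])
next
  case False
  let ?g = "\<lambda>p. cnj (f (\<chi> j. cnj (p $ j)))"
  have conj: "(\<chi> j. cnj (cpt (of_real a) (\<i> * of_real b) z $ j)) = cpt (of_real a) (\<i> * of_real (- b)) z" for a b and z :: "(real ^ 'd) \<times> (real ^ 'd)"
  proof -
    have "cnj (cpt (of_real a) (\<i> * of_real b) z $ j) = cpt (of_real a) (\<i> * of_real (- b)) z $ j" for j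
      by (cases j) simp_all
    then show ?thesis by (simp add: vec_eq_iff)
  qed
  have "(\<integral>z. cmod (?g (cpt (of_real (cosh (- \<eta>))) (\<i> * of_real (sinh (- \<eta>))) z)) powr p \<partial>gaussian)
    \<le> cosh (2 * - \<eta>) powr (real n * p / 2) * (\<integral>z. cmod (?g (cpt 1 0 z)) powr p \<partial>gaussian)"
    using False by (intro complex_moment_bound_nonneg[OF wpoly_conjugate[OF f] wn p]) auto
  then show ?thesis unfolding conj using conj[of 1 0] by simp
qed

section \<open>From complex moments to the derivative\<close>

lemma powr_tangent_line:
  fixes a x p :: real
  assumes "p > 1" "a \<ge> 0" "x \<ge> 0"
  shows "a powr p + p * a powr (p - 1) * (x - a) \<le> x powr p"
proof -
  have "x * a powr (p - 1) \<le> x powr p / p + (a powr (p - 1)) powr (p / (p - 1)) / (p / (p - 1))"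
    using assms by (intro Youngs_inequality) (auto simp: field_simps)
  also have "(a powr (p - 1)) powr (p / (p - 1)) = a powr p" using assms by (simp add: powr_powr)
  finally have "p * (x * a powr (p - 1)) \<le> p * (x powr p / p + a powr p / (p / (p - 1)))"
    using assms by (intro mult_left_mono) auto
  moreover have "p * (x powr p / p + a powr p / (p / (p - 1))) = x powr p + (p - 1) * a powr p"
    using assms by (simp add: field_simps)
  moreover have "a powr p = a powr (p - 1) * a"
    using assms by (cases "a = 0") (auto simp: powr_diff)
  ultimately show ?thesis by (simp add: algebra_simps)
qed

lemma interval_power_mean:
  fixes X :: "real \<Rightarrow> real"
  assumes c: "continuous_on {0..1} X" and X: "\<And>t. X t \<ge> 0" and p: "p > 1"
  shows "(\<integral>t. indicator {0..1} t * X t \<partial>lborel) powr p \<le> (\<integral>t. indicator {0..1} t * X t powr p \<partial>lborel)"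
proof -
  have I: "integrable lborel (\<lambda>t. indicator {0..1} t * Y t)" if "continuous_on {0..1} Y" for Y :: "real \<Rightarrow> real"
    using borel_integrable_atLeastAtMost'[OF that] by (simp add: set_integrable_def)
  note I1 = I[OF c]
  have I2: "integrable lborel (\<lambda>t. indicator {0..1} t * X t powr p)"
    using p X by (intro I continuous_on_powr' c continuous_on_const) auto
  have I0: "integrable lborel (\<lambda>t::real. indicator {0..1} t :: real)"
    using I[of "\<lambda>_. 1"] by simp
  define a where "a = (\<integral>t. indicator {0..1} t * X t \<partial>lborel)"
  have a: "a \<ge> 0" unfolding a_def using X by (intro Bochner_Integration.integral_nonneg) simp
  have "a powr p = (\<integral>t. indicator {0..1} t * (a powr p - p * a powr (p - 1) * a) + p * a powr (p - 1) * (indicator {0..1} t * X t) \<partial>lborel)"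
    using I0 I1 by (simp add: a_def[symmetric])
  also have "\<dots> \<le> (\<integral>t. indicator {0..1} t * X t powr p \<partial>lborel)"
  proof (rule integral_mono)
    show "integrable lborel (\<lambda>t. indicator {0..1} t * (a powr p - p * a powr (p - 1) * a) + p * a powr (p - 1) * (indicator {0..1} t * X t))"
      using I0 I1 by simp
    show "indicator {0..1} t * (a powr p - p * a powr (p - 1) * a) + p * a powr (p - 1) * (indicator {0..1} t * X t) \<le> indicator {0..1} t * X t powr p" for t
      using powr_tangent_line[OF p a X[of t]] by (auto simp: indicator_def algebra_simps)
  qed (rule I2)
  finally show ?thesis unfolding a_def .
qed

lemma Cauchy_derivative_powr_bound:
  assumes T: "T holomorphic_on UNIV" and D: "(T has_field_derivative D) (at 0)" and r: "r > 0" and p: "p > 1"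
  shows "cmod D powr p \<le> r powr (- p) *
    (\<integral>t. indicator {0..1} t * cmod (T (of_real r * exp (2 * of_real pi * \<i> * of_real t))) powr p \<partial>lborel)"
proof -
  let ?e = "\<lambda>t::real. of_real r * exp (2 * of_real pi * \<i> * of_real t)"
  have cT: "continuous_on S T" for S using T holomorphic_on_imp_continuous_on continuous_on_subset by blast
  have e0: "?e t \<noteq> 0" "cmod (?e t) = r" for t using r by (auto simp: norm_mult)
  have "((\<lambda>u. T u / (u - 0) ^ (Suc 1)) has_contour_integral ((2 * pi * \<i>) / (fact 1) * (deriv ^^ 1) T 0)) (circlepath 0 r)"
    using r by (intro Cauchy_has_contour_integral_higher_derivative_circlepath cT holomorphic_on_subset[OF T]) auto
  then have "((\<lambda>u. T u / u ^ 2) has_contour_integral (2 * pi * \<i> * D)) (circlepath 0 r)"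
    using DERIV_imp_deriv[OF D] by (simp add: power2_eq_square)
  then have "((\<lambda>t. T (?e t) / (?e t)\<^sup>2 * (2 * pi * \<i> * r * exp (2 * of_real pi * \<i> * t))) has_integral (2 * pi * \<i> * D)) {0..1}"
    unfolding has_contour_integral_def
  proof (rule has_integral_eq[rotated])
    fix t :: real assume "t \<in> {0..1}"
    then have vd: "vector_derivative (circlepath 0 r) (at t within {0..1}) = 2 * pi * \<i> * r * exp (2 * of_real pi * \<i> * t)"
      by (intro vector_derivative_circlepath01) auto
    show "T (circlepath 0 r t) / (circlepath 0 r t)\<^sup>2 * vector_derivative (circlepath 0 r) (at t within {0..1})
        = T (?e t) / (?e t)\<^sup>2 * (2 * pi * \<i> * r * exp (2 * of_real pi * \<i> * t))"
      unfolding vd by (simp add: circlepath)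
  qed
  then have "((\<lambda>t. (2 * pi * \<i>) * (T (?e t) / ?e t)) has_integral (2 * pi * \<i> * D)) {0..1}"
    by (rule has_integral_eq[rotated]) (use e0 in \<open>simp add: power2_eq_square\<close>)
  then have "((\<lambda>t. (1 / (2 * pi * \<i>)) * ((2 * pi * \<i>) * (T (?e t) / ?e t))) has_integral ((1 / (2 * pi * \<i>)) * (2 * pi * \<i> * D))) {0..1}"
    by (rule has_integral_mult_right)
  then have hi: "((\<lambda>t. T (?e t) / ?e t) has_integral D) {0..1}" by simp
  have cX: "continuous_on {0..1} (\<lambda>t. cmod (T (?e t)))"
    by (intro continuous_on_norm continuous_on_compose2[OF cT[of UNIV]] continuous_intros) auto
  have "cmod D \<le> integral {0..1} (\<lambda>t. cmod (T (?e t)) / r)"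
    unfolding integral_unique[OF hi, symmetric]
  proof (rule integral_norm_bound_integral)
    show "(\<lambda>t. T (?e t) / ?e t) integrable_on {0..1}" using hi by blast
    show "(\<lambda>t. cmod (T (?e t)) / r) integrable_on {0..1}"
      using cX r by (intro integrable_continuous_interval continuous_on_divide continuous_on_const) auto
    show "cmod (T (?e t) / ?e t) \<le> cmod (T (?e t)) / r" for t using e0 by (simp add: norm_divide)
  qed
  also have "\<dots> = (\<integral>t. indicator {0..1} t * cmod (T (?e t)) \<partial>lborel) / r"
    using set_borel_integral_eq_integral(2)[OF borel_integrable_atLeastAtMost'[OF cX]]
    by (simp add: set_lebesgue_integral_def)
  finally have "cmod D powr p \<le> ((\<integral>t. indicator {0..1} t * cmod (T (?e t)) \<partial>lborel) / r) powr p"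
    using p by (intro powr_mono2) auto
  also have "\<dots> = r powr (- p) * (\<integral>t. indicator {0..1} t * cmod (T (?e t)) \<partial>lborel) powr p"
    using r by (subst powr_divide) (auto intro!: Bochner_Integration.integral_nonneg simp: powr_minus field_simps)
  also have "\<dots> \<le> r powr (- p) * (\<integral>t. indicator {0..1} t * cmod (T (?e t)) powr p \<partial>lborel)"
    by (intro mult_left_mono interval_power_mean[OF cX _ p]) auto
  finally show ?thesis .
qed

lemma cosh_le_exp_square: "cosh x \<le> exp (x\<^sup>2 / 2)" for x :: real
proof -
  have main: "cosh x \<le> exp (x\<^sup>2 / 2)" if "x \<ge> 0" for x :: real
  proof -
    have t: "sinh y \<le> y * cosh y" if "y \<ge> 0" for y :: real
    proof -
      have "0 * cosh 0 - sinh 0 \<le> y * cosh y - sinh (y :: real)"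
        by (rule DERIV_nonneg_imp_nondecreasing[OF that])
          (auto intro!: exI derivative_eq_intros mult_nonneg_nonneg simp: algebra_simps)
      then show ?thesis by simp
    qed
    have "cosh 0 * exp (- 0\<^sup>2 / 2) \<ge> cosh x * exp (- x\<^sup>2 / 2)"
    proof (rule DERIV_nonpos_imp_nonincreasing[OF that])
      fix y :: real assume y: "0 \<le> y" "y \<le> x"
      have "((\<lambda>y. cosh y * exp (- y\<^sup>2 / 2)) has_real_derivative (sinh y - y * cosh y) * exp (- y\<^sup>2 / 2)) (at y)"
        by (auto intro!: derivative_eq_intros simp: algebra_simps)
      moreover have "(sinh y - y * cosh y) * exp (- y\<^sup>2 / 2) \<le> 0"
        using t[OF y(1)] by (intro mult_nonpos_nonneg) auto
      ultimately show "\<exists>z. ((\<lambda>y. cosh y * exp (- y\<^sup>2 / 2)) has_real_derivative z) (at y) \<and> z \<le> 0" by blast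
    qed
    then show ?thesis by (simp add: exp_minus field_simps)
  qed
  show ?thesis using main[of "\<bar>x\<bar>"] by simp
qed

lemma holo_curve:
  assumes f: "holo f f'" and z: "\<And>j. ((\<lambda>t. z t $ j) has_field_derivative z' $ j) (at t)"
  shows "((\<lambda>t. f (z t)) has_field_derivative (\<Sum>j\<in>UNIV. f' j (z t) * z' $ j)) (at t)"
proof -
  have ax: "bounded_linear (axis j :: complex \<Rightarrow> complex ^ 'a)" for j
    unfolding linear_conv_bounded_linear[symmetric]
    by (rule linearI) (auto simp: vec_eq_iff axis_def)
  have rep: "v = (\<Sum>j\<in>UNIV. axis j (v $ j))" for v :: "complex ^ 'a"
    by (simp add: vec_eq_iff axis_def)
  have "((\<lambda>t. \<Sum>j\<in>UNIV. axis j (z t $ j)) has_derivative (\<lambda>h. \<Sum>j\<in>UNIV. axis j (z' $ j * h))) (at t)"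
    using z unfolding has_field_derivative_def
    by (intro has_derivative_sum bounded_linear.has_derivative[OF ax]) auto
  then have "(z has_derivative (\<lambda>h. \<Sum>j\<in>UNIV. axis j (z' $ j * h))) (at t)" unfolding rep[symmetric] .
  moreover have "(f has_derivative (\<lambda>h. \<Sum>j\<in>UNIV. f' j (z t) * h $ j)) (at (z t))"
    using f unfolding wirtinger_def by simp
  ultimately have "((\<lambda>t. f (z t)) has_derivative (\<lambda>h. \<Sum>j\<in>UNIV. f' j (z t) * (\<Sum>j\<in>UNIV. axis j (z' $ j * h)) $ j)) (at t)"
    by (rule has_derivative_compose)
  moreover have "(\<Sum>j\<in>UNIV. axis j (z' $ j * h)) $ k = z' $ k * h" for k h
    using rep[of "\<chi> j. z' $ j * h"] by (metis (no_types, lifting) sum.cong vec_lambda_beta)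
  moreover have "(\<lambda>h. \<Sum>j\<in>UNIV. f' j (z t) * (z' $ j * h)) = (*) (\<Sum>j\<in>UNIV. f' j (z t) * z' $ j)"
    by (simp add: fun_eq_iff sum_distrib_right mult.assoc)
  ultimately show ?thesis unfolding has_field_derivative_def by simp
qed

lemma directional_derivative_moment:
  fixes f :: "complex ^ 'd::finite option \<Rightarrow> complex"
  assumes f: "holo f f'" and tf: "tame f" and tf': "\<And>j. tame (f' j)" and n: "n \<ge> 1" and p: "p \<ge> 2" and M: "M \<ge> 0"
    and bound: "\<And>\<eta>. (\<integral>z. cmod (f (cpt (of_real (cosh \<eta>)) (\<i> * of_real (sinh \<eta>)) z)) powr p \<partial>gaussian)
      \<le> cosh (2 * \<eta>) powr (real n * p / 2) * M"
  shows "(\<integral>z. cmod (\<Sum>i\<in>UNIV. f' (Some i) (cpt 1 0 z) * of_real (snd z $ i)) powr p \<partial>gaussian)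
      \<le> (2 * exp 1 * real n) powr (p / 2) * M"
proof -
  define r where "r = 1 / sqrt (2 * real n)"
  have r: "r > 0" "r \<le> 1" unfolding r_def using n by (auto simp: real_le_rsqrt)
  let ?e = "\<lambda>t::real. of_real r * exp (2 * of_real pi * \<i> * of_real t)"
  let ?T = "\<lambda>z \<zeta>. f (cpt (cos \<zeta>) (sin \<zeta>) z)"
  let ?D = "\<lambda>z. \<Sum>i\<in>UNIV. f' (Some i) (cpt 1 0 z) * of_real (snd z $ i)"
  have dT: "(?T z has_field_derivative (\<Sum>j\<in>UNIV. f' j (cpt (cos \<zeta>) (sin \<zeta>) z) *
      (\<chi> j. case j of None \<Rightarrow> 0 | Some i \<Rightarrow> - sin \<zeta> * of_real (fst z $ i) + cos \<zeta> * of_real (snd z $ i)) $ j)) (at \<zeta>)" for z \<zeta>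
  proof (rule holo_curve[OF f])
    show "((\<lambda>\<zeta>. cpt (cos \<zeta>) (sin \<zeta>) z $ j) has_field_derivative
      (\<chi> j. case j of None \<Rightarrow> 0 | Some i \<Rightarrow> - sin \<zeta> * of_real (fst z $ i) + cos \<zeta> * of_real (snd z $ i)) $ j) (at \<zeta>)" for j
      by (cases j) (auto intro!: derivative_eq_intros)
  qed
  have hol: "?T z holomorphic_on UNIV" for z
    using dT by (intro holomorphic_onI) (meson field_differentiable_def field_differentiable_at_within)
  have d0: "(?T z has_field_derivative ?D z) (at 0)" for z
    using dT[of z 0] by (simp add: UNIV_option_sum)
  define F where "F = (\<lambda>t z. cmod (?T z (?e t)) powr p)"
  have tF: "tame (\<lambda>w. F (fst w) (snd w))"
  proof -
    have ce: "tame (\<lambda>t. cos (?e t))" "tame (\<lambda>t. sin (?e t))"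
    proof -
      have Im: "\<bar>Im (?e t)\<bar> \<le> r" for t using abs_Im_le_cmod[of "?e t"] r by (simp add: norm_mult)
      have b: "cmod (cos w) \<le> exp \<bar>Im w\<bar>" "cmod (sin w) \<le> exp \<bar>Im w\<bar>" for w
        using cmod_cos_le_exp[of 1 w] cmod_sin_le_exp[of 1 w] by simp_all
      have "exp \<bar>Im (?e t)\<bar> \<le> exp r" for t using Im[of t] by simp
      then have "cmod (cos (?e t)) \<le> exp r" "cmod (sin (?e t)) \<le> exp r" for t
        using b[of "?e t"] order_trans by blast+
      moreover have "continuous_on UNIV (\<lambda>t. cos (?e t))" "continuous_on UNIV (\<lambda>t. sin (?e t))"
        by (intro continuous_intros)+
      ultimately show "tame (\<lambda>t. cos (?e t))" "tame (\<lambda>t. sin (?e t))"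
        by (blast intro: tame_bounded)+
    qed
    have "tame (\<lambda>w. cpt (cos (?e (fst w))) (sin (?e (fst w))) (snd w :: (real ^ 'd) \<times> (real ^ 'd)))"
    proof (rule tame_vec)
      fix j :: "'d option"
      show "tame (\<lambda>w. cpt (cos (?e (fst w))) (sin (?e (fst w))) (snd w :: (real ^ 'd) \<times> (real ^ 'd)) $ j)"
        by (cases j; simp only: cpt_nth)
          (intro tame_const tame_add tame_mult tame_of_real tame_nth tame_fst tame_snd tame_id tame_compose[OF ce(1)] tame_compose[OF ce(2)])+
    qed
    then show ?thesis unfolding F_def using p by (intro tame_powr tame_norm tame_compose[OF tf]) auto
  qed
  have rot: "(\<integral>z. F t z \<partial>gaussian) \<le> exp (p / 2) * M" for t
  proof -
    define \<theta> where "\<theta> = Re (?e t)"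
    define \<eta> where "\<eta> = Im (?e t)"
    have e: "?e t = of_real \<theta> + \<i> * of_real \<eta>" unfolding \<theta>_def \<eta>_def by (rule complex_eq)
    have ce: "cmod (?e t) = r" using r by (simp add: norm_mult)
    have \<theta>: "\<bar>\<theta>\<bar> \<le> r" and \<eta>: "\<bar>\<eta>\<bar> \<le> r" unfolding \<theta>_def \<eta>_def using abs_Re_le_cmod[of "?e t"] abs_Im_le_cmod[of "?e t"] ce by auto
    have c\<theta>: "cos (\<theta> / 2) \<noteq> 0"
    proof -
      have "- (pi / 2) < \<theta> / 2" "\<theta> / 2 < pi / 2" using \<theta> r pi_gt3 by linarith+
      then show ?thesis using cos_gt_zero_pi[of "\<theta> / 2"] by linarith
    qed
    have ch: "cos (\<i> * of_real \<eta>) = of_real (cosh \<eta>)" and sh: "sin (\<i> * of_real \<eta>) = \<i> * of_real (sinh \<eta>)"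
    proof -
      show "cos (\<i> * of_real \<eta>) = of_real (cosh \<eta>)"
        using cos_i_times[of "of_real \<eta>"] by (simp add: cosh_field_def exp_of_real exp_minus add.commute)
      show "sin (\<i> * of_real \<eta>) = \<i> * of_real (sinh \<eta>)"
        using sin_i_times[of "of_real \<eta>"] by (simp add: sinh_field_def exp_of_real exp_minus)
    qed
    let ?R = "\<lambda>z :: (real ^ 'd) \<times> (real ^ 'd). (cos \<theta> *\<^sub>R fst z + sin \<theta> *\<^sub>R snd z, cos \<theta> *\<^sub>R snd z - sin \<theta> *\<^sub>R fst z)"
    have "cpt (cos (?e t)) (sin (?e t)) z = cpt (of_real (cosh \<eta>)) (\<i> * of_real (sinh \<eta>)) (?R z)" for z
    proof -
      have cs: "cos (?e t) = of_real (cos \<theta>) * of_real (cosh \<eta>) - of_real (sin \<theta>) * (\<i> * of_real (sinh \<eta>))"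
        "sin (?e t) = of_real (sin \<theta>) * of_real (cosh \<eta>) + of_real (cos \<theta>) * (\<i> * of_real (sinh \<eta>))"
        unfolding e cos_add sin_add ch sh cos_of_real sin_of_real by simp_all
      have "cpt (cos (?e t)) (sin (?e t)) z $ j = cpt (of_real (cosh \<eta>)) (\<i> * of_real (sinh \<eta>)) (?R z) $ j" for j
        unfolding cs by (cases j) (simp_all add: algebra_simps)
      then show ?thesis by (simp add: vec_eq_iff)
    qed
    then have "(\<integral>z. F t z \<partial>gaussian) = (\<integral>z. cmod (f (cpt (of_real (cosh \<eta>)) (\<i> * of_real (sinh \<eta>)) (?R z))) powr p \<partial>gaussian)"
      unfolding F_def by simp
    also have "\<dots> = (\<integral>z. cmod (f (cpt (of_real (cosh \<eta>)) (\<i> * of_real (sinh \<eta>)) z)) powr p \<partial>gaussian)"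
    proof (rule gaussian_rotate[OF c\<theta>, of "\<lambda>z. cmod (f (cpt (of_real (cosh \<eta>)) (\<i> * of_real (sinh \<eta>)) z)) powr p"])
      show "(\<lambda>z. cmod (f (cpt (of_real (cosh \<eta>)) (\<i> * of_real (sinh \<eta>)) z)) powr p) \<in> borel_measurable borel"
        using tame_measurable[OF tame_compose[OF tf tame_cpt]] by measurable
    qed
    also have "\<dots> \<le> cosh (2 * \<eta>) powr (real n * p / 2) * M" by (rule bound)
    also have "\<dots> \<le> exp (p / 2) * M"
    proof (rule mult_right_mono[OF _ M])
      have "cosh (2 * \<eta>) \<le> exp ((2 * \<eta>)\<^sup>2 / 2)" by (rule cosh_le_exp_square)
      also have "\<dots> \<le> exp (2 * r\<^sup>2)" using \<eta> r by (auto simp: power_mult_distrib intro!: abs_le_square_iff[THEN iffD1])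
      also have "2 * r\<^sup>2 = 1 / real n" unfolding r_def using n by (simp add: power_divide)
      finally have "cosh (2 * \<eta>) powr (real n * p / 2) \<le> exp (1 / real n) powr (real n * p / 2)"
        using p by (intro powr_mono2) auto
      also have "\<dots> = exp (p / 2)" using n by (simp add: exp_powr_real)
      finally show "cosh (2 * \<eta>) powr (real n * p / 2) \<le> exp (p / 2)" .
    qed
    finally show ?thesis .
  qed
  have tD: "tame ?D" by (intro tame_sum tame_mult tame_of_real tame_nth tame_snd tame_id tame_compose[OF tf' tame_cpt])
  have "(\<integral>z. cmod (?D z) powr p \<partial>gaussian) \<le> (\<integral>z. r powr (- p) * (\<integral>t. indicator {0..1} t *\<^sub>R F t z \<partial>lborel) \<partial>gaussian)"
  proof (rule integral_mono)
    show "integrable gaussian (\<lambda>z. cmod (?D z) powr p)"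
      using p by (intro integrable_tame tame_powr tame_norm tD) auto
    show "integrable gaussian (\<lambda>z. r powr (- p) * (\<integral>t. indicator {0..1} t *\<^sub>R F t z \<partial>lborel))"
      by (intro integrable_mult_right interval_gaussian_Fubini(2)[OF tF])
    show "cmod (?D z) powr p \<le> r powr (- p) * (\<integral>t. indicator {0..1} t *\<^sub>R F t z \<partial>lborel)" for z
      using Cauchy_derivative_powr_bound[OF hol d0 r(1), of p z] p unfolding F_def by simp
  qed
  also have "\<dots> = r powr (- p) * (\<integral>t. indicator {0..1} t *\<^sub>R (\<integral>z. F t z \<partial>gaussian) \<partial>lborel)"
    using interval_gaussian_Fubini(1)[OF tF, of 0 1] by simp
  also have "\<dots> \<le> r powr (- p) * (\<integral>t. indicator {0..1} t *\<^sub>R (exp (p / 2) * M) \<partial>(lborel :: real measure))"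
  proof (rule mult_left_mono)
    show "(\<integral>t. indicator {0..1} t *\<^sub>R (\<integral>z. F t z \<partial>gaussian) \<partial>lborel)
        \<le> (\<integral>t. indicator {0..1} t *\<^sub>R (exp (p / 2) * M) \<partial>(lborel :: real measure))"
    proof (rule integral_mono)
      show "integrable lborel (\<lambda>t. indicator {0..1} t *\<^sub>R (\<integral>z. F t z \<partial>gaussian))"
        by (rule interval_gaussian_Fubini(3)[OF tF])
      show "integrable lborel (\<lambda>t::real. indicator {0..1} t *\<^sub>R (exp (p / 2) * M))"
        using borel_integrable_atLeastAtMost'[of 0 1 "\<lambda>_. exp (p / 2) * M"] by (simp add: set_integrable_def)
      show "indicator {0..1} t *\<^sub>R (\<integral>z. F t z \<partial>gaussian) \<le> indicator {0..1} t *\<^sub>R (exp (p / 2) * M)" for t :: real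
        by (rule scaleR_left_mono[OF rot]) simp
    qed
  qed simp
  also have "\<dots> = r powr (- p) * exp (p / 2) * M" by simp
  also have "r powr (- p) * exp (p / 2) = (2 * exp 1 * real n) powr (p / 2)"
  proof -
    have "r = (2 * real n) powr (- (1 / 2))" unfolding r_def using n by (simp add: powr_minus_divide powr_half_sqrt)
    then have "r powr (- p) = (2 * real n) powr (p / 2)" by (simp add: powr_powr)
    moreover have "exp (p / 2) = exp 1 powr (p / 2)" by (simp add: exp_powr_real)
    moreover have "(2 * exp 1 * real n) powr (p / 2) = (2 * real n) powr (p / 2) * exp 1 powr (p / 2)"
      using powr_mult[of "2 * real n" "exp 1" "p / 2"] by (simp add: mult_ac)
    ultimately show ?thesis by simp
  qed
  finally show ?thesis .
qed

section \<open>Absolute moments of the standard Gaussian\<close>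

definition abs_moment :: "real \<Rightarrow> real" where
  "abs_moment p = (\<integral>g. \<bar>g\<bar> powr p \<partial>(gaussian :: real measure))"

lemma tame_abs_powr: "p > 0 \<Longrightarrow> tame (\<lambda>x::real. \<bar>x\<bar> powr p)"
  using tame_powr[OF tame_norm[OF tame_id[where 'a = real]], of p] by simp

lemma square_powr: "(x\<^sup>2) powr a = \<bar>x\<bar> powr (2 * a)" for x a :: real
proof (cases "x = 0")
  case False
  then have "x\<^sup>2 = \<bar>x\<bar> powr 2" by (simp add: powr_numeral)
  then show ?thesis by (simp only: powr_powr)
qed simp

lemma has_derivative_abs_powr_times:
  fixes x p :: real
  assumes p: "p > 0"
  shows "((\<lambda>x. \<bar>x\<bar> powr p * x) has_real_derivative (p + 1) * \<bar>x\<bar> powr p) (at x)"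
proof (cases "x = 0")
  case True
  have "((\<lambda>h::real. \<bar>h\<bar> powr p) \<longlongrightarrow> \<bar>0\<bar> powr p) (at 0)"
    using p by (intro tendsto_powr2 tendsto_rabs tendsto_ident_at tendsto_const) auto
  then have "((\<lambda>h::real. \<bar>h\<bar> powr p) \<longlongrightarrow> 0) (at 0)" by simp
  then have "((\<lambda>h. (\<bar>0 + h\<bar> powr p * (0 + h) - \<bar>0\<bar> powr p * 0) / h) \<longlongrightarrow> 0) (at 0)"
    by (rule Lim_transform_eventually) (auto simp: eventually_at_filter)
  then show ?thesis unfolding True DERIV_def by simp
next
  case False
  have "(abs has_real_derivative sgn x) (at x)"
  proof (rule has_field_derivative_transform_within_open)
    show "((\<lambda>y. sgn x * y) has_real_derivative sgn x) (at x)" by (auto intro!: derivative_eq_intros)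
    show "open {y. y * x > 0}" by (intro open_Collect_less continuous_intros)
    show "x \<in> {y. y * x > 0}" using False by (simp add: not_sum_squares_lt_zero zero_less_mult_iff) linarith
    show "sgn x * y = \<bar>y\<bar>" if "y \<in> {y. y * x > 0}" for y
      using that by (auto simp: zero_less_mult_iff sgn_if)
  qed
  from DERIV_chain2[OF has_real_derivative_powr this, of p]
  have "((\<lambda>x. \<bar>x\<bar> powr p) has_real_derivative p * \<bar>x\<bar> powr (p - 1) * sgn x) (at x)" using False by simp
  from DERIV_mult[OF this DERIV_ident]
  have "((\<lambda>x. \<bar>x\<bar> powr p * x) has_real_derivative p * \<bar>x\<bar> powr (p - 1) * sgn x * x + 1 * \<bar>x\<bar> powr p) (at x)" .
  moreover have "p * \<bar>x\<bar> powr (p - 1) * sgn x * x + 1 * \<bar>x\<bar> powr p = (p + 1) * \<bar>x\<bar> powr p"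
  proof -
    have "\<bar>x\<bar> powr (p - 1) * (sgn x * x) = \<bar>x\<bar> powr p"
      using False powr_add[of "\<bar>x\<bar>" "p - 1" 1] by (simp add: sgn_if abs_if)
    then show ?thesis by (simp add: algebra_simps)
  qed
  ultimately show ?thesis by simp
qed

lemma abs_moment_rec:
  assumes "p > 0" shows "abs_moment (p + 2) = (p + 1) * abs_moment p"
proof -
  have "(\<integral>x. (1 \<bullet> x) *\<^sub>R (\<bar>x\<bar> powr p * x) \<partial>(gaussian :: real measure)) = (\<integral>x. (p + 1) * \<bar>x\<bar> powr p \<partial>gaussian)"
  proof (rule gaussian_integration_by_parts)
    show "tame (\<lambda>x::real. \<bar>x\<bar> powr p * x)" "tame (\<lambda>x::real. (p + 1) * \<bar>x\<bar> powr p)"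
      by (intro tame_mult tame_const tame_id tame_abs_powr assms)+
    fix x :: real
    have "((\<lambda>y. \<bar>y\<bar> powr p * y) has_real_derivative (p + 1) * \<bar>x\<bar> powr p) (at (x + 0 * 1))"
      using has_derivative_abs_powr_times[OF assms, of x] by simp
    moreover have "((\<lambda>t. x + t * 1) has_real_derivative 1) (at 0)" by (auto intro!: derivative_eq_intros)
    ultimately have "((\<lambda>t. \<bar>x + t * 1\<bar> powr p * (x + t * 1)) has_real_derivative ((p + 1) * \<bar>x\<bar> powr p) * 1) (at 0)"
      by (rule DERIV_chain2[where f = "\<lambda>y. \<bar>y\<bar> powr p * y" and g = "\<lambda>t. x + t * 1"])
    then show "((\<lambda>t. \<bar>x + t *\<^sub>R 1\<bar> powr p * (x + t *\<^sub>R 1)) has_vector_derivative (p + 1) * \<bar>x\<bar> powr p) (at 0)"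
      by (simp add: has_real_derivative_iff_has_vector_derivative)
  qed
  moreover have "(1 \<bullet> x) *\<^sub>R (\<bar>x\<bar> powr p * x) = \<bar>x\<bar> powr (p + 2)" for x :: real
    by (cases "x = 0") (auto simp: powr_add powr_numeral power2_eq_square)
  ultimately show ?thesis unfolding abs_moment_def by simp
qed

lemma abs_moment_2: "abs_moment 2 = 1"
proof -
  interpret prob_space "gaussian :: real measure" by (rule prob_space_gaussian)
  have "(\<integral>x. (1 \<bullet> x) *\<^sub>R x \<partial>(gaussian :: real measure)) = (\<integral>x. 1 \<partial>(gaussian :: real measure))"
  proof (rule gaussian_integration_by_parts[where f = "\<lambda>x. x" and f' = "\<lambda>_. 1"])
    show "((\<lambda>t. x + t *\<^sub>R 1) has_vector_derivative 1) (at 0)" for x :: real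
      unfolding has_real_derivative_iff_has_vector_derivative[symmetric] by (auto intro!: derivative_eq_intros)
  qed auto
  moreover have "\<bar>x\<bar> powr 2 = (1 \<bullet> x) *\<^sub>R x" for x :: real
    by (cases "x = 0") (auto simp: powr_numeral power2_eq_square)
  ultimately show ?thesis unfolding abs_moment_def using prob_space by simp
qed

lemma abs_moment_4: "abs_moment 4 = 3" and abs_moment_6: "abs_moment 6 = 15"
  using abs_moment_rec[of 2] abs_moment_rec[of 4] abs_moment_2 by simp_all

lemma abs_moment_ge_1:
  assumes "p \<ge> 2" shows "abs_moment p \<ge> 1"
proof -
  interpret prob_space "gaussian :: real measure" by (rule prob_space_gaussian)
  have t: "\<bar>x\<bar> powr p \<ge> 1 + p / 2 * (\<bar>x\<bar> powr 2 - 1)" for x :: real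
  proof (cases "p = 2")
    case False
    have "1 powr (p / 2) + p / 2 * 1 powr (p / 2 - 1) * (x\<^sup>2 - 1) \<le> (x\<^sup>2) powr (p / 2)"
      using assms False by (intro powr_tangent_line) auto
    moreover have "\<bar>x\<bar> powr 2 = x\<^sup>2" by (cases "x = 0") (auto simp: powr_numeral)
    ultimately show ?thesis by (simp add: square_powr)
  qed simp
  have i2: "integrable (gaussian :: real measure) (\<lambda>x. \<bar>x\<bar> powr 2)" by (intro integrable_tame tame_abs_powr) simp
  have e: "(\<integral>x. 1 + p / 2 * (\<bar>x\<bar> powr 2 - 1) \<partial>(gaussian :: real measure)) = 1 + p / 2 * (abs_moment 2 - 1)"
    using i2 prob_space unfolding abs_moment_def by (simp add: Bochner_Integration.integral_diff)
  have "(\<integral>x. 1 + p / 2 * (\<bar>x\<bar> powr 2 - 1) \<partial>(gaussian :: real measure)) \<le> abs_moment p"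
    unfolding abs_moment_def
  proof (rule integral_mono)
    show "integrable (gaussian :: real measure) (\<lambda>x. 1 + p / 2 * (\<bar>x\<bar> powr 2 - 1))"
      by (intro integrable_tame tame_add tame_mult tame_diff tame_const tame_abs_powr) simp
    show "integrable (gaussian :: real measure) (\<lambda>x. \<bar>x\<bar> powr p)"
      using assms by (intro integrable_tame tame_abs_powr) simp
  qed (rule t)
  then show ?thesis unfolding e by (simp add: abs_moment_2)
qed

text \<open>Log-convexity of the moments, extrapolated from $p = 4$ and $p = 6$ by the tangent of
  $z \mapsto z^{-c}$ at $z = x^2 / 5 = 1$.\<close>

lemma abs_moment_lower_2_4:
  assumes "2 \<le> p" "p \<le> 4" shows "abs_moment p \<ge> 3 * 5 powr (p / 2 - 2)"
proof -
  define c where "c = 2 - p / 2"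
  have c: "c \<ge> 0" unfolding c_def using assms by simp
  have z: "z powr (- c) \<ge> 1 - c * (z - 1)" if "z > 0" for z :: real
  proof -
    have "1 - c * (z - 1) \<le> 1 + (- c * ln z)" using ln_le_minus_one[OF that] c by (simp add: mult_left_mono)
    also have "\<dots> \<le> exp (- c * ln z)" by (rule exp_ge_add_one_self)
    finally show ?thesis using that by (simp add: powr_def)
  qed
  have t: "\<bar>x\<bar> powr p \<ge> 5 powr (- c) * ((1 + c) * \<bar>x\<bar> powr 4 - c / 5 * \<bar>x\<bar> powr 6)" for x :: real
  proof (cases "x = 0")
    case False
    have s: "\<bar>x\<bar> powr p = 5 powr (- c) * \<bar>x\<bar> powr 4 * (x\<^sup>2 / 5) powr (- c)"
    proof -
      have "(x\<^sup>2 / 5) powr (- c) = \<bar>x\<bar> powr (2 * - c) / 5 powr (- c)"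
        by (simp only: powr_divide square_powr)
      moreover have "\<bar>x\<bar> powr p = \<bar>x\<bar> powr 4 * \<bar>x\<bar> powr (2 * - c)"
        unfolding powr_add[symmetric] c_def by simp
      ultimately show ?thesis by simp
    qed
    have "5 powr (- c) * \<bar>x\<bar> powr 4 * (1 - c * (x\<^sup>2 / 5 - 1)) \<le> \<bar>x\<bar> powr p"
      unfolding s using False by (intro mult_left_mono z) auto
    moreover have "\<bar>x\<bar> powr 6 = \<bar>x\<bar> powr 4 * x\<^sup>2"
      using False powr_add[of "\<bar>x\<bar>" 4 2] by (simp add: powr_numeral)
    ultimately show ?thesis by (simp add: algebra_simps)
  qed simp
  have i: "integrable (gaussian :: real measure) (\<lambda>x. \<bar>x\<bar> powr 4)" "integrable (gaussian :: real measure) (\<lambda>x. \<bar>x\<bar> powr 6)"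
    by (intro integrable_tame tame_abs_powr; simp)+
  have e: "(\<integral>x. 5 powr (- c) * ((1 + c) * \<bar>x\<bar> powr 4 - c / 5 * \<bar>x\<bar> powr 6) \<partial>(gaussian :: real measure))
      = 5 powr (- c) * ((1 + c) * abs_moment 4 - c / 5 * abs_moment 6)"
    using i unfolding abs_moment_def by (simp add: Bochner_Integration.integral_diff)
  have "(1 + c) * abs_moment 4 - c / 5 * abs_moment 6 = 3" unfolding abs_moment_4 abs_moment_6 by simp
  moreover have "(\<integral>x. 5 powr (- c) * ((1 + c) * \<bar>x\<bar> powr 4 - c / 5 * \<bar>x\<bar> powr 6) \<partial>(gaussian :: real measure)) \<le> abs_moment p"
    unfolding abs_moment_def
  proof (rule integral_mono)
    show "integrable (gaussian :: real measure) (\<lambda>x. 5 powr (- c) * ((1 + c) * \<bar>x\<bar> powr 4 - c / 5 * \<bar>x\<bar> powr 6))"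
      by (intro integrable_tame tame_mult tame_diff tame_const tame_abs_powr; simp)
    show "integrable (gaussian :: real measure) (\<lambda>x. \<bar>x\<bar> powr p)"
      using assms by (intro integrable_tame tame_abs_powr) simp
  qed (rule t)
  ultimately show ?thesis unfolding e by (simp add: c_def mult.commute)
qed

lemma ln_1_plus_le_Pade:
  fixes x :: real assumes "x \<ge> 0" shows "ln (1 + x) \<le> x * (6 + x) / (6 + 4 * x)"
proof -
  have "0 * (6 + 0) / (6 + 4 * 0) - ln (1 + 0) \<le> x * (6 + x) / (6 + 4 * x) - ln (1 + x)"
  proof (rule DERIV_nonneg_imp_nondecreasing[OF assms])
    fix y :: real assume y: "0 \<le> y" "y \<le> x"
    have "((\<lambda>x. x * (6 + x) / (6 + 4 * x) - ln (1 + x)) has_real_derivative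
        ((6 + 2 * y) * (6 + 4 * y) - y * (6 + y) * 4) / ((6 + 4 * y) * (6 + 4 * y)) - 1 / (1 + y)) (at y)"
      using y by (auto intro!: derivative_eq_intros simp: algebra_simps)
    moreover have "((6 + 2 * y) * (6 + 4 * y) - y * (6 + y) * 4) / ((6 + 4 * y) * (6 + 4 * y)) - 1 / (1 + y)
        = 4 * y ^ 3 / ((6 + 4 * y) * (6 + 4 * y) * (1 + y))"
      using y by (simp add: divide_simps) (simp add: algebra_simps power3_eq_cube)
    ultimately have "((\<lambda>x. x * (6 + x) / (6 + 4 * x) - ln (1 + x)) has_real_derivative 4 * y ^ 3 / ((6 + 4 * y) * (6 + 4 * y) * (1 + y))) (at y)"
      by simp
    moreover have "4 * y ^ 3 / ((6 + 4 * y) * (6 + 4 * y) * (1 + y)) \<ge> 0" using y by simp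
    ultimately show "\<exists>z. ((\<lambda>x. x * (6 + x) / (6 + 4 * x) - ln (1 + x)) has_real_derivative z) (at y) \<and> 0 \<le> z"
      by (intro exI conjI)
  qed
  then show ?thesis by simp
qed

lemma powr_step:
  fixes p :: real assumes p: "p \<ge> 2"
  shows "((p + 2) / exp 1) powr ((p + 2) / 2) \<le> (p + 1) * (p / exp 1) powr (p / 2)"
proof -
  have a: "p / 2 * (ln (p + 2) - ln p) \<le> 1 - 3 / (3 * p + 4)"
  proof -
    have "ln (p + 2) - ln p = ln (1 + 2 / p)"
    proof -
      have "1 + 2 / p = (p + 2) / (p)" using p by (simp add: field_simps)
      then show ?thesis using p ln_div[of "p + 2" "p"] by simp
    qed
    also have "\<dots> \<le> (2 / p) * (6 + 2 / p) / (6 + 4 * (2 / p))" using p by (intro ln_1_plus_le_Pade) auto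
    finally have "p / 2 * (ln (p + 2) - ln p) \<le> p / 2 * ((2 / p) * (6 + 2 / p) / (6 + 4 * (2 / p)))"
      using p by (intro mult_left_mono) auto
    also have "\<dots> = 1 - 3 / (3 * p + 4)" using p by (simp add: divide_simps) (simp add: algebra_simps)
    finally show ?thesis .
  qed
  have b: "ln (p + 2) - ln (p + 1) \<le> 3 / (3 * p + 4)"
  proof -
    have "ln (p + 2) - ln (p + 1) = ln (1 + 1 / (p + 1))"
    proof -
      have "1 + 1 / (p + 1) = (p + 2) / (p + 1)" using p by (simp add: field_simps)
      then show ?thesis using p ln_div[of "p + 2" "p + 1"] by simp
    qed
    also have "\<dots> \<le> (1 / (p + 1)) * (6 + 1 / (p + 1)) / (6 + 4 * (1 / (p + 1)))" using p by (intro ln_1_plus_le_Pade) auto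
    also have "\<dots> = (6 * p + 7) / ((p + 1) * (6 * p + 10))" using p by (simp add: divide_simps) (simp add: algebra_simps)
    also have "\<dots> \<le> 3 / (3 * p + 4)" using p by (simp add: divide_simps) (simp add: algebra_simps)
    finally show ?thesis .
  qed
  have "(p + 2) / 2 * (ln (p + 2) - 1) \<le> ln (p + 1) + p / 2 * (ln p - 1)"
  proof -
    define X Y where "X = p / 2 * (ln (p + 2) - ln p)" and "Y = p / 2 * ln p"
    have "(p + 2) / 2 * (ln (p + 2) - 1) = X + Y + ln (p + 2) - p / 2 - 1"
      unfolding X_def Y_def by (simp add: field_simps)
    moreover have "p / 2 * (ln p - 1) = Y - p / 2" unfolding Y_def by (simp only: right_diff_distrib mult_1_right)
    moreover have "X \<le> 1 - 3 / (3 * p + 4)" using a unfolding X_def .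
    ultimately show ?thesis using b by (simp del: times_divide_eq_right times_divide_eq_left)
  qed
  then have "exp ((p + 2) / 2 * (ln (p + 2) - 1)) \<le> exp (ln (p + 1) + p / 2 * (ln p - 1))" by simp
  moreover have "exp ((p + 2) / 2 * (ln (p + 2) - 1)) = ((p + 2) / exp 1) powr ((p + 2) / 2)"
    using p by (simp add: powr_def ln_div)
  moreover have "exp (ln (p + 1) + p / 2 * (ln p - 1)) = (p + 1) * (p / exp 1) powr (p / 2)"
    using p by (simp add: powr_def ln_div exp_add)
  ultimately show ?thesis by (simp only:)
qed

lemma exp_1_ge: "8 / 3 \<le> exp (1 :: real)"
proof -
  have "(1 + 1 / 3 + (1 / 3)\<^sup>2 / 2) ^ 3 \<le> exp (1 / 3 :: real) ^ 3"
    by (intro power_mono exp_lower_Taylor_quadratic) auto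
  also have "\<dots> = exp 1" by (simp add: exp_of_nat_mult[symmetric])
  finally show ?thesis by (simp add: power2_eq_square power3_eq_cube)
qed

lemma abs_moment_base:
  assumes "2 \<le> p" "p \<le> 4" shows "abs_moment p \<ge> (p / exp 1) powr (p / 2)"
proof (cases "p \<le> 8 / 3")
  case True
  have "(p / exp 1) powr (p / 2) \<le> 1 powr (p / 2)" using True assms exp_1_ge by (intro powr_mono2) (auto simp: field_simps)
  then show ?thesis using abs_moment_ge_1[OF assms(1)] by simp
next
  case False
  define h where "h = (\<lambda>p::real. ln 3 + (p / 2 - 2) * ln 5 - p / 2 * (ln p - 1))"
  have "h (8 / 3) \<le> h p"
  proof (rule DERIV_nonneg_imp_nondecreasing[where f = h and a = "8 / 3" and b = p])
    show "8 / 3 \<le> p" using False by simp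
    fix y :: real assume y: "8 / 3 \<le> y" "y \<le> p"
    have "(h has_real_derivative (ln 5 - ln y) / 2) (at y)"
      unfolding h_def using y by (auto intro!: derivative_eq_intros simp: field_simps)
    moreover have "(ln 5 - ln y) / 2 \<ge> 0" using y assms by simp
    ultimately show "\<exists>z. (h has_real_derivative z) (at y) \<and> 0 \<le> z" by blast
  qed
  moreover have "h (8 / 3) \<ge> 0"
  proof -
    have "ln (8 / 3 :: real) \<le> ln (exp 1)" using exp_1_ge by (subst ln_le_cancel_iff) auto
    moreover have "2 * ln 5 \<le> 3 * ln (3 :: real)"
    proof -
      have "ln (5 ^ 2) \<le> ln (3 ^ 3 :: real)" by (subst ln_le_cancel_iff) auto
      then show ?thesis by (simp add: ln_realpow del: power_numeral)
    qed
    ultimately show ?thesis unfolding h_def by simp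
  qed
  ultimately have "0 \<le> h p" by linarith
  then have "p / 2 * (ln p - 1) \<le> ln 3 + (p / 2 - 2) * ln 5" unfolding h_def by linarith
  then have "exp (p / 2 * (ln p - 1)) \<le> exp (ln 3 + (p / 2 - 2) * ln 5)" by simp
  moreover have "exp (p / 2 * (ln p - 1)) = (p / exp 1) powr (p / 2)"
    using assms by (simp add: powr_def ln_div)
  moreover have "exp (ln 3 + (p / 2 - 2) * ln 5) = 3 * 5 powr (p / 2 - 2 :: real)"
    by (simp add: powr_def exp_add)
  ultimately show ?thesis using abs_moment_lower_2_4[OF assms] by simp
qed

lemma abs_moment_lower:
  assumes "p \<ge> 2" shows "abs_moment p \<ge> (p / exp 1) powr (p / 2)"
proof -
  have "abs_moment p \<ge> (p / exp 1) powr (p / 2)" if "2 \<le> p" "p \<le> 4 + 2 * real k" for p k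
    using that
  proof (induction k arbitrary: p)
    case 0
    then show ?case by (intro abs_moment_base) auto
  next
    case (Suc k)
    show ?case
    proof (cases "p \<le> 4")
      case True
      then show ?thesis using Suc.prems by (intro abs_moment_base) auto
    next
      case False
      define s where "s = p - 2"
      have s: "s \<ge> 2" "s \<le> 4 + 2 * real k" "p = s + 2" unfolding s_def using False Suc.prems by auto
      have "(p / exp 1) powr (p / 2) \<le> (s + 1) * (s / exp 1) powr (s / 2)"
        unfolding s(3) by (rule powr_step[OF s(1)])
      also have "\<dots> \<le> (s + 1) * abs_moment s" using s by (intro mult_left_mono Suc.IH) auto
      also have "\<dots> = abs_moment p" unfolding s(3) using s by (simp add: abs_moment_rec)
      finally show ?thesis .
    qed
  qed
  from this[of p "nat \<lceil>p\<rceil>"] show ?thesis using assms by (simp add: le_nat_iff) linarith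
qed

lemma gauss_moment_eq: "gauss_moment p = abs_moment p powr (1 / p)"
  unfolding gauss_moment_def Lp_norm_def abs_moment_def by simp

lemma gauss_moment_lower:
  assumes "p \<ge> 2" shows "sqrt (p / exp 1) \<le> gauss_moment p"
proof -
  have "sqrt (p / exp 1) = ((p / exp 1) powr (p / 2)) powr (1 / p)"
    using assms by (simp add: powr_powr powr_half_sqrt)
  also have "\<dots> \<le> gauss_moment p"
    unfolding gauss_moment_eq using assms by (intro powr_mono2 abs_moment_lower) auto
  finally show ?thesis .
qed

lemma gauss_moment_upper: "\<exists>C>0. \<forall>q\<ge>2. gauss_moment q \<le> C * sqrt q"
proof -
  define K where "K = (\<integral>x. exp (x\<^sup>2 / 4) \<partial>(gaussian :: real measure))"
  have i: "integrable (gaussian :: real measure) (\<lambda>x. exp (x\<^sup>2 / 4))"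
  proof -
    have "gauss_dens x *\<^sub>R exp (x\<^sup>2 / 4) = (2 * pi) powr (- 1 / 2) * exp (- (norm x)\<^sup>2 / 4)" for x :: real
      unfolding gauss_dens_def by (simp add: exp_add[symmetric])
    then have "integrable lborel (\<lambda>x::real. gauss_dens x *\<^sub>R exp (x\<^sup>2 / 4))"
      using integrable_lborel_exp_norm[where 'a = real] by simp
    then show ?thesis
      unfolding gaussian_density by (subst integrable_density) (auto simp: less_imp_le[OF gauss_dens_pos])
  qed
  have K: "K \<ge> 0" unfolding K_def by (intro Bochner_Integration.integral_nonneg) simp
  have "gauss_moment q \<le> (sqrt 2 * max 1 K) * sqrt q" if q: "q \<ge> 2" for q
  proof -
    have pt: "\<bar>x\<bar> powr q \<le> (2 * q) powr (q / 2) * exp (x\<^sup>2 / 4)" for x :: real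
    proof (cases "x = 0")
      case False
      have "x\<^sup>2 / (2 * q) \<le> exp (x\<^sup>2 / (2 * q))" using exp_ge_add_one_self[of "x\<^sup>2 / (2 * q)"] by linarith
      then have "x\<^sup>2 \<le> 2 * q * exp (x\<^sup>2 / (2 * q))" using q by (simp add: field_simps)
      then have "(x\<^sup>2) powr (q / 2) \<le> (2 * q * exp (x\<^sup>2 / (2 * q))) powr (q / 2)"
        using q by (intro powr_mono2) auto
      also have "\<dots> = (2 * q) powr (q / 2) * exp (x\<^sup>2 / 4)"
        using q by (subst powr_mult) (auto simp: exp_powr_real)
      also have "(x\<^sup>2) powr (q / 2) = \<bar>x\<bar> powr q"
        by (simp add: square_powr)
      finally show ?thesis .
    qed simp
    have "abs_moment q \<le> (\<integral>x. (2 * q) powr (q / 2) * exp (x\<^sup>2 / 4) \<partial>(gaussian :: real measure))"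
      unfolding abs_moment_def
    proof (rule integral_mono)
      show "integrable (gaussian :: real measure) (\<lambda>x. \<bar>x\<bar> powr q)"
        using q by (intro integrable_tame tame_abs_powr) simp
      show "integrable (gaussian :: real measure) (\<lambda>x. (2 * q) powr (q / 2) * exp (x\<^sup>2 / 4))"
        using i by simp
    qed (rule pt)
    also have "\<dots> = (2 * q) powr (q / 2) * K" unfolding K_def using i by simp
    also have "\<dots> \<le> (2 * q) powr (q / 2) * max 1 K" by (intro mult_left_mono) auto
    finally have "abs_moment q powr (1 / q) \<le> ((2 * q) powr (q / 2) * max 1 K) powr (1 / q)"
      using q by (intro powr_mono2) (auto simp: abs_moment_def intro!: Bochner_Integration.integral_nonneg)
    also have "\<dots> = sqrt (2 * q) * max 1 K powr (1 / q)"
    proof -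
      have "((2 * q) powr (q / 2)) powr (1 / q) = (2 * q) powr (1 / 2)" using q by (simp add: powr_powr)
      also have "\<dots> = sqrt (2 * q)" using q by (intro powr_half_sqrt) simp
      finally show ?thesis by (simp only: powr_mult)
    qed
    also have "\<dots> \<le> sqrt (2 * q) * max 1 K powr 1"
      using q by (intro mult_left_mono powr_mono) auto
    finally show ?thesis unfolding gauss_moment_eq real_sqrt_mult by (simp add: mult_ac)
  qed
  then show ?thesis by (intro exI[of _ "sqrt 2 * max 1 K"]) auto
qed

section \<open>Homogenisation of the even and odd parts\<close>

text \<open>On the slice where the homogenising variable is $1$, the weights $m$ and $m - 1$ carry the monomials
  of degree at most $m$ with the parity of $m$ and the opposite parity, respectively.\<close>

definition poly_parts :: "nat \<Rightarrow> (complex ^ 'd::finite option \<Rightarrow> complex) \<Rightarrow> bool" where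
  "poly_parts m f \<longleftrightarrow> (\<exists>H0 H1. wpoly (int m) H0 \<and> wpoly (int m - 1) H1 \<and> (\<forall>p. p $ None = 1 \<longrightarrow> f p = H0 p + H1 p))"

lemma poly_parts_const: "poly_parts 0 (\<lambda>_. c)"
  unfolding poly_parts_def
  by (rule exI[of _ "\<lambda>_. c"], rule exI[of _ "\<lambda>_. 0"]) (auto intro: wpoly.intros)

lemma poly_parts_var: "poly_parts 1 (\<lambda>p. p $ Some i)"
  unfolding poly_parts_def
  using wpoly_var[of "Some i"]
  by (intro exI[of _ "\<lambda>p. p $ Some i"] exI[of _ "\<lambda>_. 0"]) (auto intro: wpoly_zero)

lemma poly_parts_add:
  assumes "poly_parts m f" "poly_parts m g" shows "poly_parts m (\<lambda>p. f p + g p)"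
proof -
  obtain H0 H1 K0 K1 where *: "wpoly (int m) H0" "wpoly (int m - 1) H1" "\<And>p. p $ None = 1 \<Longrightarrow> f p = H0 p + H1 p"
    "wpoly (int m) K0" "wpoly (int m - 1) K1" "\<And>p. p $ None = 1 \<Longrightarrow> g p = K0 p + K1 p"
    using assms unfolding poly_parts_def by blast
  show ?thesis unfolding poly_parts_def
    by (rule exI[of _ "\<lambda>p. H0 p + K0 p"], rule exI[of _ "\<lambda>p. H1 p + K1 p"]) (auto simp: * intro!: wpoly_add)
qed

lemma poly_parts_mult:
  assumes "poly_parts m f" "poly_parts k g" shows "poly_parts (m + k) (\<lambda>p. f p * g p)"
proof -
  obtain H0 H1 K0 K1 where *: "wpoly (int m) H0" "wpoly (int m - 1) H1" "\<And>p. p $ None = 1 \<Longrightarrow> f p = H0 p + H1 p"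
    "wpoly (int k) K0" "wpoly (int k - 1) K1" "\<And>p. p $ None = 1 \<Longrightarrow> g p = K0 p + K1 p"
    using assms unfolding poly_parts_def by blast
  have 0: "wpoly (int (m + k)) (\<lambda>p. H0 p * K0 p + p $ None * (H1 p * K1 p))"
  proof (rule wpoly_add)
    show "wpoly (int (m + k)) (\<lambda>p. H0 p * K0 p)" using wpoly_mult[OF *(1,4)] by simp
    show "wpoly (int (m + k)) (\<lambda>p. p $ None * (H1 p * K1 p))"
      using wpoly_mult[OF wpoly_var[of None] wpoly_mult[OF *(2,5)]] by (simp add: algebra_simps)
  qed
  have 1: "wpoly (int (m + k) - 1) (\<lambda>p. H0 p * K1 p + H1 p * K0 p)"
  proof (rule wpoly_add)
    show "wpoly (int (m + k) - 1) (\<lambda>p. H0 p * K1 p)" using wpoly_mult[OF *(1,5)] by (simp add: algebra_simps)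
    show "wpoly (int (m + k) - 1) (\<lambda>p. H1 p * K0 p)" using wpoly_mult[OF *(2,4)] by (simp add: algebra_simps)
  qed
  show ?thesis unfolding poly_parts_def
    by (intro exI conjI, rule 0, rule 1) (auto simp: * algebra_simps)
qed

lemma poly_parts_Suc:
  assumes "poly_parts m f" shows "poly_parts (Suc m) f"
proof -
  obtain H0 H1 where *: "wpoly (int m) H0" "wpoly (int m - 1) H1" "\<And>p. p $ None = 1 \<Longrightarrow> f p = H0 p + H1 p"
    using assms unfolding poly_parts_def by blast
  have "wpoly (int (Suc m)) (\<lambda>p. p $ None * H1 p)"
    using wpoly_mult[OF wpoly_var[of None] *(2)] by (simp add: algebra_simps)
  moreover have "wpoly (int (Suc m) - 1) H0" using *(1) by simp
  ultimately show ?thesis unfolding poly_parts_def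
    by (intro exI[of _ "\<lambda>p. p $ None * H1 p"] exI[of _ H0]) (auto simp: *)
qed

lemma poly_parts_mono:
  assumes "poly_parts m f" "m \<le> n" shows "poly_parts n f"
  using assms(2,1) by (induction rule: dec_induct) (auto intro: poly_parts_Suc)

lemma poly_parts_power: "poly_parts m f \<Longrightarrow> poly_parts (m * k) (\<lambda>p. f p ^ k)"
  by (induction k) (auto intro: poly_parts_const poly_parts_mult)

lemma poly_parts_prod:
  assumes "finite I" shows "(\<And>i. i \<in> I \<Longrightarrow> poly_parts (m i) (f i)) \<Longrightarrow> poly_parts (\<Sum>i\<in>I. m i) (\<lambda>p. \<Prod>i\<in>I. f i p)"
  using assms by (induction I rule: finite_induct) (auto intro: poly_parts_const poly_parts_mult)

lemma poly_parts_sum: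
  "(\<And>i. i \<in> I \<Longrightarrow> poly_parts m (f i)) \<Longrightarrow> poly_parts m (\<lambda>p. \<Sum>i\<in>I. f i p)"
proof (induction I rule: infinite_finite_induct)
  case (insert x I)
  then show ?case by (auto intro: poly_parts_add)
qed (auto intro: poly_parts_mono[OF poly_parts_const])

lemma poly_parts_of_polynomial:
  fixes P :: "real ^ 'd \<Rightarrow> real"
  assumes "polynomial_degree_le n P"
  obtains H0 H1 where "wpoly (int n) H0" "wpoly (int n - 1) H1"
    "\<And>z. of_real (P (fst z)) = H0 (cpt 1 0 z) + H1 (cpt 1 0 z)"
proof -
  obtain c where P: "\<And>x. P x = (\<Sum>\<alpha> \<in> {\<alpha>. (\<Sum>i\<in>UNIV. \<alpha> i) \<le> n}. c \<alpha> * (\<Prod>i\<in>UNIV. (x $ i) ^ \<alpha> i))"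
    using assms unfolding polynomial_degree_le_def by blast
  define f where "f = (\<lambda>p :: complex ^ 'd option. \<Sum>\<alpha> \<in> {\<alpha>. (\<Sum>i\<in>UNIV. \<alpha> i) \<le> n}. of_real (c \<alpha>) * (\<Prod>i\<in>UNIV. (p $ Some i) ^ \<alpha> i))"
  have "poly_parts n f"
    unfolding f_def
  proof (rule poly_parts_sum)
    fix \<alpha> :: "'d \<Rightarrow> nat" assume \<alpha>: "\<alpha> \<in> {\<alpha>. (\<Sum>i\<in>UNIV. \<alpha> i) \<le> n}"
    have "poly_parts (\<Sum>i\<in>UNIV. \<alpha> i) (\<lambda>p :: complex ^ 'd option. \<Prod>i\<in>UNIV. (p $ Some i) ^ \<alpha> i)"
      using poly_parts_power[OF poly_parts_var, of "\<alpha> _"] by (intro poly_parts_prod) auto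
    then have "poly_parts (0 + (\<Sum>i\<in>UNIV. \<alpha> i)) (\<lambda>p :: complex ^ 'd option. of_real (c \<alpha>) * (\<Prod>i\<in>UNIV. (p $ Some i) ^ \<alpha> i))"
      by (intro poly_parts_mult poly_parts_const)
    then show "poly_parts n (\<lambda>p :: complex ^ 'd option. of_real (c \<alpha>) * (\<Prod>i\<in>UNIV. (p $ Some i) ^ \<alpha> i))"
      using \<alpha> by (auto intro: poly_parts_mono)
  qed
  then obtain H0 H1 where H: "wpoly (int n) H0" "wpoly (int n - 1) H1" "\<And>p. p $ None = 1 \<Longrightarrow> f p = H0 p + H1 p"
    unfolding poly_parts_def by blast
  have "of_real (P (fst z)) = H0 (cpt 1 0 z) + H1 (cpt 1 0 z)" for z
    unfolding H(3)[OF cpt_nth(1), symmetric] P f_def by simp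
  then show thesis using H that by blast
qed

lemma wpoly_cpt_uminus:
  assumes "wpoly w f" shows "f (cpt a b (- z)) = (- 1) powi w * f (cpt a b z)"
proof -
  have "cpt a b (- z) $ j = (\<chi> j. (- 1) powi wt j * cpt a b z $ j) $ j" for j
    by (cases j) simp_all
  then have "cpt a b (- z) = (\<chi> j. (- 1) powi wt j * cpt a b z $ j)" by (simp only: vec_eq_iff) simp
  then show ?thesis using wpoly_scale[OF assms, of "- 1"] by simp
qed

section \<open>The gradient\<close>

lemma gradient_of_holo:
  fixes P :: "real ^ 'd \<Rightarrow> real"
  assumes f: "holo f f'" and tf': "\<And>j. tame (f' j)" and P: "\<And>z. of_real (P (fst z)) = f (cpt 1 0 z)"
  shows "of_real (gradient P (fst z) \<bullet> snd z) = (\<Sum>i\<in>UNIV. f' (Some i) (cpt 1 0 z) * of_real (snd z $ i))" (is ?A)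
    and "tame (gradient P)"
proof -
  let ?c = "\<lambda>x::real ^ 'd. cpt 1 0 (x, 0 :: real ^ 'd)"
  define D where "D = (\<lambda>x. \<chi> i. Re (f' (Some i) (?c x)))"
  have c: "cpt 1 0 z = ?c (fst z)" for z :: "(real ^ 'd) \<times> (real ^ 'd)"
  proof -
    have "cpt 1 0 z $ j = ?c (fst z) $ j" for j by (cases j) simp_all
    then show ?thesis by (simp add: vec_eq_iff)
  qed
  have fd: "((\<lambda>x. f (?c x)) has_derivative (\<lambda>h. \<Sum>i\<in>UNIV. f' (Some i) (?c x) * of_real (h $ i))) (at x)" for x
  proof -
    let ?L = "\<lambda>h::real ^ 'd. (\<chi> j. case j of None \<Rightarrow> 0 | Some i \<Rightarrow> of_real (h $ i)) :: complex ^ 'd option"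
    have bl: "bounded_linear ?L"
      unfolding linear_conv_bounded_linear[symmetric]
      by (rule linearI) (auto simp: vec_eq_iff complex_eq_iff split: option.splits)
    have "?c x = ?c 0 + ?L x" for x by (auto simp: vec_eq_iff cpt_def split: option.splits)
    then have "?c = (\<lambda>x. ?c 0 + ?L x)" by blast
    moreover have "((\<lambda>x. ?c 0 + ?L x) has_derivative ?L) (at x)"
      using has_derivative_add[OF has_derivative_const bounded_linear_imp_has_derivative[OF bl]] by simp
    ultimately have "(?c has_derivative ?L) (at x)" by simp
    moreover have "(f has_derivative (\<lambda>h. \<Sum>j\<in>UNIV. f' j (?c x) * h $ j)) (at (?c x))"
      using f unfolding wirtinger_def by simp
    ultimately have "((\<lambda>x. f (?c x)) has_derivative (\<lambda>h. \<Sum>j\<in>UNIV. f' j (?c x) * ?L h $ j)) (at x)"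
      by (rule has_derivative_compose)
    then show ?thesis by (simp add: UNIV_option_sum)
  qed
  have Pf: "of_real (P x) = f (?c x)" for x using P[of "(x, 0)"] by simp
  have "((\<lambda>x. Re (f (?c x))) has_derivative (\<lambda>h. Re (\<Sum>i\<in>UNIV. f' (Some i) (?c x) * of_real (h $ i)))) (at x)" for x
    by (rule has_derivative_Re[OF fd])
  moreover have "Re (f (?c x)) = P x" for x unfolding Pf[symmetric] by simp
  moreover have "Re (\<Sum>i\<in>UNIV. f' (Some i) (?c x) * of_real (h $ i)) = h \<bullet> D x" for x h
    unfolding D_def inner_vec_def by (simp add: mult.commute)
  ultimately have dP: "(P has_derivative (\<lambda>h. h \<bullet> D x)) (at x)" for x by simp
  then have grad: "gradient P x = D x" for x
    by (intro gradient_eq) (simp add: gderiv_def)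
  have "((\<lambda>x. complex_of_real (P x)) has_derivative (\<lambda>h. of_real (h \<bullet> D x))) (at x)" for x
    by (rule has_derivative_of_real[OF dP])
  then have "((\<lambda>x. f (?c x)) has_derivative (\<lambda>h. of_real (h \<bullet> D x))) (at x)" for x unfolding Pf .
  then have "(\<lambda>h. of_real (h \<bullet> D x)) = (\<lambda>h. \<Sum>i\<in>UNIV. f' (Some i) (?c x) * of_real (h $ i))" for x
    using fd has_derivative_unique by blast
  then have "of_real (h \<bullet> D x) = (\<Sum>i\<in>UNIV. f' (Some i) (?c x) * of_real (h $ i))" for x h by meson
  then show ?A unfolding grad c[of z] by (simp add: inner_commute)
  have tc: "tame ?c"
    by (rule tame_compose[OF tame_cpt]) (intro tame_Pair tame_id tame_const)
  have "tame D"
    unfolding D_def by (rule tame_vec) (simp, intro tame_Re tame_compose[OF tf' tc])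
  then show "tame (gradient P)" using grad by presburger
qed

lemma gaussian_gradient_moment:
  fixes G :: "real ^ 'd \<Rightarrow> real ^ 'd"
  assumes G: "tame G" and p: "p > 0"
  shows "(\<integral>z. \<bar>G (fst z) \<bullet> snd z\<bar> powr p \<partial>gaussian) = abs_moment p * (\<integral>x. norm (G x) powr p \<partial>gaussian)"
proof -
  interpret A: prob_space "gaussian :: (real ^ 'd) measure" by (rule prob_space_gaussian)
  interpret pair_prob_space "gaussian :: (real ^ 'd) measure" "gaussian :: (real ^ 'd) measure" ..
  have "tame (\<lambda>z. \<bar>G (fst z) \<bullet> snd z\<bar> powr p)"
    by (intro tame_compose[OF tame_abs_powr[OF p]] tame_inner tame_compose[OF G] tame_fst tame_snd tame_id)
  then have "integrable (gaussian \<Otimes>\<^sub>M gaussian) (\<lambda>z. \<bar>G (fst z) \<bullet> snd z\<bar> powr p)"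
    unfolding gaussian_pair[symmetric] by (rule integrable_tame)
  from integral_fst'[OF this] show ?thesis
    unfolding gaussian_pair[symmetric] by (simp add: gaussian_abs_inner_powr abs_moment_def mult.commute)
qed

lemma gaussian_fst:
  fixes g :: "'a::euclidean_space \<Rightarrow> real"
  assumes g: "tame g"
  shows "(\<integral>z. g (fst z) \<partial>(gaussian :: ('a \<times> 'b::euclidean_space) measure)) = (\<integral>x. g x \<partial>gaussian)"
proof -
  interpret A: prob_space "gaussian :: 'a measure" by (rule prob_space_gaussian)
  interpret B: prob_space "gaussian :: 'b measure" by (rule prob_space_gaussian)
  interpret pair_prob_space "gaussian :: 'a measure" "gaussian :: 'b measure" ..
  have "tame (\<lambda>z :: 'a \<times> 'b. g (fst z))" by (intro tame_compose[OF g] tame_fst tame_id)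
  then have "integrable (gaussian \<Otimes>\<^sub>M gaussian) (\<lambda>z :: 'a \<times> 'b. g (fst z))"
    unfolding gaussian_pair[symmetric] by (rule integrable_tame)
  from integral_fst'[OF this] show ?thesis
    unfolding gaussian_pair[symmetric] using B.prob_space by simp
qed

section \<open>Moment form of the gradient inequality\<close>

lemma derivative_moment_wpoly:
  fixes f :: "complex ^ 'd::finite option \<Rightarrow> complex"
  assumes f: "wpoly w f" "holo f f'" "\<And>j. tame (f' j)" and w: "w \<le> int n" and n: "n \<ge> 1" and p: "p \<ge> 2"
  shows "(\<integral>z. cmod (\<Sum>i\<in>UNIV. f' (Some i) (cpt 1 0 z) * of_real (snd z $ i)) powr p \<partial>gaussian)
      \<le> (2 * exp 1 * real n) powr (p / 2) * (\<integral>z. cmod (f (cpt 1 0 z)) powr p \<partial>gaussian)"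
proof (rule directional_derivative_moment[OF f(2) wpoly_tame[OF f(1)] f(3) n p])
  show "0 \<le> (\<integral>z. cmod (f (cpt 1 0 z)) powr p \<partial>gaussian)" by (intro Bochner_Integration.integral_nonneg) simp
qed (rule complex_moment_bound[OF f(1) w p])

lemma even_moment_bound:
  fixes f :: "complex ^ 'd::finite option \<Rightarrow> complex"
  assumes f: "poly_parts n f" and k: "k \<ge> 1" and p: "p = 2 * real k" and tf: "tame f"
  shows "(\<integral>z. cmod (f (cpt (of_real (cosh \<eta>)) (\<i> * of_real (sinh \<eta>)) z)) powr p \<partial>gaussian)
    \<le> cosh (2 * \<eta>) powr (real n * p / 2) * (\<integral>z. cmod (f (cpt 1 0 z)) powr p \<partial>gaussian)"
proof -
  obtain G0 G1 where G: "wpoly (int (n * k)) G0" "wpoly (int (n * k) - 1) G1" "\<And>p. p $ None = 1 \<Longrightarrow> f p ^ k = G0 p + G1 p"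
    using poly_parts_power[OF f, of k] unfolding poly_parts_def by blast
  note t = wpoly_tame[OF G(1)] wpoly_tame[OF G(2)]
  have sq: "cmod v powr p = cmod (v ^ k) powr 2" for v
  proof (cases "v = 0")
    case False
    then have "cmod v powr p = (cmod v powr real k) powr 2" unfolding p by (simp only: powr_powr) (simp add: mult.commute)
    then show ?thesis using False by (simp add: powr_realpow norm_power)
  qed (use p k in simp)
  have split: "(\<integral>z. cmod (f (cpt a b z)) powr p \<partial>gaussian)
     = (\<integral>z. cmod (G0 (cpt a b z)) powr 2 \<partial>gaussian) + (\<integral>z. cmod (G1 (cpt a b z)) powr 2 \<partial>gaussian)" for a b
  proof -
    define X where "X = (\<lambda>z. Re (G0 (cpt a b z) * cnj (G1 (cpt a b z))))"
    have expand: "cmod (f (cpt a b z)) powr p = cmod (G0 (cpt a b z)) powr 2 + cmod (G1 (cpt a b z)) powr 2 + 2 * X z" for z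
    proof -
      have "cmod (x + y) powr 2 = cmod x powr 2 + cmod y powr 2 + 2 * Re (x * cnj y)" for x y
      proof -
        have "cmod v powr 2 = (cmod v)\<^sup>2" for v by (cases "v = 0") (auto simp: powr_numeral)
        then show ?thesis by (simp add: cmod_power2) (simp add: power2_eq_square algebra_simps)
      qed
      then show ?thesis unfolding sq G(3)[OF cpt_nth(1)] X_def .
    qed
    have tX: "tame X"
      unfolding X_def by (intro tame_Re tame_mult tame_cnj tame_compose[OF t(1) tame_cpt] tame_compose[OF t(2) tame_cpt])
    have "X (- z) = - X z" for z
    proof -
      have e: "(- 1 :: complex) powi int m = (- 1) ^ m" "(- 1 :: complex) powi (int m - 1) = - ((- 1) ^ m)" for m
        by (simp_all add: power_int_diff)
      show ?thesis
        unfolding X_def wpoly_cpt_uminus[OF G(1)] wpoly_cpt_uminus[OF G(2)] e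
        by (cases "even (n * k)") simp_all
    qed
    then have "(\<integral>z. X (- z) \<partial>gaussian) = - (\<integral>z. X z \<partial>gaussian)" by simp
    then have X0: "(\<integral>z. X z \<partial>gaussian) = 0"
      using gaussian_uminus[OF tame_measurable[OF tX]] by simp
    have "integrable gaussian (\<lambda>z. cmod (G0 (cpt a b z)) powr 2)" "integrable gaussian (\<lambda>z. cmod (G1 (cpt a b z)) powr 2)"
      by (intro integrable_tame tame_powr tame_norm tame_compose[OF t(1) tame_cpt] tame_compose[OF t(2) tame_cpt]; simp)+
    then show ?thesis using integrable_tame[OF tX] unfolding expand by (simp add: X0)
  qed
  have e: "real (n * k) * 2 / 2 = real n * p / 2" unfolding p by simp
  have "(\<integral>z. cmod (G0 (cpt (of_real (cosh \<eta>)) (\<i> * of_real (sinh \<eta>)) z)) powr 2 \<partial>gaussian)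
      \<le> cosh (2 * \<eta>) powr (real n * p / 2) * (\<integral>z. cmod (G0 (cpt 1 0 z)) powr 2 \<partial>gaussian)"
    using complex_moment_bound[OF G(1), of "n * k" 2 \<eta>] unfolding e by simp
  moreover have "(\<integral>z. cmod (G1 (cpt (of_real (cosh \<eta>)) (\<i> * of_real (sinh \<eta>)) z)) powr 2 \<partial>gaussian)
      \<le> cosh (2 * \<eta>) powr (real n * p / 2) * (\<integral>z. cmod (G1 (cpt 1 0 z)) powr 2 \<partial>gaussian)"
    using complex_moment_bound[OF G(2), of "n * k" 2 \<eta>] unfolding e by simp
  ultimately show ?thesis unfolding split by (simp add: distrib_left)
qed


lemma gradient_moment_holo:
  fixes P :: "real ^ 'd \<Rightarrow> real"
  assumes f: "holo f f'" "\<And>j. tame (f' j)" "tame f" and P: "\<And>z. of_real (P (fst z)) = f (cpt 1 0 z)" and p: "p > 0"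
  shows "(\<integral>z. cmod (\<Sum>i\<in>UNIV. f' (Some i) (cpt 1 0 z) * of_real (snd z $ i)) powr p \<partial>gaussian)
      = abs_moment p * (\<integral>x. norm (gradient P x) powr p \<partial>gaussian)"
    and "(\<integral>z. cmod (f (cpt 1 0 z)) powr p \<partial>gaussian) = (\<integral>x. norm (P x) powr p \<partial>gaussian)"
    and "tame P"
proof -
  show "(\<integral>z. cmod (\<Sum>i\<in>UNIV. f' (Some i) (cpt 1 0 z) * of_real (snd z $ i)) powr p \<partial>gaussian)
      = abs_moment p * (\<integral>x. norm (gradient P x) powr p \<partial>gaussian)"
    unfolding gradient_of_holo(1)[OF f(1,2) P, symmetric] norm_of_real
    by (rule gaussian_gradient_moment[OF gradient_of_holo(2)[OF f(1,2) P] p])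
  have "tame (\<lambda>x. Re (f (cpt 1 0 (x, 0 :: real ^ 'd))))"
    by (intro tame_Re tame_compose[OF f(3)] tame_compose[OF tame_cpt] tame_Pair tame_id tame_const)
  moreover have "Re (f (cpt 1 0 (x, 0 :: real ^ 'd))) = P x" for x
    unfolding P[symmetric] by simp
  ultimately show tP: "tame P" by simp
  have "tame (\<lambda>x. norm (P x) powr p)" using p by (intro tame_powr tame_norm tP) auto
  from gaussian_fst[OF this]
  show "(\<integral>z. cmod (f (cpt 1 0 z)) powr p \<partial>gaussian) = (\<integral>x. norm (P x) powr p \<partial>gaussian)"
    unfolding P[symmetric] norm_of_real by simp
qed

lemma gradient_moment_wpoly:
  fixes P :: "real ^ 'd \<Rightarrow> real"
  assumes f: "wpoly w f" and w: "w \<le> int n" and n: "n \<ge> 1" and p: "p \<ge> 2" and P: "\<And>z. of_real (P (fst z)) = f (cpt 1 0 z)"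
  shows "abs_moment p * (\<integral>x. norm (gradient P x) powr p \<partial>gaussian)
    \<le> (2 * exp 1 * real n) powr (p / 2) * (\<integral>x. norm (P x) powr p \<partial>gaussian)"
proof -
  obtain f' where f': "holo f f'" "\<And>j. wpoly (w - wt j) (f' j)" using wpoly_derivative[OF f] by blast
  have p0: "p > 0" using p by simp
  show ?thesis
    using derivative_moment_wpoly[OF f f'(1) wpoly_tame[OF f'(2)] w n p]
    unfolding gradient_moment_holo(1,2)[OF f'(1) wpoly_tame[OF f'(2)] wpoly_tame[OF f] P p0] .
qed

lemma gradient_moment_sharp:
  fixes P :: "real ^ 'd \<Rightarrow> real"
  assumes P: "polynomial_degree_le n P" and n: "n \<ge> 1" and p: "p \<ge> 2"
    and special: "(\<exists>k::int. even k \<and> p = of_int k) \<or> (\<forall>x. P (- x) = P x) \<or> (\<forall>x. P (- x) = - P x)"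
  shows "abs_moment p * (\<integral>x. norm (gradient P x) powr p \<partial>gaussian)
    \<le> (2 * exp 1 * real n) powr (p / 2) * (\<integral>x. norm (P x) powr p \<partial>gaussian)"
proof -
  obtain H0 H1 where H: "wpoly (int n) H0" "wpoly (int n - 1) H1"
    "\<And>z. of_real (P (fst z)) = H0 (cpt 1 0 z) + H1 (cpt 1 0 z)"
    using poly_parts_of_polynomial[OF P] by blast
  have parity: ?thesis if \<tau>: "\<tau> = 1 \<or> \<tau> = - 1" "\<And>x. P (- x) = \<tau> * P x" for \<tau> :: real
  proof -
    have m: "of_real (\<tau> * P (fst z)) = (- 1) ^ n * (H0 (cpt 1 0 z) - H1 (cpt 1 0 z))" for z :: "(real ^ 'd) \<times> (real ^ 'd)"
      using H(3)[of "- z"] unfolding wpoly_cpt_uminus[OF H(1)] wpoly_cpt_uminus[OF H(2)]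
      by (simp add: \<tau>(2) power_int_diff algebra_simps)
    show ?thesis
    proof (cases "\<tau> = (- 1) ^ n")
      case True
      have "of_real (P (fst z)) = H0 (cpt 1 0 z)" for z
        using m[of z] H(3)[of z] True by (cases "even n") (auto simp: complex_eq_iff)
      then show ?thesis by (intro gradient_moment_wpoly[OF H(1) _ n p]) auto
    next
      case False
      then have "\<tau> = - ((- 1) ^ n)" using \<tau>(1) by (cases "even n") auto
      then have "of_real (P (fst z)) = H1 (cpt 1 0 z)" for z
        using m[of z] H(3)[of z] by (cases "even n") (auto simp: complex_eq_iff)
      then show ?thesis by (intro gradient_moment_wpoly[OF H(2) _ n p]) auto
    qed
  qed
  consider "\<exists>k::int. even k \<and> p = of_int k" | "\<forall>x. P (- x) = P x" | "\<forall>x. P (- x) = - P x"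
    using special by blast
  then show ?thesis
  proof cases
    case 1
    then obtain j :: int where j: "p = 2 * of_int j" by (auto elim!: evenE)
    define k where "k = nat j"
    have k: "k \<ge> 1" "p = 2 * real k" using j p unfolding k_def by auto
    let ?f = "\<lambda>q. H0 q + H1 q"
    obtain H0' where H0': "holo H0 H0'" "\<And>j. wpoly (int n - wt j) (H0' j)" using wpoly_derivative[OF H(1)] by blast
    obtain H1' where H1': "holo H1 H1'" "\<And>j. wpoly (int n - 1 - wt j) (H1' j)" using wpoly_derivative[OF H(2)] by blast
    let ?f' = "\<lambda>j q. H0' j q + H1' j q"
    have hf: "holo ?f ?f'" using wirtinger_add[OF H0'(1) H1'(1)] by simp
    have tf: "tame ?f" "\<And>j. tame (?f' j)" by (intro tame_add wpoly_tame[OF H(1)] wpoly_tame[OF H(2)] wpoly_tame[OF H0'(2)] wpoly_tame[OF H1'(2)])+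
    have pp: "poly_parts n ?f" using H(1,2) unfolding poly_parts_def by blast
    have p0: "p > 0" using p by simp
    have "(\<integral>z. cmod (\<Sum>i\<in>UNIV. ?f' (Some i) (cpt 1 0 z) * of_real (snd z $ i)) powr p \<partial>gaussian)
      \<le> (2 * exp 1 * real n) powr (p / 2) * (\<integral>z. cmod (?f (cpt 1 0 z)) powr p \<partial>gaussian)"
    proof (rule directional_derivative_moment[OF hf tf n p])
      show "0 \<le> (\<integral>z. cmod (?f (cpt 1 0 z)) powr p \<partial>gaussian)" by (intro Bochner_Integration.integral_nonneg) simp
    qed (rule even_moment_bound[OF pp k tf(1)])
    then show ?thesis unfolding gradient_moment_holo(1,2)[OF hf tf(2,1) H(3) p0] .
  next
    case 2
    then show ?thesis by (intro parity[of 1]) auto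
  next
    case 3
    then show ?thesis by (intro parity[of "- 1"]) auto
  qed
qed

lemma powr_add_le:
  fixes a b p :: real
  assumes "p > 1" "a \<ge> 0" "b \<ge> 0"
  shows "(a + b) powr p \<le> 2 powr (p - 1) * (a powr p + b powr p)"
proof -
  define m where "m = (a + b) / 2"
  have m: "m \<ge> 0" unfolding m_def using assms by simp
  have "m powr p + p * m powr (p - 1) * (a - m) \<le> a powr p" "m powr p + p * m powr (p - 1) * (b - m) \<le> b powr p"
    using assms m by (intro powr_tangent_line; simp)+
  moreover have "p * m powr (p - 1) * (a - m) + p * m powr (p - 1) * (b - m) = 0"
    unfolding m_def distrib_left[symmetric] by simp
  ultimately have "2 * m powr p \<le> a powr p + b powr p" by linarith
  then have "2 powr (p - 1) * (2 * m powr p) \<le> 2 powr (p - 1) * (a powr p + b powr p)" by (intro mult_left_mono) auto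
  moreover have "2 powr (p - 1) * (2 * m powr p) = (2 * m) powr p"
    by (simp add: powr_mult powr_diff)
  moreover have "2 * m = a + b" unfolding m_def by simp
  ultimately show ?thesis by simp
qed

lemma gradient_moment_general:
  fixes P :: "real ^ 'd \<Rightarrow> real"
  assumes P: "polynomial_degree_le n P" and n: "n \<ge> 1" and p: "p \<ge> 2"
  shows "abs_moment p * (\<integral>x. norm (gradient P x) powr p \<partial>gaussian)
    \<le> 2 powr p * (2 * exp 1 * real n) powr (p / 2) * (\<integral>x. norm (P x) powr p \<partial>gaussian)"
proof -
  obtain H0 H1 where H: "wpoly (int n) H0" "wpoly (int n - 1) H1"
    "\<And>z. of_real (P (fst z)) = H0 (cpt 1 0 z) + H1 (cpt 1 0 z)"
    using poly_parts_of_polynomial[OF P] by blast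
  obtain H0' where H0': "holo H0 H0'" "\<And>j. wpoly (int n - wt j) (H0' j)" using wpoly_derivative[OF H(1)] by blast
  obtain H1' where H1': "holo H1 H1'" "\<And>j. wpoly (int n - 1 - wt j) (H1' j)" using wpoly_derivative[OF H(2)] by blast
  note t = wpoly_tame[OF H(1)] wpoly_tame[OF H(2)] wpoly_tame[OF H0'(2)] wpoly_tame[OF H1'(2)]
  let ?f = "\<lambda>q. H0 q + H1 q" and ?f' = "\<lambda>j q. H0' j q + H1' j q"
  have hf: "holo ?f ?f'" using wirtinger_add[OF H0'(1) H1'(1)] by simp
  have tf: "tame ?f" "\<And>j. tame (?f' j)" by (intro tame_add t)+
  have p0: "p > 0" "p > 1" using p by simp_all
  note hol = gradient_moment_holo[OF hf tf(2,1) H(3) p0(1)]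
  let ?B = "(2 * exp 1 * real n) powr (p / 2)"
  let ?J = "\<integral>x. norm (P x) powr p \<partial>gaussian"
  let ?L0 = "\<lambda>z. \<Sum>i\<in>UNIV. H0' (Some i) (cpt 1 0 z) * of_real (snd z $ i)"
  let ?L1 = "\<lambda>z. \<Sum>i\<in>UNIV. H1' (Some i) (cpt 1 0 z) * of_real (snd z $ i)"
  have tL: "tame ?L0" "tame ?L1"
    by (intro tame_sum tame_mult tame_of_real tame_nth tame_snd tame_id tame_compose[OF t(3) tame_cpt] tame_compose[OF t(4) tame_cpt])+
  have tp: "tame (\<lambda>z. cmod (g z) powr p)" if "tame g" for g :: "(real ^ 'd) \<times> (real ^ 'd) \<Rightarrow> complex"
    using p0 by (intro tame_powr tame_norm that) auto
  have part: "(\<integral>z. cmod (h (cpt 1 0 z)) powr p \<partial>gaussian) \<le> ?J"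
    if h: "\<And>z. h (cpt 1 0 z) = (of_real (P (fst z)) + \<tau> * of_real (P (- fst z))) / 2" and \<tau>: "cmod \<tau> = 1" and th: "tame h" for h \<tau>
  proof -
    have tP: "tame (\<lambda>x. norm (P x) powr p)" using p0 by (intro tame_powr tame_norm hol(3)) auto
    have tPm: "tame (\<lambda>x. norm (P (- x)) powr p)" using p0 by (intro tame_powr tame_norm tame_compose[OF hol(3)] tame_uminus tame_id) auto
    have pt: "cmod (h (cpt 1 0 z)) powr p \<le> (norm (P (fst z)) powr p + norm (P (- fst z)) powr p) / 2" for z
    proof -
      have "cmod (h (cpt 1 0 z)) \<le> (norm (P (fst z)) + norm (P (- fst z))) / 2"
        unfolding h using norm_triangle_ineq[of "of_real (P (fst z))" "\<tau> * of_real (P (- fst z))"]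
        by (simp add: norm_mult \<tau> norm_divide)
      then have "cmod (h (cpt 1 0 z)) powr p \<le> ((norm (P (fst z)) + norm (P (- fst z))) / 2) powr p"
        using p0 by (intro powr_mono2) auto
      also have "\<dots> = (norm (P (fst z)) + norm (P (- fst z))) powr p / 2 powr p" by (subst powr_divide) auto
      also have "\<dots> \<le> 2 powr (p - 1) * (norm (P (fst z)) powr p + norm (P (- fst z)) powr p) / 2 powr p"
        using p0 by (intro divide_right_mono powr_add_le) auto
      also have "\<dots> = (norm (P (fst z)) powr p + norm (P (- fst z)) powr p) / 2" by (simp add: powr_diff)
      finally show ?thesis .
    qed
    have "(\<integral>z. cmod (h (cpt 1 0 z)) powr p \<partial>gaussian) \<le> (\<integral>z. (norm (P (fst z)) powr p + norm (P (- fst z)) powr p) / 2 \<partial>(gaussian :: ((real ^ 'd) \<times> (real ^ 'd)) measure))"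
    proof (rule integral_mono)
      show "integrable gaussian (\<lambda>z. cmod (h (cpt 1 0 z)) powr p)" by (intro integrable_tame tp tame_compose[OF th tame_cpt])
      show "integrable (gaussian :: ((real ^ 'd) \<times> (real ^ 'd)) measure) (\<lambda>z. (norm (P (fst z)) powr p + norm (P (- fst z)) powr p) / 2)"
        by (intro integrable_divide integrable_tame tame_add tame_compose[OF tP] tame_compose[OF tPm] tame_fst tame_id)
    qed (rule pt)
    also have "\<dots> = (\<integral>x. (norm (P x) powr p + norm (P (- x)) powr p) / 2 \<partial>gaussian)"
    proof (rule gaussian_fst[of "\<lambda>x. (norm (P x) powr p + norm (P (- x)) powr p) / 2"])
      have "tame (\<lambda>x. (1 / 2) * (norm (P x) powr p + norm (P (- x)) powr p))" by (intro tame_mult tame_const tame_add tP tPm)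
      then show "tame (\<lambda>x. (norm (P x) powr p + norm (P (- x)) powr p) / 2)" by simp
    qed
    also have "\<dots> = (?J + (\<integral>x. norm (P (- x)) powr p \<partial>gaussian)) / 2"
      using integrable_tame[OF tP] integrable_tame[OF tPm] by simp
    also have "(\<integral>x. norm (P (- x)) powr p \<partial>gaussian) = ?J"
      by (rule gaussian_uminus[OF tame_measurable[OF tP]])
    finally show ?thesis by simp
  qed
  have m: "of_real (P (- fst z)) = (- 1) ^ n * (H0 (cpt 1 0 z) - H1 (cpt 1 0 z))" for z :: "(real ^ 'd) \<times> (real ^ 'd)"
    using H(3)[of "- z"] unfolding wpoly_cpt_uminus[OF H(1)] wpoly_cpt_uminus[OF H(2)]
    by (simp add: power_int_diff algebra_simps)
  have J0: "(\<integral>z. cmod (H0 (cpt 1 0 z)) powr p \<partial>gaussian) \<le> ?J"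
  proof (rule part[of _ "(- 1) ^ n"])
    show "H0 (cpt 1 0 z) = (of_real (P (fst z)) + (- 1) ^ n * of_real (P (- fst z))) / 2" for z
      unfolding m H(3) by (cases "even n") simp_all
  qed (simp_all add: norm_power t)
  have J1: "(\<integral>z. cmod (H1 (cpt 1 0 z)) powr p \<partial>gaussian) \<le> ?J"
  proof (rule part[of _ "- ((- 1) ^ n)"])
    show "H1 (cpt 1 0 z) = (of_real (P (fst z)) + - ((- 1) ^ n) * of_real (P (- fst z))) / 2" for z
      unfolding m H(3) by (cases "even n") simp_all
  qed (simp_all add: norm_power t)
  have K0: "(\<integral>z. cmod (?L0 z) powr p \<partial>gaussian) \<le> ?B * ?J"
    using derivative_moment_wpoly[OF H(1) H0'(1) t(3) _ n p] mult_left_mono[OF J0, of ?B] by simp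
  have K1: "(\<integral>z. cmod (?L1 z) powr p \<partial>gaussian) \<le> ?B * ?J"
    using derivative_moment_wpoly[OF H(2) H1'(1) t(4) _ n p] mult_left_mono[OF J1, of ?B] by simp
  have "abs_moment p * (\<integral>x. norm (gradient P x) powr p \<partial>gaussian) = (\<integral>z. cmod (?L0 z + ?L1 z) powr p \<partial>gaussian)"
    unfolding hol(1)[symmetric] by (simp add: distrib_right sum.distrib)
  also have "\<dots> \<le> (\<integral>z. 2 powr (p - 1) * (cmod (?L0 z) powr p + cmod (?L1 z) powr p) \<partial>gaussian)"
  proof (rule integral_mono)
    show "integrable gaussian (\<lambda>z. cmod (?L0 z + ?L1 z) powr p)" by (intro integrable_tame tp tame_add tL)
    show "integrable gaussian (\<lambda>z. 2 powr (p - 1) * (cmod (?L0 z) powr p + cmod (?L1 z) powr p))"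
      by (intro integrable_tame tame_mult tame_const tame_add tp tL)
    show "cmod (?L0 z + ?L1 z) powr p \<le> 2 powr (p - 1) * (cmod (?L0 z) powr p + cmod (?L1 z) powr p)" for z
    proof -
      have "cmod (?L0 z + ?L1 z) powr p \<le> (cmod (?L0 z) + cmod (?L1 z)) powr p"
        using p0 by (intro powr_mono2 norm_triangle_ineq) auto
      also have "\<dots> \<le> 2 powr (p - 1) * (cmod (?L0 z) powr p + cmod (?L1 z) powr p)"
        using p0 by (intro powr_add_le) auto
      finally show ?thesis .
    qed
  qed
  also have "\<dots> = 2 powr (p - 1) * ((\<integral>z. cmod (?L0 z) powr p \<partial>gaussian) + (\<integral>z. cmod (?L1 z) powr p \<partial>gaussian))"
    using integrable_tame[OF tp[OF tL(1)]] integrable_tame[OF tp[OF tL(2)]] by simp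
  also have "\<dots> \<le> 2 powr (p - 1) * (?B * ?J + ?B * ?J)" by (intro mult_left_mono add_mono K0 K1) auto
  also have "\<dots> = 2 powr p * ?B * ?J" by (simp add: powr_diff)
  finally show ?thesis .
qed

lemma Lp_norm_le_of_moments:
  assumes "p \<ge> 2" "c \<ge> 0"
    and le: "abs_moment p * (\<integral>x. norm (f x) powr p \<partial>M) \<le> c powr p * (\<integral>x. norm (g x) powr p \<partial>N)"
  shows "Lp_norm M p f \<le> c / gauss_moment p * Lp_norm N p g"
    and "Lp_norm M p f \<le> c / sqrt (p / exp 1) * Lp_norm N p g"
proof -
  let ?I = "\<integral>x. norm (f x) powr p \<partial>M" and ?J = "\<integral>x. norm (g x) powr p \<partial>N"
  have I: "?I \<ge> 0" "?J \<ge> 0" by (intro Bochner_Integration.integral_nonneg; simp)+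
  have am: "abs_moment p \<ge> 1" by (rule abs_moment_ge_1[OF assms(1)])
  then have gm: "gauss_moment p > 0" unfolding gauss_moment_eq by simp
  have "(abs_moment p * ?I) powr (1 / p) \<le> (c powr p * ?J) powr (1 / p)"
    using assms(1) am I by (intro powr_mono2 le) auto
  then have "gauss_moment p * Lp_norm M p f \<le> c * Lp_norm N p g"
    unfolding gauss_moment_eq Lp_norm_def using assms(1,2) by (simp add: powr_mult powr_powr)
  then show 1: "Lp_norm M p f \<le> c / gauss_moment p * Lp_norm N p g"
    using gm by (simp add: field_simps)
  have "c / gauss_moment p \<le> c / sqrt (p / exp 1)"
    using gauss_moment_lower[OF assms(1)] assms(1,2) by (intro divide_left_mono) (auto intro!: mult_pos_pos gm)
  then have "c / gauss_moment p * Lp_norm N p g \<le> c / sqrt (p / exp 1) * Lp_norm N p g"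
    by (intro mult_right_mono) (simp_all add: Lp_norm_def)
  with 1 show "Lp_norm M p f \<le> c / sqrt (p / exp 1) * Lp_norm N p g" by linarith
qed

theorem theorem1p2:
  fixes P :: "real ^ 'd \<Rightarrow> real" and n :: nat and p :: real
  assumes "n \<ge> 1"
    and "polynomial_degree_le n P"
    and "p \<ge> 2"
  shows "(\<exists>c>0. \<exists>C>0. \<forall>q::real. q \<ge> 2 \<longrightarrow>
            c * sqrt q \<le> gauss_moment q \<and> gauss_moment q \<le> C * sqrt q)
    \<and> Lp_norm gaussian p (gradient P)
        \<le> 2 * sqrt (2 * exp 1 * real n) / gauss_moment p * Lp_norm gaussian p P
    \<and> Lp_norm gaussian p (gradient P)
        \<le> 2 * exp 1 * sqrt 2 * sqrt (real n / p) * Lp_norm gaussian p P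
    \<and> ((\<exists>k::int. even k \<and> p = of_int k) \<or> (\<forall>x. P (- x) = P x) \<or> (\<forall>x. P (- x) = - P x) \<longrightarrow>
         Lp_norm gaussian p (gradient P)
           \<le> sqrt (2 * exp 1 * real n) / gauss_moment p * Lp_norm gaussian p P
       \<and> Lp_norm gaussian p (gradient P)
           \<le> exp 1 * sqrt 2 * sqrt (real n / p) * Lp_norm gaussian p P)"
proof (intro conjI impI)
  let ?s = "sqrt (2 * exp 1 * real n)"
  have s: "?s powr p = (2 * exp 1 * real n) powr (p / 2)"
  proof -
    have "?s = (2 * exp 1 * real n) powr (1 / 2)" by (rule powr_half_sqrt[symmetric]) simp
    then show ?thesis by (simp add: powr_powr)
  qed
  have const: "?s / sqrt (p / exp 1) = exp 1 * sqrt 2 * sqrt (real n / p)"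
  proof -
    have "?s / sqrt (p / exp 1) = sqrt ((exp 1)\<^sup>2 * (2 * (real n / p)))"
      unfolding real_sqrt_divide[symmetric] using assms(3) by (simp add: power2_eq_square field_simps)
    also have "\<dots> = exp 1 * (sqrt 2 * sqrt (real n / p))"
      unfolding real_sqrt_mult real_sqrt_abs by simp
    finally show ?thesis by simp
  qed
  show "\<exists>c>0. \<exists>C>0. \<forall>q::real. q \<ge> 2 \<longrightarrow> c * sqrt q \<le> gauss_moment q \<and> gauss_moment q \<le> C * sqrt q"
  proof -
    obtain C where C: "C > 0" "\<And>q. q \<ge> 2 \<Longrightarrow> gauss_moment q \<le> C * sqrt q"
      using gauss_moment_upper by blast
    have "sqrt (1 / exp 1) * sqrt q \<le> gauss_moment q" if "q \<ge> 2" for q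
      using gauss_moment_lower[OF that] unfolding real_sqrt_mult[symmetric] by simp
    then show ?thesis using C by (intro exI[of _ "sqrt (1 / exp 1)"]) auto
  qed
  have g: "abs_moment p * (\<integral>x. norm (gradient P x) powr p \<partial>gaussian) \<le> (2 * ?s) powr p * (\<integral>x. norm (P x) powr p \<partial>gaussian)"
    using gradient_moment_general[OF assms(2,1,3)] by (simp add: powr_mult s)
  have g0: "0 \<le> 2 * ?s" by simp
  show "Lp_norm gaussian p (gradient P) \<le> 2 * ?s / gauss_moment p * Lp_norm gaussian p P"
    by (rule Lp_norm_le_of_moments(1)[OF assms(3) g0 g])
  have "2 * ?s / sqrt (p / exp 1) = 2 * exp 1 * sqrt 2 * sqrt (real n / p)"
    using const by simp
  then show "Lp_norm gaussian p (gradient P) \<le> 2 * exp 1 * sqrt 2 * sqrt (real n / p) * Lp_norm gaussian p P"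
    using Lp_norm_le_of_moments(2)[OF assms(3) g0 g] by simp
  assume special: "(\<exists>k::int. even k \<and> p = of_int k) \<or> (\<forall>x. P (- x) = P x) \<or> (\<forall>x. P (- x) = - P x)"
  have h: "abs_moment p * (\<integral>x. norm (gradient P x) powr p \<partial>gaussian) \<le> ?s powr p * (\<integral>x. norm (P x) powr p \<partial>gaussian)"
    using gradient_moment_sharp[OF assms(2,1,3) special] by (simp only: s)
  have h0: "0 \<le> ?s" by simp
  show "Lp_norm gaussian p (gradient P) \<le> ?s / gauss_moment p * Lp_norm gaussian p P"
    by (rule Lp_norm_le_of_moments(1)[OF assms(3) h0 h])
  show "Lp_norm gaussian p (gradient P) \<le> exp 1 * sqrt 2 * sqrt (real n / p) * Lp_norm gaussian p P"
    using Lp_norm_le_of_moments(2)[OF assms(3) h0 h] unfolding const .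
qed

end
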